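(* Let $G$ be a finite group, let $p$ be a prime divisor of $|G|$, and let $S$ be a Sylow $p$-subgroup of $G$. Suppose that there exists a subgroup $D$ of $S$ with $1<|D|<|S|$ such that every subgroup of $S$ of order $|D|$ is a strong $CAP$-subgroup of $G$ and, if $S$ is non-abelian and $|D|=p=2$, every cyclic subgroup of $S$ of order $4$ is a strong $CAP$-subgroup of $G$. Then the fusion system $\mathcal{F}_S(G)$ is supersolvable.
   Context: All groups are finite. For a subgroup $A$ of a group $G$ and a chief factor $H/K$ of $G$, $A$ covers $H/K$ if $HA=KA$, and avoids $H/K$ if $H\cap A=K\cap A$. $A$ is a $CAP$-subgroup of $G$ if it covers or avoids every chief factor of $G$. $A$ is a strong $CAP$-subgroup of $G$ if $A$ is a $CAP$-subgroup of $H$ for every subgroup $H$ of $G$ with $A\leq H$. For a finite group $G$ and a Sylow $p$-subgroup $S$ of $G$, $\mathcal{F}_S(G)$ is the fusion system over $S$ whose objects are the subgroups of $S$ and whose morphisms $P\to Q$ are the homomorphisms induced by conjugation by elements $g\in G$ with $P^g\leq Q$. For a fusion system $\mathcal{F}$ over $S$, a subgroup $T\leq S$ is strongly $\mathcal{F}$-closed if $\varphi(R)\leq T$ for every $R\leq T$ and every $\mathcal{F}$-morphism $\varphi:R\to S$. $\mathcal{F}$ is supersolvable if there is a series $1=S_0\leq S_1\leq\cdots\leq S_n=S$ of strongly $\mathcal{F}$-closed subgroups of $S$ such that $S_{i+1}/S_i$ is cyclic for all $0\leq i<n$. *)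

theory Defs
  imports "HOL-Algebra.Algebra"
begin

definition sylow_subgroup :: "nat \<Rightarrow> ('a, 'b) monoid_scheme \<Rightarrow> 'a set \<Rightarrow> bool"
  where "sylow_subgroup p G S \<longleftrightarrow>
    subgroup S G \<and> card S = p ^ multiplicity p (order G)"

definition chief_factor :: "('a, 'b) monoid_scheme \<Rightarrow> 'a set \<Rightarrow> 'a set \<Rightarrow> bool"
  where "chief_factor G H K \<longleftrightarrow>
    H \<lhd> G \<and> K \<lhd> G \<and> K \<subset> H \<and> \<not> (\<exists>N. N \<lhd> G \<and> K \<subset> N \<and> N \<subset> H)"

definition covers :: "('a, 'b) monoid_scheme \<Rightarrow> 'a set \<Rightarrow> 'a set \<Rightarrow> 'a set \<Rightarrow> bool"
  where "covers G A H K \<longleftrightarrow> H <#>\<^bsub>G\<^esub> A = K <#>\<^bsub>G\<^esub> A"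

definition avoids :: "'a set \<Rightarrow> 'a set \<Rightarrow> 'a set \<Rightarrow> bool"
  where "avoids A H K \<longleftrightarrow> H \<inter> A = K \<inter> A"

definition CAP_subgroup :: "'a set \<Rightarrow> ('a, 'b) monoid_scheme \<Rightarrow> bool"
  where "CAP_subgroup A G \<longleftrightarrow>
    subgroup A G \<and> (\<forall>H K. chief_factor G H K \<longrightarrow> covers G A H K \<or> avoids A H K)"

definition strong_CAP_subgroup :: "'a set \<Rightarrow> ('a, 'b) monoid_scheme \<Rightarrow> bool"
  where "strong_CAP_subgroup A G \<longleftrightarrow>
    subgroup A G \<and>
    (\<forall>H. subgroup H G \<and> A \<subseteq> H \<longrightarrow> CAP_subgroup A (G\<lparr>carrier := H\<rparr>))"

text \<open>
  A fusion system over a group is given by its morphism sets, indexed by source and target;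
  the objects are the subgroups of the group. Morphisms with source \<open>P\<close> are functions
  restricted to \<open>P\<close>, so that different group elements inducing the same map on \<open>P\<close>
  give the same morphism.
\<close>

type_synonym 'a fusion = "'a set \<Rightarrow> 'a set \<Rightarrow> ('a \<Rightarrow> 'a) set"

definition group_fusion :: "('a, 'b) monoid_scheme \<Rightarrow> 'a set \<Rightarrow> 'a fusion"
  where "group_fusion G S P Q =
    {\<phi>. subgroup P (G\<lparr>carrier := S\<rparr>) \<and> subgroup Q (G\<lparr>carrier := S\<rparr>) \<and>
        (\<exists>g \<in> carrier G. \<phi> = (\<lambda>x\<in>P. inv\<^bsub>G\<^esub> g \<otimes>\<^bsub>G\<^esub> x \<otimes>\<^bsub>G\<^esub> g) \<and> \<phi> ` P \<subseteq> Q)}"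

definition strongly_closed :: "('a, 'b) monoid_scheme \<Rightarrow> 'a fusion \<Rightarrow> 'a set \<Rightarrow> bool"
  where "strongly_closed S F T \<longleftrightarrow>
    subgroup T S \<and>
    (\<forall>R \<phi>. subgroup R (S\<lparr>carrier := T\<rparr>) \<and> \<phi> \<in> F R (carrier S) \<longrightarrow> \<phi> ` R \<subseteq> T)"

text \<open>
  The quotients below are genuine groups: in a fusion system over \<open>S\<close>, conjugations by
  elements of \<open>S\<close> are morphisms, hence strongly closed subgroups are normal in \<open>S\<close>.
\<close>

definition supersolvable_fusion :: "('a, 'b) monoid_scheme \<Rightarrow> 'a fusion \<Rightarrow> bool"
  where "supersolvable_fusion S F \<longleftrightarrow>
    (\<exists>(n::nat) T. T 0 = {\<one>\<^bsub>S\<^esub>} \<and> T n = carrier S \<and>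
       (\<forall>i\<le>n. strongly_closed S F (T i)) \<and>
       (\<forall>i<n. T i \<subseteq> T (Suc i) \<and> cyclic_group (S\<lparr>carrier := T (Suc i)\<rparr> Mod T i)))"

end

theory Submission
  imports Defs "HOL-Number_Theory.Residue_Primitive_Roots"
begin

text \<open>
  Write $|D| = p^d$. If $P \le S$ with $|P| > p^d$ is normal in $H \le G$, then every
  $H$-chief factor below $P$ has order $p$: otherwise some $p'$-element $h$ of prime power
  order acts trivially on all $H$-factors of order $p$ but not on $P$. Let $N$ be the least
  $H$-invariant subgroup containing $[P,h]$ and $N/K$ an $H$-chief factor; then $N/K$ is not
  cyclic, and one finds $A$ of order $p^d$ (or cyclic of order 4) with $A \cap N \not\le K$ and
  $K(A \cap N) \ne N$, so $A$ neither covers nor avoids $N/K$. Thus $H$ acts on an $H$-chief factor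
  below $P$ as an abelian group of exponent dividing $p - 1$, that is, by scalars.
  Hence $N_G(P)/C_G(P)$ is $p$-closed, and Alperin's argument shows that $N_G(S)$ controls the fusion
  of subgroups of $S$ of order greater than $p^d$.

  On the other side, there is a normal subgroup $Y$ of $G$ with $|S \cap Y| = p^d$, and all
  chief factors $V/U$ of $G$ below $Y$ satisfy $|S \cap V : S \cap U| \le p$. If one of them were larger,
  take the highest; a $p'$-group $Q$ acting nontrivially on $V/U$, but trivially on all
  factors of order $p$, yields a subgroup of $S$ of order $p^{d+1}$ with a maximal subgroup not
  containing $S \cap V$, which again contradicts the cover-avoidance property.

  The strongly closed series consists of the intersections of $S$ with a chief series of $G$ up to $Y$,
  continued by an $N_G(S)$-chief series from $S \cap Y$ to $S$.
\<close>


section \<open>Conjugation, congruence modulo a subgroup, and fixed points of group actions\<close>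

text \<open>What shapes the proof is a change of regime at the order \<open>p^d\<close>. Subgroups
  of \<open>S\<close> above it have room for test subgroups \<open>A\<close>, which makes the action
  of their normalizers rigid. Below it no such control is available, so strong closure has to come
  from normal subgroups of \<open>G\<close>; these need not be p-groups, hence only their
  intersections with \<open>S\<close> are measured. The halves fit because no chief factor of
  \<open>G\<close> jumps across \<open>p^d\<close>, so \<open>Y\<close> attains exactly this order;
  an element outside \<open>Y\<close> then generates with \<open>S \<inter> Y\<close> a subgroup of
  larger order, to which control of fusion applies. The test subgroup against \<open>N/K\<close> is
  found as follows. If \<open>|N| \<le> p^d\<close>, the fixed points of \<open>h\<close> modulo
  \<open>K\<close> lie in a maximal subgroup of \<open>P\<close>; it cuts \<open>N\<close> in a
  hyperplane, and \<open>A\<close> is put between the two. If \<open>|N| > p^d\<close>, the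
  hypothesis forces every element of \<open>N - K\<close> to have order above \<open>p^d\<close>,
  while \<open>N\<close> has class at most two and a commutator \<open>[x,h]\<close> outside
  \<open>K\<close> has order at most \<open>p\<close>, except that for \<open>p = 2\<close> it may
  have order 4. This is where the extra hypothesis on cyclic subgroups of order 4 comes
  from.\<close>

locale fin_group = group +
  assumes fin [simp, intro]: "finite (carrier G)"

text \<open>The right action \<open>x^g\<close>, in the convention of the morphisms of
  \<open>group_fusion\<close>; iterating it multiplies the conjugating elements from left to
  right.\<close>

definition (in group) conj_by :: "'a \<Rightarrow> 'a \<Rightarrow> 'a"
  where "conj_by g x = inv g \<otimes> x \<otimes> g"

text \<open>\<open>H\<close> may be any set: the notion is applied to \<open>{h}\<close>, to
  p-groups acting on subgroups that do not lie in them, and to the whole carrier, where it means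
  normality in \<open>G\<close>.\<close>

definition (in group) normalized_by :: "'a set \<Rightarrow> 'a set \<Rightarrow> bool"
  where "normalized_by H N \<longleftrightarrow> subgroup N G \<and> (\<forall>h\<in>H. \<forall>x\<in>N. conj_by h x \<in> N)"

text \<open>Equality of the left cosets of \<open>K\<close>; so \<open>cong_mod K x (conj_by h x)\<close> says $[x,h] \in K$.\<close>
definition (in group) cong_mod :: "'a set \<Rightarrow> 'a \<Rightarrow> 'a \<Rightarrow> bool"
  where "cong_mod K x y \<longleftrightarrow> inv x \<otimes> y \<in> K"

context group
begin

lemma inv_cancel:
  assumes "x \<in> carrier G" "y \<in> carrier G"
  shows "x \<otimes> (inv x \<otimes> y) = y" "inv x \<otimes> (x \<otimes> y) = y"
  using assms by (simp_all add: m_assoc[symmetric])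

lemmas group_word_simps = m_assoc inv_mult_group inv_cancel

lemma sub_carrier: "subgroup H G \<Longrightarrow> x \<in> H \<Longrightarrow> x \<in> carrier G"
  by (rule subgroup.mem_carrier)

lemma conj_by_closed [simp, intro]: "g \<in> carrier G \<Longrightarrow> x \<in> carrier G \<Longrightarrow> conj_by g x \<in> carrier G"
  by (simp add: conj_by_def)

lemma conj_by_mult: "g \<in> carrier G \<Longrightarrow> x \<in> carrier G \<Longrightarrow> y \<in> carrier G \<Longrightarrow>
    conj_by g (x \<otimes> y) = conj_by g x \<otimes> conj_by g y"
  by (simp add: conj_by_def group_word_simps)

lemma conj_by_conj_by: "g \<in> carrier G \<Longrightarrow> h \<in> carrier G \<Longrightarrow> x \<in> carrier G \<Longrightarrow>
    conj_by h (conj_by g x) = conj_by (g \<otimes> h) x"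
  by (simp add: conj_by_def group_word_simps)

lemma conj_by_one [simp]: "g \<in> carrier G \<Longrightarrow> conj_by g \<one> = \<one>"
  by (simp add: conj_by_def)

lemma conj_by_one_left [simp]: "x \<in> carrier G \<Longrightarrow> conj_by \<one> x = x"
  by (simp add: conj_by_def)

lemma conj_by_inv: "g \<in> carrier G \<Longrightarrow> x \<in> carrier G \<Longrightarrow> conj_by g (inv x) = inv (conj_by g x)"
  by (simp add: conj_by_def group_word_simps)

lemma conj_by_pow: "g \<in> carrier G \<Longrightarrow> x \<in> carrier G \<Longrightarrow> conj_by g (x [^] (n::nat)) = conj_by g x [^] n"
  by (induction n) (simp_all add: conj_by_mult)

lemma conj_by_cancel [simp]: "g \<in> carrier G \<Longrightarrow> x \<in> carrier G \<Longrightarrow> conj_by (inv g) (conj_by g x) = x"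
  "g \<in> carrier G \<Longrightarrow> x \<in> carrier G \<Longrightarrow> conj_by g (conj_by (inv g) x) = x"
  by (simp_all add: conj_by_conj_by)

lemma conj_by_inj: "g \<in> carrier G \<Longrightarrow> inj_on (conj_by g) (carrier G)"
  by (metis conj_by_cancel(1) inj_on_inverseI)

lemma card_conj_by_image: "g \<in> carrier G \<Longrightarrow> A \<subseteq> carrier G \<Longrightarrow> card (conj_by g ` A) = card A"
  by (rule card_image, rule inj_on_subset[OF conj_by_inj])

lemma conj_by_image_subgroup:
  assumes g: "g \<in> carrier G" and H: "subgroup H G"
  shows "subgroup (conj_by g ` H) G"
proof (rule subgroupI)
  show "conj_by g ` H \<subseteq> carrier G" using g sub_carrier[OF H] by auto
  show "conj_by g ` H \<noteq> {}" using subgroup.one_closed[OF H] by auto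
  fix a assume "a \<in> conj_by g ` H"
  then obtain x where x: "x \<in> H" "a = conj_by g x" by auto
  then show "inv a \<in> conj_by g ` H"
    using g H conj_by_inv[of g x] by (metis image_eqI sub_carrier subgroup.m_inv_closed)
  fix b assume "b \<in> conj_by g ` H"
  then obtain y where y: "y \<in> H" "b = conj_by g y" by auto
  then show "a \<otimes> b \<in> conj_by g ` H"
    using x g H conj_by_mult[of g x y] by (metis image_eqI sub_carrier subgroup.m_closed)
qed

lemma normalized_by_subgroup: "normalized_by H N \<Longrightarrow> subgroup N G"
  by (simp add: normalized_by_def)

lemma normalized_by_conj_by: "normalized_by H N \<Longrightarrow> h \<in> H \<Longrightarrow> x \<in> N \<Longrightarrow> conj_by h x \<in> N"
  by (simp add: normalized_by_def)

lemma normalized_by_mono: "normalized_by H N \<Longrightarrow> H' \<subseteq> H \<Longrightarrow> normalized_by H' N"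
  by (auto simp: normalized_by_def)

lemma normalized_by_self: "subgroup H G \<Longrightarrow> normalized_by H H"
  by (auto simp: normalized_by_def conj_by_def subgroup.m_closed subgroup.m_inv_closed)

lemma normalized_by_Int: "normalized_by H A \<Longrightarrow> normalized_by H B \<Longrightarrow> normalized_by H (A \<inter> B)"
  by (auto simp: normalized_by_def intro: subgroups_Inter_pair)

lemma normalized_by_one: "H \<subseteq> carrier G \<Longrightarrow> normalized_by H {\<one>}"
  by (auto simp: normalized_by_def triv_subgroup)

lemma subgroup_pow_closed: "subgroup H G \<Longrightarrow> x \<in> H \<Longrightarrow> x [^] (n::nat) \<in> H"
  by (induction n) (auto simp: subgroup.one_closed subgroup.m_closed)

lemma sub_mult_left_iff:
  assumes "subgroup H G" "x \<in> H" "y \<in> carrier G"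
  shows "x \<otimes> y \<in> H \<longleftrightarrow> y \<in> H"
  by (metis assms inv_cancel(2) sub_carrier subgroup.m_closed subgroup.m_inv_closed)

lemma sub_mult_right_iff:
  assumes "subgroup H G" "x \<in> H" "y \<in> carrier G"
  shows "y \<otimes> x \<in> H \<longleftrightarrow> y \<in> H"
  by (metis assms inv_solve_right' sub_carrier subgroup.m_closed subgroup.m_inv_closed)

lemma sub_inv_iff: "subgroup H G \<Longrightarrow> x \<in> carrier G \<Longrightarrow> inv x \<in> H \<longleftrightarrow> x \<in> H"
  by (metis inv_inv subgroup.m_inv_closed)

lemma cong_mod_refl: "subgroup K G \<Longrightarrow> x \<in> carrier G \<Longrightarrow> cong_mod K x x"
  by (simp add: cong_mod_def subgroup.one_closed)

lemma cong_mod_sym: "subgroup K G \<Longrightarrow> x \<in> carrier G \<Longrightarrow> y \<in> carrier G \<Longrightarrow> cong_mod K x y \<Longrightarrow> cong_mod K y x"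
  unfolding cong_mod_def by (metis inv_closed inv_inv inv_mult_group subgroup.m_inv_closed)

lemma cong_mod_trans: "subgroup K G \<Longrightarrow> x \<in> carrier G \<Longrightarrow> y \<in> carrier G \<Longrightarrow> z \<in> carrier G \<Longrightarrow>
   cong_mod K x y \<Longrightarrow> cong_mod K y z \<Longrightarrow> cong_mod K x z"
proof -
  assume K: "subgroup K G" and c: "x \<in> carrier G" "y \<in> carrier G" "z \<in> carrier G"
    and "cong_mod K x y" "cong_mod K y z"
  then have "(inv x \<otimes> y) \<otimes> (inv y \<otimes> z) \<in> K"
    using subgroup.m_closed[OF K] unfolding cong_mod_def by simp
  then show ?thesis using c by (simp add: cong_mod_def group_word_simps)
qed

lemma cong_mod_mult:
  assumes K: "normalized_by N K" and N: "subgroup N G" and "x \<in> N" "x' \<in> N" "y \<in> N" "y' \<in> N"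
    and xx: "cong_mod K x x'" and yy: "cong_mod K y y'"
  shows "cong_mod K (x \<otimes> y) (x' \<otimes> y')"
proof -
  have c: "x \<in> carrier G" "x' \<in> carrier G" "y \<in> carrier G" "y' \<in> carrier G"
    using assms sub_carrier by auto
  have "conj_by y (inv x \<otimes> x') \<otimes> (inv y \<otimes> y') \<in> K"
    using normalized_by_conj_by[OF K \<open>y \<in> N\<close>] xx yy subgroup.m_closed[OF normalized_by_subgroup[OF K]]
    unfolding cong_mod_def by simp
  then show ?thesis using c by (simp add: cong_mod_def conj_by_def group_word_simps)
qed

lemma cong_mod_pow:
  assumes K: "normalized_by N K" and N: "subgroup N G" and "x \<in> N" "x' \<in> N"
    and xx: "cong_mod K x x'"
  shows "cong_mod K (x [^] (n::nat)) (x' [^] n)"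
proof (induction n)
  case 0 show ?case by (simp add: cong_mod_refl normalized_by_subgroup[OF K])
next
  case (Suc n)
  show ?case
    using cong_mod_mult[OF K N _ _ assms(3,4) Suc xx] subgroup_pow_closed[OF N] assms by simp
qed

lemma cong_mod_conj_by:
  assumes K: "normalized_by H K" and "h \<in> H" "h \<in> carrier G" "x \<in> carrier G" "y \<in> carrier G"
    "cong_mod K x y"
  shows "cong_mod K (conj_by h x) (conj_by h y)"
proof -
  have "conj_by h (inv x \<otimes> y) \<in> K" using assms normalized_by_conj_by[OF K] unfolding cong_mod_def by simp
  then show ?thesis using assms by (simp add: cong_mod_def conj_by_mult conj_by_inv)
qed

lemma cong_mod_in:
  assumes "subgroup K G" "subgroup L G" "K \<subseteq> L" "x \<in> carrier G" "y \<in> carrier G" "cong_mod K x y"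
  shows "x \<in> L \<longleftrightarrow> y \<in> L"
proof -
  have "inv x \<otimes> y \<in> L" using assms by (auto simp: cong_mod_def)
  then show ?thesis
    using assms sub_mult_left_iff[OF assms(2), of "inv x" y]
      sub_mult_right_iff[OF assms(2), of y "inv x"]
      sub_inv_iff[OF assms(2), of x] by auto
qed

lemma cong_mod_one: "x \<in> carrier G \<Longrightarrow> cong_mod K \<one> x \<longleftrightarrow> x \<in> K"
  by (simp add: cong_mod_def)

lemma cong_mod_mono: "cong_mod K x y \<Longrightarrow> K \<subseteq> L \<Longrightarrow> cong_mod L x y"
  by (auto simp: cong_mod_def)

lemma cong_mod_triv: "x \<in> carrier G \<Longrightarrow> y \<in> carrier G \<Longrightarrow> cong_mod {\<one>} x y \<longleftrightarrow> x = y"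
  using inv_equality[of "inv x" y] inv_comm[of "inv x" y] by (auto simp: cong_mod_def)

end

section \<open>Orders of subgroups and orbit counting in finite groups\<close>

context fin_group
begin

lemma fin_sub [simp]: "subgroup H G \<Longrightarrow> finite H"
  using finite_subset[OF subgroup.subset fin] .

lemma card_pos: "subgroup H G \<Longrightarrow> 0 < card H"
  using subgroup.finite_imp_card_positive[OF _ fin] .

lemma fin_subgroupI:
  assumes "N \<subseteq> carrier G" "\<one> \<in> N" "\<And>x y. x \<in> N \<Longrightarrow> y \<in> N \<Longrightarrow> x \<otimes> y \<in> N"
  shows "subgroup N G"
proof (rule subgroupI)
  fix a assume a: "a \<in> N"
  have pow: "a [^] (n::nat) \<in> N" for n by (induction n) (use assms a in auto)
  have ac: "a \<in> carrier G" using a assms by auto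
  have "a [^] ord a = \<one>" using ac by simp
  moreover have "ord a > 0" using ac ord_ge_1[OF fin ac] by simp
  ultimately have "a [^] (ord a - 1) \<otimes> a = \<one>"
    by (metis Suc_diff_1 nat_pow_Suc)
  then have "inv a = a [^] (ord a - 1)" using ac inv_equality by auto
  then show "inv a \<in> N" using pow by simp
qed (use assms in auto)

lemma card_sub_dvd:
  assumes "subgroup K G" "subgroup H G" "K \<subseteq> H"
  shows "card K dvd card H"
proof -
  interpret H: group "G\<lparr>carrier := H\<rparr>" using assms(2) by (rule subgroup_imp_group)
  have "subgroup K (G\<lparr>carrier := H\<rparr>)" using assms subgroup_incl by blast
  then have "card (rcosets\<^bsub>G\<lparr>carrier := H\<rparr>\<^esub> K) * card K = order (G\<lparr>carrier := H\<rparr>)"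
    using H.lagrange by blast
  then have "order (G\<lparr>carrier := H\<rparr>) = card (rcosets\<^bsub>G\<lparr>carrier := H\<rparr>\<^esub> K) * card K" by simp
  then show ?thesis by (simp add: order_def)
qed

lemma card_cosets_mult:
  assumes "subgroup K G" "subgroup H G" "K \<subseteq> H"
  shows "card ((\<lambda>h. K #> h) ` H) * card K = card H"
proof -
  interpret H: group "G\<lparr>carrier := H\<rparr>" using assms(2) by (rule subgroup_imp_group)
  have "subgroup K (G\<lparr>carrier := H\<rparr>)" using assms subgroup_incl by blast
  then have "card (rcosets\<^bsub>G\<lparr>carrier := H\<rparr>\<^esub> K) * card K = order (G\<lparr>carrier := H\<rparr>)"
    using H.lagrange by blast
  moreover have "rcosets\<^bsub>G\<lparr>carrier := H\<rparr>\<^esub> K = (\<lambda>h. K #> h) ` H"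
    by (auto simp: RCOSETS_def r_coset_def)
  ultimately show ?thesis by (simp add: order_def)
qed

text \<open>Every fibre of multiplication \<open>A \<times> B \<rightarrow> A <#> B\<close> is
  parametrized by \<open>A \<inter> B\<close>, through \<open>c \<mapsto> (a c, c^-1 b)\<close>. The
  product is a mere set here, so no normality enters.\<close>

lemma card_set_mult:
  assumes A: "subgroup A G" and B: "subgroup B G"
  shows "card (A <#> B) * card (A \<inter> B) = card A * card B"
proof -
  note Ac = sub_carrier[OF A] and Bc = sub_carrier[OF B]
  let ?f = "\<lambda>(a,b). a \<otimes> b"
  have im: "A <#> B = ?f ` (A \<times> B)" by (auto simp: set_mult_def)
  have fib: "card {x \<in> A \<times> B. ?f x = z} = card (A \<inter> B)" if "z \<in> A <#> B" for z
  proof -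
    from that obtain a b where ab: "a \<in> A" "b \<in> B" "z = a \<otimes> b" by (auto simp: set_mult_def)
    have "bij_betw (\<lambda>c. (a \<otimes> c, inv c \<otimes> b)) (A \<inter> B) {x \<in> A \<times> B. ?f x = z}"
    proof (rule bij_betwI[where g = "\<lambda>(x, y). inv a \<otimes> x"])
      show "(\<lambda>c. (a \<otimes> c, inv c \<otimes> b)) \<in> A \<inter> B \<rightarrow> {x \<in> A \<times> B. ?f x = z}"
        using ab Ac Bc A B by (auto simp: subgroup.m_closed subgroup.m_inv_closed group_word_simps)
      have "inv a \<otimes> x = b \<otimes> inv y" if "x \<in> A" "y \<in> B" "x \<otimes> y = a \<otimes> b" for x y
      proof -
        have "x = a \<otimes> b \<otimes> inv y" using that ab Ac Bc by (metis inv_solve_right' m_closed)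
        then show ?thesis using that ab Ac Bc by (simp add: group_word_simps)
      qed
      then show "(\<lambda>(x, y). inv a \<otimes> x) \<in> {x \<in> A \<times> B. ?f x = z} \<rightarrow> A \<inter> B"
        using ab A B by (auto simp: subgroup.m_closed subgroup.m_inv_closed) 
          (metis subgroup.m_closed subgroup.m_inv_closed)
    next
      fix c assume "c \<in> A \<inter> B"
      then show "(\<lambda>(x, y). inv a \<otimes> x) (a \<otimes> c, inv c \<otimes> b) = c"
        using ab Ac by (simp add: group_word_simps)
    next
      fix w assume w: "w \<in> {x \<in> A \<times> B. ?f x = z}"
      obtain x y where xy: "w = (x, y)" by (cases w)
      have m: "x \<in> A" "y \<in> B" "x \<otimes> y = a \<otimes> b" using w xy ab by auto
      then have "inv x \<otimes> (a \<otimes> b) = y" using ab Ac Bc by (metis inv_cancel(2))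
      then show "(a \<otimes> (case w of (x, y) \<Rightarrow> inv a \<otimes> x), inv (case w of (x, y) \<Rightarrow> inv a \<otimes> x) \<otimes> b) = w"
        using m ab Ac Bc xy by (simp add: group_word_simps)
    qed
    then show ?thesis by (simp add: bij_betw_same_card)
  qed
  have finAB: "finite (A \<times> B)" using A B by simp
  have "card (A \<times> B) = (\<Sum>z\<in>?f ` (A \<times> B). card {x \<in> A \<times> B. ?f x = z})"
    using sum.image_gen[OF finAB, of "\<lambda>_. 1::nat" ?f] by simp
  also have "\<dots> = card (A <#> B) * card (A \<inter> B)"
    using fib im by simp
  finally show ?thesis by (simp add: card_cartesian_product)
qed

text \<open>An orbit of a q-group has q-power size, so every orbit outside the fixed points has size
  divisible by \<open>q\<close>. The set acted on has its own type: it will consist of left cosets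
  under conjugation or of right cosets under right multiplication.\<close>

lemma fixed_points:
  fixes f :: "'a \<Rightarrow> 'c \<Rightarrow> 'c"
  assumes Q: "subgroup Q G" and Z: "finite Z" and q: "Factorial_Ring.prime q" and cQ: "card Q = q ^ k"
    and cl: "\<And>g x. g \<in> Q \<Longrightarrow> x \<in> Z \<Longrightarrow> f g x \<in> Z"
    and one: "\<And>x. x \<in> Z \<Longrightarrow> f \<one> x = x"
    and comp: "\<And>g h x. g \<in> Q \<Longrightarrow> h \<in> Q \<Longrightarrow> x \<in> Z \<Longrightarrow> f h (f g x) = f (g \<otimes> h) x"
  shows "card Z mod q = card {x \<in> Z. \<forall>g\<in>Q. f g x = x} mod q"
proof -
  note Qc = sub_carrier[OF Q]
  define Fx where "Fx = {x \<in> Z. \<forall>g\<in>Q. f g x = x}"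
  define Or where "Or x = (\<lambda>g. f g x) ` Q" for x
  have orb: "q dvd card (Or x)" if x: "x \<in> Z - Fx" for x
  proof -
    define St where "St = {g \<in> Q. f g x = x}"
    have xX: "x \<in> Z" using x by simp
    have fib: "card {g \<in> Q. f g x = y} = card St" if "y \<in> Or x" for y
    proof -
      from that obtain g0 where g0: "g0 \<in> Q" "y = f g0 x" by (auto simp: Or_def)
      have ret: "f (inv g0) y = x"
        using comp[of g0 "inv g0" x] g0 xX one Qc subgroup.m_inv_closed[OF Q] by auto
      have "bij_betw (\<lambda>s. s \<otimes> g0) St {g \<in> Q. f g x = y}"
      proof (rule bij_betwI[where g = "\<lambda>s. s \<otimes> inv g0"])
        show "(\<lambda>s. s \<otimes> g0) \<in> St \<rightarrow> {g \<in> Q. f g x = y}"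
          using g0 Q xX by (auto simp: St_def subgroup.m_closed comp[symmetric])
        show "(\<lambda>s. s \<otimes> inv g0) \<in> {g \<in> Q. f g x = y} \<rightarrow> St"
          using g0 Q xX ret
            by (auto simp: St_def subgroup.m_closed subgroup.m_inv_closed comp[symmetric])
      qed (use g0 Qc in \<open>auto simp: St_def group_word_simps\<close>)
      then show ?thesis by (simp add: bij_betw_same_card)
    qed
    have finQ: "finite Q" using Q by simp
    have "card Q = (\<Sum>y\<in>(\<lambda>g. f g x) ` Q. card {g \<in> Q. f g x = y})"
      using sum.image_gen[OF finQ, of "\<lambda>_. 1::nat" "\<lambda>g. f g x"] by simp
    also have "\<dots> = card (Or x) * card St" using fib by (simp add: Or_def)
    finally have "card (Or x) dvd q ^ k" using cQ by auto
    then obtain i where i: "card (Or x) = q ^ i" using q divides_primepow_nat by auto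
    have "i \<noteq> 0"
    proof
      assume "i = 0"
      then have c1: "card (Or x) = 1" using i by simp
      have "x \<in> Or x" using one[OF xX] subgroup.one_closed[OF Q] unfolding Or_def by force
      then have "Or x = {x}" using c1 by (metis card_1_singletonE singletonD)
      then have "x \<in> Fx" using xX by (auto simp: Or_def Fx_def)
      then show False using x by simp
    qed
    then show ?thesis using i by simp
  qed
  have sub: "Or x \<subseteq> Z - Fx" if "x \<in> Z - Fx" for x
  proof
    fix y assume "y \<in> Or x"
    then obtain g where g: "g \<in> Q" "y = f g x" by (auto simp: Or_def)
    have xX: "x \<in> Z" using that by simp
    have "y \<notin> Fx"
    proof
      assume yF: "y \<in> Fx"
      have "f (inv g) y = x"
        using comp[of g "inv g" x] g xX one Qc subgroup.m_inv_closed[OF Q] by auto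
      moreover have "f (inv g) y = y" using yF g subgroup.m_inv_closed[OF Q] by (auto simp: Fx_def)
      ultimately show False using yF that by simp
    qed
    then show "y \<in> Z - Fx" using g cl xX by auto
  qed
  have refl: "x \<in> Or x" if "x \<in> Z" for x
    using one[OF that] subgroup.one_closed[OF Q] unfolding Or_def by force
  have cov: "\<Union> (Or ` (Z - Fx)) = Z - Fx" using sub refl by blast
  have disj: "Or x = Or y" if "x \<in> Z" "y \<in> Z" "z \<in> Or x" "z \<in> Or y" for x y z
  proof -
    have gen: "Or z = Or x" if "x \<in> Z" "z \<in> Or x" for x z
    proof -
      from that obtain g where g: "g \<in> Q" "z = f g x" by (auto simp: Or_def)
      have "Or z = (\<lambda>h. f (g \<otimes> h) x) ` Q" using g that comp by (auto simp: Or_def)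
      also have "\<dots> = (\<lambda>h. f h x) ` ((\<lambda>h. g \<otimes> h) ` Q)" by (simp add: image_image)
      also have "(\<lambda>h. g \<otimes> h) ` Q = Q"
      proof
        show "(\<lambda>h. g \<otimes> h) ` Q \<subseteq> Q" using g Q by (auto simp: subgroup.m_closed)
        show "Q \<subseteq> (\<lambda>h. g \<otimes> h) ` Q"
        proof
          fix u assume "u \<in> Q"
          then have "u = g \<otimes> (inv g \<otimes> u)" "inv g \<otimes> u \<in> Q"
            using g Q Qc by (auto simp: group_word_simps subgroup.m_closed subgroup.m_inv_closed)
          then show "u \<in> (\<lambda>h. g \<otimes> h) ` Q" by blast
        qed
      qed
      finally show ?thesis by (simp add: Or_def)
    qed
    show ?thesis using gen that by metis
  qed
  have "q dvd card (\<Union> (Or ` (Z - Fx)))"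
  proof (rule dvd_partition)
    show "finite (\<Union> (Or ` (Z - Fx)))" using cov Z by simp
    show "\<forall>c\<in>Or ` (Z - Fx). q dvd card c" using orb by auto
    show "\<forall>c1\<in>Or ` (Z - Fx). \<forall>c2\<in>Or ` (Z - Fx). c1 \<noteq> c2 \<longrightarrow> c1 \<inter> c2 = {}"
      using disj by (metis (no_types, lifting) DiffD1 disjoint_iff imageE)
  qed
  then have "q dvd card (Z - Fx)" using cov by simp
  moreover have "card Z = card Fx + card (Z - Fx)"
    using Z by (metis (no_types, lifting) Fx_def card_mono card_Diff_subset finite_subset le_add_diff_inverse mem_Collect_eq subsetI)
  ultimately show ?thesis unfolding Fx_def[symmetric]
    by (metis dvd_imp_mod_0 add.right_neutral mod_add_right_eq)
qed

end

text \<open>An inclusion suffices: conjugation is injective, so for a finite \<open>T\<close> it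
  maps \<open>T\<close> onto itself.\<close>

definition (in group) normalizer_of :: "'a set \<Rightarrow> 'a set"
  where "normalizer_of T = {g \<in> carrier G. \<forall>x\<in>T. conj_by g x \<in> T}"

definition (in group) left_coset :: "'a \<Rightarrow> 'a set \<Rightarrow> 'a set"
  where "left_coset x K = (\<lambda>k. x \<otimes> k) ` K"

context group
begin

lemma normalized_by_imp_normal:
  assumes F: "normalized_by N F" and N: "subgroup N G" and FN: "F \<subseteq> N"
  shows "F \<lhd> G\<lparr>carrier := N\<rparr>"
proof -
  interpret N: group "G\<lparr>carrier := N\<rparr>" using N by (rule subgroup_imp_group)
  show ?thesis
  proof (rule N.normal_invI)
    show "subgroup F (G\<lparr>carrier := N\<rparr>)"
      using subgroup_incl[OF normalized_by_subgroup[OF F] N FN] .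
    fix x h assume "x \<in> carrier (G\<lparr>carrier := N\<rparr>)" "h \<in> F"
    then have x: "x \<in> N" "h \<in> F" by auto
    then have "conj_by (inv x) h \<in> F"
      using normalized_by_conj_by[OF F] subgroup.m_inv_closed[OF N] by simp
    then show "x \<otimes>\<^bsub>G\<lparr>carrier := N\<rparr>\<^esub> h \<otimes>\<^bsub>G\<lparr>carrier := N\<rparr>\<^esub> inv\<^bsub>G\<lparr>carrier := N\<rparr>\<^esub> x \<in> F"
      using x sub_carrier[OF N] m_inv_consistent[OF N] by (simp add: conj_by_def)
  qed
qed

lemma normal_imp_normalized_by:
  assumes F: "F \<lhd> G\<lparr>carrier := N\<rparr>" and N: "subgroup N G"
  shows "normalized_by N F" "F \<subseteq> N"
proof -
  interpret N: group "G\<lparr>carrier := N\<rparr>" using N by (rule subgroup_imp_group)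
  have sub: "subgroup F (G\<lparr>carrier := N\<rparr>)" using F normal_imp_subgroup by blast
  show FN: "F \<subseteq> N" using subgroup.subset[OF sub] by simp
  have "conj_by h x \<in> F" if "h \<in> N" "x \<in> F" for h x
    using normal.inv_op_closed1[OF F, of h x] that m_inv_consistent[OF N] by (simp add: conj_by_def)
  then show "normalized_by N F"
    unfolding normalized_by_def using incl_subgroup[OF N sub] by auto
qed

lemma rcos_eq_iff:
  assumes K: "subgroup K G" and c: "x \<in> carrier G" "y \<in> carrier G"
  shows "K #> x = K #> y \<longleftrightarrow> y \<otimes> inv x \<in> K"
proof -
  interpret subgroup K G by fact
  have "K #> x = K #> y \<longleftrightarrow> y \<in> K #> x"
    using c K rcos_self repr_independence by metis
  then show ?thesis using rcos_module[OF is_group c] by simp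
qed

lemma lcos_eq_iff:
  assumes K: "subgroup K G" and c: "x \<in> carrier G" "y \<in> carrier G"
  shows "left_coset x K = left_coset y K \<longleftrightarrow> cong_mod K x y"
proof
  assume "left_coset x K = left_coset y K"
  moreover have "y \<otimes> \<one> \<in> left_coset y K" using subgroup.one_closed[OF K] unfolding left_coset_def
    by blast
  ultimately have "y \<in> left_coset x K" using c by simp
  then obtain k where "k \<in> K" "y = x \<otimes> k" by (auto simp: left_coset_def)
  then show "cong_mod K x y" using c sub_carrier[OF K] by (simp add: cong_mod_def group_word_simps)
next
  assume a: "cong_mod K x y"
  have sub: "left_coset u K \<subseteq> left_coset v K" if "u \<in> carrier G" "v \<in> carrier G" "cong_mod K v u" for u v
  proof
    fix z assume "z \<in> left_coset u K"
    then obtain k where k: "k \<in> K" "z = u \<otimes> k" by (auto simp: left_coset_def)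
    then have "z = v \<otimes> ((inv v \<otimes> u) \<otimes> k)" using that sub_carrier[OF K] by (simp add: group_word_simps)
    moreover have "(inv v \<otimes> u) \<otimes> k \<in> K" using that(3) k subgroup.m_closed[OF K]
      by (simp add: cong_mod_def)
    ultimately show "z \<in> left_coset v K" unfolding left_coset_def by blast
  qed
  show "left_coset x K = left_coset y K"
    using sub[of x y] sub[of y x] a c cong_mod_sym[OF K] by blast
qed

lemma lcos_disjoint:
  assumes K: "subgroup K G" and c: "x \<in> carrier G" "y \<in> carrier G" and z: "z \<in> left_coset x K"
    "z \<in> left_coset y K"
  shows "left_coset x K = left_coset y K"
proof -
  from z obtain k l where kl: "k \<in> K" "z = x \<otimes> k" "l \<in> K" "z = y \<otimes> l" by (auto simp: left_coset_def)
  have kc: "k \<in> carrier G" "l \<in> carrier G" using kl sub_carrier[OF K] by auto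
  have "y = x \<otimes> (k \<otimes> inv l)" using kl kc c by (metis inv_closed inv_solve_right m_assoc m_closed)
  then have "inv x \<otimes> y = k \<otimes> inv l" using c kc by (simp add: group_word_simps)
  then have "cong_mod K x y" using kl K
    by (simp add: cong_mod_def subgroup.m_closed subgroup.m_inv_closed)
  then show ?thesis using lcos_eq_iff[OF K c] by simp
qed

end

lemma one_less_factor:
  fixes a b m :: nat
  assumes "m * a = b" "a < b"
  shows "1 < m"
proof (rule ccontr)
  assume "\<not> 1 < m"
  then have "m * a \<le> 1 * a" by (intro mult_le_mono1) simp
  then show False using assms by simp
qed

section \<open>Counting fixed cosets: coprime action and p-groups\<close>

context fin_group
begin

lemma normalizer_of_subgroup:
  assumes T: "subgroup T G" shows "subgroup (normalizer_of T) G"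
  by (rule fin_subgroupI)
    (use T sub_carrier[OF T] in \<open>auto simp: normalizer_of_def conj_by_conj_by[symmetric]\<close>)

lemma normalized_by_normalizer_of: "subgroup T G \<Longrightarrow> normalized_by (normalizer_of T) T"
  by (auto simp: normalized_by_def normalizer_of_def)

lemma normalizer_of_carrier: "x \<in> normalizer_of T \<Longrightarrow> x \<in> carrier G"
  by (simp add: normalizer_of_def)

lemma sub_normalizer_of: "H \<subseteq> carrier G \<Longrightarrow> normalized_by H T \<Longrightarrow> H \<subseteq> normalizer_of T"
  by (auto simp: normalizer_of_def normalized_by_def)

lemma conj_by_image_eq:
  assumes K: "subgroup K G" and "g \<in> carrier G" "\<And>x. x \<in> K \<Longrightarrow> conj_by g x \<in> K"
  shows "conj_by g ` K = K"
  using assms by (intro card_subset_eq) (auto simp: card_conj_by_image subgroup.subset)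

lemma card_lcos: "subgroup K G \<Longrightarrow> x \<in> carrier G \<Longrightarrow> card (left_coset x K) = card K"
proof -
  assume K: "subgroup K G" and x: "x \<in> carrier G"
  have "left_coset x K = (\<lambda>k. x \<otimes> k) ` K" by (auto simp: left_coset_def)
  moreover have "inj_on (\<lambda>k. x \<otimes> k) K" using x sub_carrier[OF K] by (auto simp: inj_on_def)
  ultimately show ?thesis by (simp add: card_image)
qed

text \<open>\<open>Q\<close> permutes the \<open>|W : K|\<close> left cosets of \<open>K\<close>
  contained in \<open>xW\<close>, and \<open>yK\<close> is fixed exactly if all \<open>[y,g]\<close>
  lie in \<open>K\<close>. Both later uses read off a fixed coset: for a p-group \<open>W\<close>
  and \<open>q \<noteq> p\<close> there is at least one, for \<open>q = p\<close> and
  \<open>x = 1\<close> there is more than the trivial one. \<open>K\<close> is only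
  \<open>Q\<close>-invariant, hence cosets instead of a quotient group.\<close>

lemma fixed_coset_count:
  assumes Q: "subgroup Q G" "card Q = q ^ k" "Factorial_Ring.prime q"
    and W: "normalized_by Q W" and K: "normalized_by Q K" and KW: "K \<subseteq> W"
    and x: "x \<in> carrier G" "\<And>g. g \<in> Q \<Longrightarrow> cong_mod W x (conj_by g x)"
  defines "A \<equiv> {y \<in> carrier G. cong_mod W x y \<and> (\<forall>g\<in>Q. cong_mod K y (conj_by g y))}"
  shows "\<exists>m. m * card K = card W \<and> m mod q = card ((\<lambda>y. left_coset y K) ` A) mod q"
proof -
  note Qc = sub_carrier[OF Q(1)]
  have sK: "subgroup K G" and sW: "subgroup W G" using W K normalized_by_subgroup by auto
  note Kc = sub_carrier[OF sK] and Wc = sub_carrier[OF sW]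
  define Y where "Y = {y \<in> carrier G. cong_mod W x y}"
  define C where "C = (\<lambda>y. left_coset y K) ` Y"
  have finC: "finite C" unfolding C_def Y_def by (rule finite_imageI, rule finite_subset[OF _ fin]) auto
  have Ycarr: "y \<in> carrier G" if "y \<in> Y" for y using that by (simp add: Y_def)
  have un: "\<Union>C = left_coset x W"
  proof
    show "\<Union>C \<subseteq> left_coset x W"
    proof
      fix z assume "z \<in> \<Union>C"
      then obtain y where y: "y \<in> Y" "z \<in> left_coset y K" by (auto simp: C_def)
      then obtain k where k: "k \<in> K" "z = y \<otimes> k" by (auto simp: left_coset_def)
      have "z = x \<otimes> ((inv x \<otimes> y) \<otimes> k)" using k y Kc x Ycarr by (simp add: group_word_simps)
      moreover have "(inv x \<otimes> y) \<otimes> k \<in> W" using y k KW subgroup.m_closed[OF sW]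
        by (auto simp: Y_def cong_mod_def)
      ultimately show "z \<in> left_coset x W" unfolding left_coset_def by blast
    qed
    show "left_coset x W \<subseteq> \<Union>C"
    proof
      fix z assume "z \<in> left_coset x W"
      then obtain w where w: "w \<in> W" "z = x \<otimes> w" by (auto simp: left_coset_def)
      then have "z \<in> Y" using x Wc by (simp add: Y_def cong_mod_def group_word_simps)
      moreover have "z \<otimes> \<one> \<in> left_coset z K" using subgroup.one_closed[OF sK]
        unfolding left_coset_def by blast
      ultimately show "z \<in> \<Union>C" using Ycarr by (auto simp: C_def)
    qed
  qed
  have "card K * card C = card (\<Union>C)"
  proof (rule card_partition)
    show "finite C" by fact
    show "finite (\<Union>C)" using un Wc x by (auto intro!: finite_subset[OF _ fin] simp: left_coset_def)
    show "card c = card K" if "c \<in> C" for c using that card_lcos[OF sK] Ycarr by (auto simp: C_def)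
    show "c1 \<inter> c2 = {}" if c12: "c1 \<in> C" "c2 \<in> C" "c1 \<noteq> c2" for c1 c2
    proof -
      from c12 obtain y1 y2 where "y1 \<in> Y" "c1 = left_coset y1 K" "y2 \<in> Y" "c2 = left_coset y2 K"
        by (auto simp: C_def)
      then show ?thesis using lcos_disjoint[OF sK, of y1 y2] Ycarr c12(3) by blast
    qed
  qed
  then have cC: "card C * card K = card W" using un card_lcos[OF sW x(1)] by (simp add: mult.commute)
  have imK: "conj_by g ` K = K" if "g \<in> Q" for g
    using conj_by_image_eq[OF sK Qc[OF that]] normalized_by_conj_by[OF K that] by blast
  have im: "conj_by g ` (left_coset y K) = left_coset (conj_by g y) K" if "g \<in> Q" "y \<in> carrier G" for g y
  proof -
    have "conj_by g ` (left_coset y K) = (\<lambda>k. conj_by g y \<otimes> conj_by g k) ` K"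
      unfolding left_coset_def image_image using that Qc Kc by (intro image_cong refl conj_by_mult) auto
    also have "\<dots> = (\<lambda>k. conj_by g y \<otimes> k) ` (conj_by g ` K)" by (simp only: image_image)
    also have "\<dots> = left_coset (conj_by g y) K" unfolding imK[OF that(1)] left_coset_def ..
    finally show ?thesis .
  qed
  have Yact: "conj_by g y \<in> Y" if "g \<in> Q" "y \<in> Y" for g y
  proof -
    have "cong_mod W (conj_by g x) (conj_by g y)" using cong_mod_conj_by[OF W that(1)] Qc that x
      by (auto simp: Y_def)
    then show ?thesis using cong_mod_trans[OF sW _ _ _ x(2)[OF that(1)]] that Qc x by (auto simp: Y_def)
  qed
  have "card C mod q = card {c \<in> C. \<forall>g\<in>Q. conj_by g ` c = c} mod q"
  proof (rule fixed_points[OF Q(1) finC Q(3) Q(2)])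
    show "conj_by g ` c \<in> C" if "g \<in> Q" "c \<in> C" for g c
      using that im Yact Ycarr by (auto simp: C_def)
    show "conj_by \<one> ` c = c" if "c \<in> C" for c
    proof -
      have "c \<subseteq> carrier G" using that Ycarr Kc by (auto simp: C_def left_coset_def)
      then show ?thesis by force
    qed
    show "conj_by h ` conj_by g ` c = conj_by (g \<otimes> h) ` c" if "g \<in> Q" "h \<in> Q" "c \<in> C" for g h c
    proof -
      have "c \<subseteq> carrier G" using that Ycarr Kc by (auto simp: C_def left_coset_def)
      then show ?thesis unfolding image_image using that Qc
        by (intro image_cong refl conj_by_conj_by) auto
    qed
  qed
  also have "{c \<in> C. \<forall>g\<in>Q. conj_by g ` c = c} = (\<lambda>y. left_coset y K) ` A"
  proof -
    have fx: "(\<forall>g\<in>Q. conj_by g ` (left_coset y K) = left_coset y K) \<longleftrightarrow> (\<forall>g\<in>Q. cong_mod K y (conj_by g y))" if "y \<in> Y" for y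
    proof -
      have "conj_by g ` (left_coset y K) = left_coset y K \<longleftrightarrow> cong_mod K y (conj_by g y)"
        if g: "g \<in> Q" for g
        using im[OF g] lcos_eq_iff[OF sK, of y "conj_by g y"] Ycarr \<open>y \<in> Y\<close> Qc[OF g] by auto
      then show ?thesis by blast
    qed
    have AY: "A = {y \<in> Y. \<forall>g\<in>Q. cong_mod K y (conj_by g y)}" by (auto simp: A_def Y_def)
    have "{c \<in> C. \<forall>g\<in>Q. conj_by g ` c = c} = (\<lambda>y. left_coset y K) ` {y \<in> Y. \<forall>g\<in>Q. conj_by g ` (left_coset y K) = left_coset y K}"
      unfolding C_def by blast
    also have "{y \<in> Y. \<forall>g\<in>Q. conj_by g ` (left_coset y K) = left_coset y K} = A" unfolding AY
      using fx by (intro Collect_cong) metis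
    finally show ?thesis .
  qed
  finally show ?thesis using cC by blast
qed

lemma prime_power_sub:
  fixes p :: nat
  assumes "Factorial_Ring.prime p" "m * a = p ^ n" "1 < m"
  shows "p dvd m"
proof -
  have "m dvd p ^ n" using assms(2) by (metis dvd_triv_left)
  then obtain i where "m = p ^ i" using assms(1) divides_primepow_nat by blast
  moreover have "i \<noteq> 0" using assms(3) calculation by (metis nat_neq_iff power_0)
  ultimately show ?thesis by simp
qed

text \<open>Fixed points lift in coprime action: the number of \<open>K\<close>-cosets in
  \<open>xW\<close> is a power of \<open>p\<close>, hence not divisible by \<open>q\<close>. Taking
  a q-group for \<open>Q\<close> makes plain counting sufficient.\<close>

lemma coprime_fixed_in_coset:
  assumes Q: "subgroup Q G" "card Q = q ^ k" "Factorial_Ring.prime q"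
    and W: "normalized_by Q W" and K: "normalized_by Q K" and KW: "K \<subseteq> W"
    and x: "x \<in> carrier G" "\<And>g. g \<in> Q \<Longrightarrow> cong_mod W x (conj_by g x)"
    and cW: "card W = p ^ n" "Factorial_Ring.prime p" "p \<noteq> q"
  shows "\<exists>y\<in>carrier G. cong_mod W x y \<and> (\<forall>g\<in>Q. cong_mod K y (conj_by g y))"
proof -
  define A where "A = {y \<in> carrier G. cong_mod W x y \<and> (\<forall>g\<in>Q. cong_mod K y (conj_by g y))}"
  obtain m where m: "m * card K = card W" "m mod q = card ((\<lambda>y. left_coset y K) ` A) mod q"
    using fixed_coset_count[OF Q W K KW x] unfolding A_def by blast
  have "m dvd p ^ n" using m(1) cW(1) by (metis dvd_triv_left)
  then obtain i where i: "m = p ^ i" using cW divides_primepow_nat by blast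
  have "\<not> q dvd m" using i cW Q(3) by (metis prime_dvd_power primes_dvd_imp_eq)
  then have "m mod q \<noteq> 0" by (simp add: dvd_eq_mod_eq_0)
  then have "A \<noteq> {}" using m(2) by auto
  then show ?thesis by (auto simp: A_def)
qed

text \<open>The coset \<open>K\<close> is fixed and the number of fixed cosets is divisible by
  \<open>p\<close>, so there is another one.\<close>

lemma pgroup_fixed_in_quotient:
  assumes Q: "subgroup Q G" "card Q = p ^ k" "Factorial_Ring.prime p"
    and W: "normalized_by Q W" and K: "normalized_by Q K" and KW: "K \<subset> W"
    and cW: "card W = p ^ n"
  shows "\<exists>y\<in>W - K. \<forall>g\<in>Q. cong_mod K y (conj_by g y)"
proof -
  define A where "A = {y \<in> carrier G. cong_mod W \<one> y \<and> (\<forall>g\<in>Q. cong_mod K y (conj_by g y))}"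
  have sK: "subgroup K G" and sW: "subgroup W G" using W K normalized_by_subgroup by auto
  have "cong_mod W \<one> (conj_by g \<one>)" if "g \<in> Q" for g
    using sW sub_carrier[OF Q(1) that] by (simp add: cong_mod_refl)
  then obtain m where m: "m * card K = card W" "m mod p = card ((\<lambda>y. left_coset y K) ` A) mod p"
    using fixed_coset_count[OF Q W K _ one_closed] KW unfolding A_def by blast
  have "card K < card W" using psubset_card_mono[OF fin_sub[OF sW] KW] .
  then have "1 < m" using m(1) by (rule one_less_factor[rotated])
  then have "p dvd m" using prime_power_sub[OF Q(3)] m(1) cW by metis
  then have d: "p dvd card ((\<lambda>y. left_coset y K) ` A)" using m(2) by (metis dvd_eq_mod_eq_0)
  have one: "\<one> \<in> A" using sW sK sub_carrier[OF Q(1)] by (auto simp: A_def cong_mod_refl)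
  have finA: "finite A" unfolding A_def by (rule finite_subset[OF _ fin]) auto
  have "\<exists>y\<in>A. left_coset y K \<noteq> left_coset \<one> K"
  proof (rule ccontr)
    assume "\<not> ?thesis"
    then have "(\<lambda>y. left_coset y K) ` A = {left_coset \<one> K}" using one by blast
    then have "p dvd 1" using d by simp
    then show False using Q(3) by (simp add: prime_nat_iff)
  qed
  then obtain y where y: "y \<in> A" "left_coset y K \<noteq> left_coset \<one> K" by blast
  then have "y \<in> carrier G" "y \<in> W" by (auto simp: A_def cong_mod_one)
  moreover have "y \<notin> K" using y lcos_eq_iff[OF sK one_closed, of y] \<open>y \<in> carrier G\<close>
    by (auto simp: cong_mod_one)
  ultimately show ?thesis using y by (auto simp: A_def)
qed

text \<open>\<open>Q\<close> acts by right multiplication, and \<open>T h g = T h\<close> means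
  \<open>h g h^-1 \<in> T\<close>; this is the source of the inverse in \<open>A\<close>. Sylow
  conjugacy and the growth of normalizers both follow from this count.\<close>

lemma right_coset_fixed_count:
  assumes T: "subgroup T G" and H: "subgroup H G" and TH: "T \<subseteq> H"
    and Q: "subgroup Q G" "Q \<subseteq> H" "card Q = q ^ k" "Factorial_Ring.prime q"
  defines "A \<equiv> {h \<in> H. \<forall>g\<in>Q. conj_by (inv h) g \<in> T}"
  shows "\<exists>m. m * card T = card H \<and> m mod q = card ((\<lambda>h. T #> h) ` A) mod q"
proof -
  define C where "C = (\<lambda>h. T #> h) ` H"
  note Hc = sub_carrier[OF H] and Tsub = subgroup.subset[OF T]
  have finC: "finite C" using H by (simp add: C_def)
  have "card C mod q = card {c \<in> C. \<forall>g\<in>Q. c #> g = c} mod q"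
  proof (rule fixed_points[OF Q(1) finC Q(4) Q(3)])
    show "c #> g \<in> C" if "g \<in> Q" "c \<in> C" for g c
      using that Q(2) H Hc Tsub by (auto simp: C_def coset_mult_assoc subgroup.m_closed subsetD)
    show "c #> \<one> = c" if "c \<in> C" for c
    proof -
      have "c \<subseteq> carrier G" using that Hc Tsub by (auto simp: C_def r_coset_def)
      then show ?thesis by (rule coset_mult_one)
    qed
    show "c #> g #> h = c #> (g \<otimes> h)" if "g \<in> Q" "h \<in> Q" "c \<in> C" for g h c
    proof (rule coset_mult_assoc)
      show "c \<subseteq> carrier G" using that Hc Tsub by (auto simp: C_def r_coset_def)
    qed (use that Q sub_carrier in auto)
  qed
  also have "{c \<in> C. \<forall>g\<in>Q. c #> g = c} = (\<lambda>h. T #> h) ` A"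
  proof -
    have "(\<forall>g\<in>Q. T #> h #> g = T #> h) \<longleftrightarrow> (\<forall>g\<in>Q. conj_by (inv h) g \<in> T)" if h: "h \<in> H" for h
    proof -
      have "T #> h #> g = T #> h \<longleftrightarrow> conj_by (inv h) g \<in> T" if g: "g \<in> Q" for g
      proof -
        have c: "h \<in> carrier G" "g \<in> carrier G" using h g Hc Q(2) by auto
        have "T #> h #> g = T #> h \<longleftrightarrow> T #> h = T #> (h \<otimes> g)"
          using c Tsub by (auto simp: coset_mult_assoc)
        also have "\<dots> \<longleftrightarrow> h \<otimes> g \<otimes> inv h \<in> T" using rcos_eq_iff[OF T] c by simp
        finally show ?thesis using c by (simp add: conj_by_def)
      qed
      then show ?thesis by blast
    qed
    then have "{h \<in> H. \<forall>g\<in>Q. T #> h #> g = T #> h} = A" unfolding A_def by (intro Collect_cong) metis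
    moreover have "{c \<in> C. \<forall>g\<in>Q. c #> g = c} = (\<lambda>h. T #> h) ` {h \<in> H. \<forall>g\<in>Q. T #> h #> g = T #> h}"
      unfolding C_def by blast
    ultimately show ?thesis by simp
  qed
  finally show ?thesis using card_cosets_mult[OF T H TH] unfolding C_def by blast
qed

lemma psubgroup_conj_into:
  assumes T: "subgroup T G" and H: "subgroup H G" and TH: "T \<subseteq> H"
    and R: "subgroup R G" "R \<subseteq> H" "card R = p ^ k" "Factorial_Ring.prime p"
    and m: "card H = m * card T" "\<not> p dvd m"
  shows "\<exists>h\<in>H. conj_by h ` R \<subseteq> T"
proof -
  define A where "A = {h \<in> H. \<forall>g\<in>R. conj_by (inv h) g \<in> T}"
  obtain m' where m': "m' * card T = card H" "m' mod p = card ((\<lambda>h. T #> h) ` A) mod p"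
    using right_coset_fixed_count[OF T H TH R] unfolding A_def by blast
  have "m' = m" using m m' card_pos[OF T] by auto
  then have "A \<noteq> {}" using m'(2) m(2) by (auto simp: dvd_eq_mod_eq_0)
  then obtain h where "h \<in> H" "\<forall>g\<in>R. conj_by (inv h) g \<in> T" by (auto simp: A_def)
  then have "inv h \<in> H" "conj_by (inv h) ` R \<subseteq> T" using subgroup.m_inv_closed[OF H] by auto
  then show ?thesis ..
qed

text \<open>\<open>F\<close> acts on its own right cosets in \<open>P\<close>. Their number is
  divisible by \<open>p\<close> and \<open>F\<close> itself is fixed, so a second coset
  \<open>F y\<close> is fixed, and \<open>y^-1\<close> normalizes \<open>F\<close>.\<close>

lemma normalizer_grows:
  assumes F: "subgroup F G" and P: "subgroup P G" and FP: "F \<subset> P" and cP: "card P = p ^ n"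
    and p: "Factorial_Ring.prime p"
  shows "F \<subset> normalizer_of F \<inter> P"
proof -
  define A where "A = {h \<in> P. \<forall>g\<in>F. conj_by (inv h) g \<in> F}"
  have "card F dvd p ^ n" using card_sub_dvd[OF F P] FP cP by auto
  then obtain k where k: "card F = p ^ k" using p divides_primepow_nat by blast
  have FP': "F \<subseteq> P" using FP by blast
  obtain m where m: "m * card F = card P" "m mod p = card ((\<lambda>h. F #> h) ` A) mod p"
    using right_coset_fixed_count[OF F P FP' F FP' k p] unfolding A_def by blast
  have "card F < card P" using psubset_card_mono[OF fin_sub[OF P] FP] .
  then have "1 < m" using m(1) by (rule one_less_factor[rotated])
  then have "p dvd m" using prime_power_sub[OF p] m(1) cP by metis
  then have d: "p dvd card ((\<lambda>h. F #> h) ` A)" using m(2) by (metis dvd_eq_mod_eq_0)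
  have one: "\<one> \<in> A" using F P by (auto simp: A_def sub_carrier subgroup.one_closed)
  have "\<exists>y\<in>A. F #> y \<noteq> F #> \<one>"
  proof (rule ccontr)
    assume "\<not> ?thesis"
    then have "(\<lambda>y. F #> y) ` A = {F #> \<one>}" using one by blast
    then have "p dvd 1" using d by simp
    then show False using p by (simp add: prime_nat_iff)
  qed
  then obtain y where y: "y \<in> A" "F #> y \<noteq> F #> \<one>" by blast
  have yc: "y \<in> P" "y \<in> carrier G" using y sub_carrier[OF P] by (auto simp: A_def)
  have "y \<notin> F" using y rcos_eq_iff[OF F one_closed yc(2)] yc by auto
  then have "inv y \<notin> F" using F yc sub_inv_iff by blast
  moreover have "inv y \<in> normalizer_of F \<inter> P"
    using y yc P by (auto simp: A_def normalizer_of_def subgroup.m_inv_closed)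
  moreover have "F \<subseteq> normalizer_of F"
    using sub_normalizer_of[OF subgroup.subset[OF F] normalized_by_self[OF F]] .
  ultimately show ?thesis using FP by blast
qed

end

section \<open>Sylow subgroups and chief factors\<close>

definition (in group) sylow_in :: "nat \<Rightarrow> 'a set \<Rightarrow> 'a set \<Rightarrow> bool"
  where "sylow_in p H T \<longleftrightarrow> subgroup T G \<and> T \<subseteq> H \<and> card T = p ^ multiplicity p (card H)"

text \<open>$V/U$ is a chief factor of $H$ when \<open>V \<subseteq> H\<close>; the definition itself does not require this inclusion.\<close>
definition (in group) chief_in :: "'a set \<Rightarrow> 'a set \<Rightarrow> 'a set \<Rightarrow> bool"
  where "chief_in H V U \<longleftrightarrow> normalized_by H V \<and> normalized_by H U \<and> U \<subset> V \<and>
    (\<forall>W. normalized_by H W \<longrightarrow> U \<subseteq> W \<longrightarrow> W \<subseteq> V \<longrightarrow> W = U \<or> W = V)"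

context fin_group
begin

lemma pgroup_sub:
  fixes p :: nat
  assumes "subgroup K G" "subgroup P G" "K \<subseteq> P" "card P = p ^ n" "Factorial_Ring.prime p"
  shows "\<exists>k\<le>n. card K = p ^ k"
  using card_sub_dvd[OF assms(1-3)] assms(4,5) divides_primepow_nat by auto

text \<open>The preimage of a subgroup of order \<open>p\<close> of \<open>N/F\<close>, where
  \<open>N\<close> is the normalizer of \<open>F\<close> in \<open>P\<close>.\<close>

lemma pgroup_step_up:
  assumes F: "subgroup F G" and P: "subgroup P G" and FP: "F \<subset> P" and cP: "card P = p ^ n"
    and p: "Factorial_Ring.prime p"
  shows "\<exists>F'. subgroup F' G \<and> F \<subseteq> F' \<and> F' \<subseteq> P \<and> card F' = p * card F"
proof -
  define N where "N = normalizer_of F \<inter> P"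
  have N: "subgroup N G" unfolding N_def
    by (rule subgroups_Inter_pair[OF normalizer_of_subgroup[OF F] P])
  have FN: "F \<subset> N" using normalizer_grows[OF F P FP cP p] by (simp add: N_def)
  have nF: "normalized_by N F"
    using normalized_by_mono[OF normalized_by_normalizer_of[OF F]] by (simp add: N_def)
  interpret N: group "G\<lparr>carrier := N\<rparr>" using N by (rule subgroup_imp_group)
  interpret F: normal F "G\<lparr>carrier := N\<rparr>" using normalized_by_imp_normal[OF nF N] FN by auto
  let ?M = "G\<lparr>carrier := N\<rparr> Mod F"
  have oM: "order ?M * card F = card N"
    using card_cosets_mult[OF F N] FN by (simp add: order_def carrier_FactGroup)
  have finM: "finite (carrier ?M)" using N by (simp add: carrier_FactGroup)
  have "1 < order ?M" using one_less_factor[OF oM] psubset_card_mono[OF fin_sub[OF N] FN] by simp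
  moreover obtain k where k: "card N = p ^ k"
    using pgroup_sub[OF N P _ cP p] by (auto simp: N_def)
  ultimately have "p dvd order ?M" using prime_power_sub[OF p] oM by metis
  then obtain m where "order ?M = p ^ 1 * m" by (auto simp: dvd_def)
  then obtain A where A: "subgroup A ?M" "card A = p ^ 1"
    using sylow_thm[OF p F.factorgroup_is_group _ finM] by blast
  have U: "subgroup (\<Union>A) (G\<lparr>carrier := N\<rparr>)" using F.factgroup_subgroup_union_subgroup[OF A(1)] .
  have UG: "subgroup (\<Union>A) G" using incl_subgroup[OF N U] .
  have UN: "\<Union>A \<subseteq> N" using subgroup.subset[OF U] by simp
  have "F \<in> A" using subgroup.one_closed[OF A(1)] by simp
  then have FU: "F \<subseteq> \<Union>A" by blast
  have "A = (\<lambda>h. F #> h) ` (\<Union>A)"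
    using F.factgroup_subgroup_union_factor[OF A(1)]
    by (simp add: RCOSETS_def r_coset_def UNION_singleton_eq_range)
  then have "card A * card F = card (\<Union>A)" using card_cosets_mult[OF F UG FU] by simp
  then show ?thesis using UG FU UN A(2) by (intro exI[of _ "\<Union>A"]) (auto simp: N_def)
qed

text \<open>This supplies the test subgroups: throughout, a subgroup of order \<open>p^d\<close> is
  placed between a prescribed lower and a prescribed upper bound.\<close>

lemma pgroup_between:
  assumes F: "subgroup F G" and P: "subgroup P G" and FP: "F \<subseteq> P" and cP: "card P = p ^ n"
    and p: "Factorial_Ring.prime p" and le: "card F \<le> p ^ m" "m \<le> n"
  shows "\<exists>A. subgroup A G \<and> F \<subseteq> A \<and> A \<subseteq> P \<and> card A = p ^ m"
proof -
  have p1: "1 < p" using p prime_gt_1_nat by blast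
  obtain f where f: "card F = p ^ f" using pgroup_sub[OF F P FP cP p] by blast
  have "f \<le> m" using le f p1 by simp
  have "\<exists>A. subgroup A G \<and> F \<subseteq> A \<and> A \<subseteq> P \<and> card A = p ^ j" if "f \<le> j" "j \<le> n" for j
    using that
  proof (induction j rule: dec_induct)
    case base show ?case using F FP f by blast
  next
    case (step j)
    then obtain A where A: "subgroup A G" "F \<subseteq> A" "A \<subseteq> P" "card A = p ^ j" by auto
    have "A \<noteq> P" using A cP step p1 by auto
    then obtain A' where "subgroup A' G" "A \<subseteq> A'" "A' \<subseteq> P" "card A' = p * card A"
      using pgroup_step_up[OF A(1) P _ cP p] A(3) by blast
    then show ?case using A by (intro exI[of _ A']) auto
  qed
  then show ?thesis using \<open>f \<le> m\<close> le(2) by blast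
qed

lemma no_between:
  assumes "subgroup B G" "subgroup K G" "subgroup N G" "B \<subseteq> K" "K \<subseteq> N"
    and c: "card N = p * card B" and p: "Factorial_Ring.prime p"
  shows "K = B \<or> K = N"
proof -
  obtain k where k: "card K = card B * k" using card_sub_dvd[OF assms(1,2,4)] by (auto simp: dvd_def)
  obtain l where l: "card N = card K * l" using card_sub_dvd[OF assms(2,3,5)] by (auto simp: dvd_def)
  have "card B * (k * l) = card N" using k l by simp
  then have "card B * (k * l) = card B * p" unfolding c by (simp only: mult.commute)
  then have "k * l = p \<or> card B = 0" by (simp only: mult_cancel1)
  then have "k * l = p" using card_pos[OF assms(1)] by auto
  then have "k = 1 \<or> l = 1" using p prime_product by blast
  then have "card B = card K \<or> card K = card N" using k l by auto
  then show ?thesis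
    using card_subset_eq[OF fin_sub[OF assms(2)] assms(4)]
      card_subset_eq[OF fin_sub[OF assms(3)] assms(5)] by auto
qed

lemma prime_index_pow:
  assumes B: "normalized_by N B" and N: "subgroup N G" and BN: "B \<subseteq> N"
    and c: "card N = p * card B" and x: "x \<in> N"
  shows "x [^] p \<in> B"
proof -
  interpret N: group "G\<lparr>carrier := N\<rparr>" using N by (rule subgroup_imp_group)
  interpret B: normal B "G\<lparr>carrier := N\<rparr>" using normalized_by_imp_normal[OF B N BN] .
  let ?M = "G\<lparr>carrier := N\<rparr> Mod B"
  interpret M: group ?M by (rule B.factorgroup_is_group)
  note sB = normalized_by_subgroup[OF B]
  have "order ?M * card B = card N"
    using card_cosets_mult[OF sB N BN] by (simp add: order_def carrier_FactGroup)
  then have o: "order ?M = p" using c card_pos[OF sB] by simp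
  have pow: "y [^]\<^bsub>G\<lparr>carrier := N\<rparr>\<^esub> (n::nat) = y [^] n" for y n
    using nat_pow_consistent[of y n N] by simp
  have "B #> x \<in> carrier ?M" using x by (auto simp: carrier_FactGroup)
  then have "(B #> x) [^]\<^bsub>?M\<^esub> p = B" using M.pow_order_eq_1[of "B #> x"] o by simp
  moreover have "(B #> x) [^]\<^bsub>?M\<^esub> p = B #> (x [^] p)"
    using B.FactGroup_pow[of x p] x by (simp add: pow)
  ultimately have "B #> (x [^] p) = B" by simp
  then have "B #> \<one> = B #> (x [^] p)" using subgroup.subset[OF sB] by simp
  then show ?thesis using rcos_eq_iff[OF sB one_closed, of "x [^] p"] sub_carrier[OF N x] by simp
qed

lemma prime_index_powers:
  assumes B: "normalized_by N B" and N: "subgroup N G" and BN: "B \<subseteq> N"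
    and c: "card N = p * card B" and p: "Factorial_Ring.prime p" and v: "v \<in> N" "v \<notin> B" and x: "x \<in> N"
  shows "\<exists>i::nat. cong_mod B (v [^] i) x"
proof -
  note sB = normalized_by_subgroup[OF B] and Nc = sub_carrier[OF N]
  define K where "K = {x \<in> N. \<exists>i::nat. cong_mod B (v [^] i) x}"
  have vN: "v [^] (i::nat) \<in> N" for i using subgroup_pow_closed[OF N v(1)] .
  have K: "subgroup K G"
  proof (rule fin_subgroupI)
    show "K \<subseteq> carrier G" using Nc by (auto simp: K_def)
    show "\<one> \<in> K" using subgroup.one_closed[OF N] cong_mod_refl[OF sB one_closed]
      by (auto simp: K_def intro!: exI[of _ "0::nat"])
    fix x y assume "x \<in> K" "y \<in> K"
    then obtain i j :: nat
      where ij: "x \<in> N" "y \<in> N" "cong_mod B (v [^] i) x" "cong_mod B (v [^] j) y" by (auto simp: K_def)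
    have "cong_mod B (v [^] i \<otimes> v [^] j) (x \<otimes> y)" using cong_mod_mult[OF B N _ _ _ _ ij(3,4)] ij vN
      by simp
    then have "cong_mod B (v [^] (i + j)) (x \<otimes> y)" using Nc[OF v(1)] by (simp add: nat_pow_mult)
    then show "x \<otimes> y \<in> K" using ij subgroup.m_closed[OF N] by (auto simp: K_def)
  qed
  have "B \<subseteq> K"
  proof
    fix b assume "b \<in> B"
    then have "b \<in> N" "cong_mod B (v [^] (0::nat)) b" using BN sub_carrier[OF sB]
      by (auto simp: cong_mod_one)
    then show "b \<in> K" unfolding K_def by blast
  qed
  moreover have "v \<in> K"
    using v Nc cong_mod_refl[OF sB, of v] by (auto simp: K_def intro!: exI[of _ "1::nat"])
  moreover have "K \<subseteq> N" by (auto simp: K_def)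
  ultimately have "K = N" using no_between[OF sB K N _ _ c p] v by blast
  then show ?thesis using x by (auto simp: K_def)
qed

section \<open>Products of subgroups, Sylow theory inside a subgroup, existence of chief
  factors\<close>

lemma set_mult_subgroup:
  assumes A: "normalized_by B A" and B: "subgroup B G"
  shows "subgroup (A <#> B) G"
proof (rule fin_subgroupI)
  note sA = normalized_by_subgroup[OF A]
  note Ac = sub_carrier[OF sA] and Bc = sub_carrier[OF B]
  show "A <#> B \<subseteq> carrier G" using Ac Bc by (auto simp: set_mult_def)
  show "\<one> \<in> A <#> B" using subgroup.one_closed[OF sA] subgroup.one_closed[OF B]
    unfolding set_mult_def by (auto intro!: bexI[of _ "\<one>"])
  fix x y assume "x \<in> A <#> B" "y \<in> A <#> B"
  then obtain a b a' b' where ab: "a \<in> A" "b \<in> B" "x = a \<otimes> b" "a' \<in> A" "b' \<in> B" "y = a' \<otimes> b'"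
    by (auto simp: set_mult_def)
  have "x \<otimes> y = (a \<otimes> conj_by (inv b) a') \<otimes> (b \<otimes> b')"
    using ab Ac Bc by (simp add: conj_by_def group_word_simps)
  moreover have "a \<otimes> conj_by (inv b) a' \<in> A"
    using ab normalized_by_conj_by[OF A] subgroup.m_closed[OF sA] subgroup.m_inv_closed[OF B] by simp
  moreover have "b \<otimes> b' \<in> B" using ab subgroup.m_closed[OF B] by simp
  ultimately show "x \<otimes> y \<in> A <#> B" unfolding set_mult_def by blast
qed

lemma set_mult_memI: "a \<in> A \<Longrightarrow> b \<in> B \<Longrightarrow> a \<otimes> b \<in> A <#> B"
  unfolding set_mult_def by blast

lemma set_mult_left: "subgroup A G \<Longrightarrow> subgroup B G \<Longrightarrow> A \<subseteq> A <#> B"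
  using set_mult_memI[OF _ subgroup.one_closed, of _ A B G] sub_carrier by fastforce

lemma set_mult_right: "subgroup A G \<Longrightarrow> subgroup B G \<Longrightarrow> B \<subseteq> A <#> B"
  using set_mult_memI[OF subgroup.one_closed, of A G _ B] sub_carrier by fastforce

lemma set_mult_in: "subgroup C G \<Longrightarrow> A \<subseteq> C \<Longrightarrow> B \<subseteq> C \<Longrightarrow> A <#> B \<subseteq> C"
  using subgroup.m_closed[of C G] by (auto simp: set_mult_def)

lemma sylow_in_exists:
  assumes H: "subgroup H G" and p: "Factorial_Ring.prime p"
  shows "\<exists>T. sylow_in p H T"
proof -
  have "p ^ multiplicity p (card H) dvd card H" by (rule multiplicity_dvd)
  then obtain m where "order (G\<lparr>carrier := H\<rparr>) = p ^ multiplicity p (card H) * m"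
    by (auto simp: dvd_def order_def)
  then obtain T where T: "subgroup T (G\<lparr>carrier := H\<rparr>)" "card T = p ^ multiplicity p (card H)"
    using sylow_thm[OF p subgroup_imp_group[OF H]] H by auto
  then show ?thesis using incl_subgroup[OF H T(1)] subgroup.subset[OF T(1)] by (auto simp: sylow_in_def)
qed

lemma sylow_in_index:
  assumes H: "subgroup H G" and p: "Factorial_Ring.prime p" and T: "sylow_in p H T"
  shows "\<exists>m. card H = m * card T \<and> \<not> p dvd m"
proof -
  have "card H \<noteq> 0" "\<not> is_unit p" using card_pos[OF H] p by auto
  then obtain y where "card H = p ^ multiplicity p (card H) * y" "\<not> p dvd y"
    by (rule multiplicity_decompose')
  then show ?thesis using T by (auto simp: sylow_in_def mult.commute)
qed

lemma sylI:
  assumes H: "subgroup H G" and p: "Factorial_Ring.prime p" and T: "subgroup T G" "T \<subseteq> H"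
    and c: "card T = p ^ k" "card H = m * card T" "\<not> p dvd m"
  shows "sylow_in p H T"
proof -
  have "m \<noteq> 0" using c(3) by (metis dvd_0_right)
  have "multiplicity p (card H) = k"
  proof (rule multiplicity_eqI)
    show "p ^ k dvd card H" using c by simp
    show "\<not> p ^ Suc k dvd card H" using c p by (simp add: prime_gt_0_nat)
  qed
  then show ?thesis using T c by (simp add: sylow_in_def)
qed

lemma sylow_in_absorbs:
  assumes H: "subgroup H G" and p: "Factorial_Ring.prime p" and T: "sylow_in p H T"
    and R: "subgroup R G" "R \<subseteq> H" "card R = p ^ k"
  shows "\<exists>h\<in>H. conj_by h ` R \<subseteq> T"
proof -
  obtain m where "card H = m * card T" "\<not> p dvd m" using sylow_in_index[OF H p T] by blast
  then show ?thesis using psubgroup_conj_into[OF _ H _ R p] T by (auto simp: sylow_in_def)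
qed

lemma sylow_in_card_max:
  assumes H: "subgroup H G" and p: "Factorial_Ring.prime p" and T: "sylow_in p H T"
    and R: "subgroup R G" "R \<subseteq> H" "card R = p ^ k"
  shows "card R \<le> card T"
proof -
  obtain h where h: "h \<in> H" "conj_by h ` R \<subseteq> T" using sylow_in_absorbs[OF assms] by blast
  have "card (conj_by h ` R) \<le> card T" using h T by (intro card_mono) (auto simp: sylow_in_def)
  then show ?thesis using card_conj_by_image[OF sub_carrier[OF H h(1)] subgroup.subset[OF R(1)]] by simp
qed

lemma sylow_in_conj:
  assumes H: "subgroup H G" and p: "Factorial_Ring.prime p" and T: "sylow_in p H T"
    and T': "sylow_in p H T'"
  shows "\<exists>h\<in>H. conj_by h ` T' = T"
proof -
  have T'': "subgroup T' G" "T' \<subseteq> H" "card T' = p ^ multiplicity p (card H)" using T'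
    by (auto simp: sylow_in_def)
  obtain h where h: "h \<in> H" "conj_by h ` T' \<subseteq> T" using sylow_in_absorbs[OF H p T T''] by blast
  have "card (conj_by h ` T') = card T"
    using card_conj_by_image[OF sub_carrier[OF H h(1)] subgroup.subset[OF T''(1)]] T T''
      by (simp add: sylow_in_def)
  then have "conj_by h ` T' = T" using h(2) T by (intro card_subset_eq) (auto simp: sylow_in_def)
  then show ?thesis using h(1) by blast
qed

text \<open>A Sylow subgroup of \<open>W\<close> can be moved into \<open>T\<close> by an element of
  \<open>H\<close>, and it stays inside \<open>W\<close> because \<open>H\<close> normalizes
  \<open>W\<close>.\<close>

lemma sylow_in_Int:
  assumes H: "subgroup H G" and p: "Factorial_Ring.prime p" and T: "sylow_in p H T"
    and W: "normalized_by H W" "W \<subseteq> H"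
  shows "sylow_in p W (T \<inter> W)"
proof -
  note sW = normalized_by_subgroup[OF W(1)]
  have sT: "subgroup T G" using T by (simp add: sylow_in_def)
  have sTW: "subgroup (T \<inter> W) G" using subgroups_Inter_pair[OF sT sW] .
  obtain R where R: "sylow_in p W R" using sylow_in_exists[OF sW p] by blast
  then have R': "subgroup R G" "R \<subseteq> W" "card R = p ^ multiplicity p (card W)"
    by (auto simp: sylow_in_def)
  obtain h where h: "h \<in> H" "conj_by h ` R \<subseteq> T" using sylow_in_absorbs[OF H p T R'(1) _ R'(3)] R' W
    by auto
  have "conj_by h ` R \<subseteq> T \<inter> W" using h R' normalized_by_conj_by[OF W(1)] by auto
  then have "card (conj_by h ` R) \<le> card (T \<inter> W)" using sTW by (intro card_mono) auto
  then have "card R \<le> card (T \<inter> W)"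
    using card_conj_by_image[OF sub_carrier[OF H h(1)] subgroup.subset[OF R'(1)]] by simp
  moreover obtain k where k: "card (T \<inter> W) = p ^ k"
    using pgroup_sub[OF sTW sT _ _ p] T by (auto simp: sylow_in_def)
  then have "card (T \<inter> W) \<le> card R" using sylow_in_card_max[OF sW p R sTW] by auto
  ultimately show ?thesis using R' sTW by (simp add: sylow_in_def)
qed

lemma sylow_in_mono:
  assumes H: "subgroup H G" and p: "Factorial_Ring.prime p" and T: "sylow_in p H T"
    and K: "subgroup K G" "T \<subseteq> K" "K \<subseteq> H"
  shows "sylow_in p K T"
proof -
  have sT: "subgroup T G" "card T = p ^ multiplicity p (card H)" using T by (auto simp: sylow_in_def)
  obtain m where m: "card H = m * card T" "\<not> p dvd m" using sylow_in_index[OF H p T] by blast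
  obtain a where a: "card K = a * card T" using card_sub_dvd[OF sT(1) K(1,2)]
    by (auto simp: dvd_def mult.commute)
  obtain b where b: "card H = b * card K" using card_sub_dvd[OF K(1) H K(3)]
    by (auto simp: dvd_def mult.commute)
  have "m = b * a" using m a b card_pos[OF sT(1)] by simp
  then have "\<not> p dvd a" using m(2) by auto
  then show ?thesis using sylI[OF K(1) p sT(1) K(2) sT(2) a] by blast
qed

lemma frattini:
  assumes H: "subgroup H G" and p: "Factorial_Ring.prime p" and W: "normalized_by H W" "W \<subseteq> H"
    and T: "sylow_in p W T" and h: "h \<in> H"
  shows "\<exists>w\<in>W. \<exists>n\<in>H \<inter> normalizer_of T. h = w \<otimes> n"
proof -
  note sW = normalized_by_subgroup[OF W(1)] and Hc = sub_carrier[OF H]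
  have sT: "subgroup T G" "T \<subseteq> W" using T by (auto simp: sylow_in_def)
  have ih: "inv h \<in> H" using h subgroup.m_inv_closed[OF H] by blast
  have "sylow_in p W (conj_by (inv h) ` T)"
    using T normalized_by_conj_by[OF W(1) ih] conj_by_image_subgroup[OF Hc[OF ih] sT(1)]
      card_conj_by_image[OF Hc[OF ih] subgroup.subset[OF sT(1)]] by (auto simp: sylow_in_def)
  then obtain w where w: "w \<in> W" "conj_by w ` conj_by (inv h) ` T = T"
    using sylow_in_conj[OF sW p T] by blast
  have wc: "w \<in> carrier G" using w sub_carrier[OF sW] by blast
  define n where "n = inv h \<otimes> w"
  have n: "n \<in> H" unfolding n_def using subgroup.m_closed[OF H ih] w W by blast
  have "conj_by n x \<in> T" if "x \<in> T" for x
  proof -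
    have "conj_by n x = conj_by w (conj_by (inv h) x)" using that sub_carrier[OF sT(1)] wc Hc[OF ih]
      by (simp add: n_def conj_by_conj_by)
    then show ?thesis using w that by blast
  qed
  then have "n \<in> normalizer_of T" using Hc[OF n] by (simp add: normalizer_of_def)
  then have "inv n \<in> H \<inter> normalizer_of T"
    using n subgroup.m_inv_closed[OF H] subgroup.m_inv_closed[OF normalizer_of_subgroup[OF sT(1)]]
      by blast
  moreover have "h = w \<otimes> inv n" using h wc Hc by (simp add: n_def group_word_simps)
  ultimately show ?thesis using w by blast
qed

lemma chief_in_max_exists:
  assumes V: "normalized_by H V" and U: "normalized_by H U" and UV: "U \<subset> V"
  shows "\<exists>K. chief_in H V K \<and> U \<subseteq> K"
proof -
  define Fm where "Fm = {W. normalized_by H W \<and> U \<subseteq> W \<and> W \<subset> V}"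
  have "finite Fm"
    by (rule finite_subset[of _ "Pow V"])
    (use fin_sub[OF normalized_by_subgroup[OF V]] in \<open>auto simp: Fm_def\<close>)
  moreover have "U \<in> Fm" using assms by (auto simp: Fm_def)
  ultimately obtain K where K: "K \<in> Fm" "\<And>W. W \<in> Fm \<Longrightarrow> K \<subseteq> W \<Longrightarrow> W = K"
    using finite_has_maximal[of Fm] by (metis empty_iff)
  have "W = K \<or> W = V" if "normalized_by H W" "K \<subseteq> W" "W \<subseteq> V" for W
    using K(2)[of W] K(1) that by (cases "W = V") (auto simp: Fm_def)
  then show ?thesis using V K(1) by (intro exI[of _ K]) (simp add: chief_in_def Fm_def)
qed

lemma chief_in_min_exists:
  assumes V: "normalized_by H V" and U: "normalized_by H U" and UV: "U \<subset> V"
  shows "\<exists>K. chief_in H K U \<and> K \<subseteq> V"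
proof -
  define Fm where "Fm = {W. normalized_by H W \<and> U \<subset> W \<and> W \<subseteq> V}"
  have "finite Fm"
    by (rule finite_subset[of _ "Pow V"])
    (use fin_sub[OF normalized_by_subgroup[OF V]] in \<open>auto simp: Fm_def\<close>)
  moreover have "V \<in> Fm" using assms by (auto simp: Fm_def)
  ultimately obtain K where K: "K \<in> Fm" "\<And>W. W \<in> Fm \<Longrightarrow> W \<subseteq> K \<Longrightarrow> W = K"
    using finite_has_minimal[of Fm] by (metis empty_iff)
  have "W = U \<or> W = K" if "normalized_by H W" "U \<subseteq> W" "W \<subseteq> K" for W
    using K(2)[of W] K(1) that by (cases "W = U") (auto simp: Fm_def)
  then show ?thesis using U K(1) by (intro exI[of _ K]) (simp add: chief_in_def Fm_def)
qed

end

section \<open>Eigenvectors of automorphisms whose order divides p - 1\<close>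

text \<open>Multiplication by a primitive root \<open>g\<close> permutes the nonzero residues, so
  the sum \<open>s\<close> satisfies \<open>s = g^j s\<close> modulo \<open>p\<close>, while
  \<open>g^j\<close> is not 1 in this range of \<open>j\<close>.\<close>

lemma prime_dvd_power_sum:
  fixes p j :: nat
  assumes p: "Factorial_Ring.prime p" and j: "0 < j" "j < p - 1"
  shows "p dvd (\<Sum>c=1..p - 1. c ^ j)"
proof -
  have p1: "1 < p" using p prime_gt_1_nat by blast
  obtain g where g: "residue_primroot p g"
    using prime_primitive_root_exists[of p] p p1 by auto
  have cong_mod: "coprime p g" and og: "ord p g = p - 1"
    using g p by (auto simp: residue_primroot_def totient_prime)
  have ng: "\<not> [g ^ j = 1] (mod p)"
    using j og ord_divides[of g j p] by (auto dest: dvd_imp_le)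
  let ?f = "\<lambda>c. (g * c) mod p"
  let ?I = "{1..p - 1}"
  have inj: "inj_on ?f ?I"
  proof (rule inj_onI)
    fix a b assume ab: "a \<in> ?I" "b \<in> ?I" "?f a = ?f b"
    then have "[g * a = g * b] (mod p)" by (simp add: cong_def)
    then have "[a = b] (mod p)" using cong_mod by (simp add: cong_mult_lcancel_nat coprime_commute)
    moreover have "a < p" "b < p" using ab p1 by auto
    ultimately show "a = b" by (simp add: cong_def)
  qed
  have "?f ` ?I \<subseteq> ?I"
  proof
    fix y assume "y \<in> ?f ` ?I"
    then obtain c where c: "c \<in> ?I" "y = ?f c" by auto
    have "\<not> p dvd g * c"
      using c p cong_mod p1 by (auto simp: prime_dvd_mult_iff coprime_absorb_left dest: dvd_imp_le)
    then have "y \<noteq> 0" using c by (auto simp: dvd_eq_mod_eq_0)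
    moreover have "y < p" using c p1 by simp
    ultimately show "y \<in> ?I" by auto
  qed
  then have im: "?f ` ?I = ?I" using inj by (simp add: endo_inj_surj)
  let ?s = "\<Sum>c\<in>?I. c ^ j"
  have "?s = (\<Sum>c\<in>?f ` ?I. c ^ j)" using im by simp
  also have "\<dots> = (\<Sum>c\<in>?I. (?f c) ^ j)" using inj by (simp add: sum.reindex)
  finally have "?s = (\<Sum>c\<in>?I. (?f c) ^ j)" .
  moreover have "[(\<Sum>c\<in>?I. (?f c) ^ j) = (\<Sum>c\<in>?I. g ^ j * c ^ j)] (mod p)"
  proof (rule cong_sum)
    fix c
    have "[(?f c) ^ j = (g * c) ^ j] (mod p)" by (intro cong_pow) (simp add: cong_def)
    then show "[(?f c) ^ j = g ^ j * c ^ j] (mod p)" by (simp add: power_mult_distrib)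
  qed
  ultimately have "[?s = (\<Sum>c\<in>?I. g ^ j * c ^ j)] (mod p)" by (simp only:)
  then have "[?s = g ^ j * ?s] (mod p)" by (simp only: sum_distrib_left)
  then have "[?s * g ^ j = ?s * 1] (mod p)" by (simp add: mult.commute cong_sym_eq)
  moreover have "\<not> coprime ?s p"
  proof
    assume "coprime ?s p"
    then have "[g ^ j = 1] (mod p)" using calculation cong_mult_lcancel_nat by blast
    then show False using ng by simp
  qed
  ultimately show ?thesis using p by (metis coprime_commute prime_imp_coprime)
qed

lemma prime_cong_power_sum:
  fixes p :: nat
  assumes p: "Factorial_Ring.prime p"
  shows "[(\<Sum>c=1..p - 1. c ^ (p - 1)) = p - 1] (mod p)"
proof -
  have p1: "1 < p" using p prime_gt_1_nat by blast
  have "[(\<Sum>c=1..p - 1. c ^ (p - 1)) = (\<Sum>c=1..p - 1. 1)] (mod p)"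
  proof (rule cong_sum)
    fix c assume "c \<in> {1..p - 1}"
    then have "\<not> p dvd c" using p1 by (auto dest: dvd_imp_le)
    then show "[c ^ (p - 1) = 1] (mod p)" using p fermat_theorem by blast
  qed
  then show ?thesis by simp
qed

context comm_monoid
begin

lemma finprod_pow:
  assumes "f \<in> A \<rightarrow> carrier G"
  shows "(\<Otimes>i\<in>A. f i) [^] (n::nat) = (\<Otimes>i\<in>A. f i [^] n)"
proof (induction n)
  case (Suc n)
  have "(\<lambda>i. f i [^] n) \<in> A \<rightarrow> carrier G" using assms by auto
  then show ?case using Suc assms by simp
qed simp

lemma finprod_pow_sum:
  assumes "x \<in> carrier G"
  shows "(\<Otimes>i\<in>A. x [^] (e i :: nat)) = x [^] (\<Sum>i\<in>A. e i)"
  by (induction A rule: infinite_finite_induct) (use assms in \<open>auto simp: nat_pow_mult\<close>)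

lemma finprod_swap:
  assumes "finite A" "\<And>i j. i \<in> A \<Longrightarrow> j \<in> B \<Longrightarrow> f i j \<in> carrier G"
  shows "(\<Otimes>i\<in>A. \<Otimes>j\<in>B. f i j) = (\<Otimes>j\<in>B. \<Otimes>i\<in>A. f i j)"
  using assms
proof (induction A rule: finite_induct)
  case (insert a A)
  have "(\<Otimes>i\<in>insert a A. \<Otimes>j\<in>B. f i j) = (\<Otimes>j\<in>B. f a j) \<otimes> (\<Otimes>i\<in>A. \<Otimes>j\<in>B. f i j)"
    using insert by (intro finprod_insert) auto
  also have "\<dots> = (\<Otimes>j\<in>B. f a j) \<otimes> (\<Otimes>j\<in>B. \<Otimes>i\<in>A. f i j)" using insert by simp
  also have "\<dots> = (\<Otimes>j\<in>B. f a j \<otimes> (\<Otimes>i\<in>A. f i j))"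
    using insert by (intro finprod_multf[symmetric]) auto
  also have "\<dots> = (\<Otimes>j\<in>B. \<Otimes>i\<in>insert a A. f i j)"
    using insert by (intro finprod_cong' refl finprod_insert[symmetric]) auto
  finally show ?case .
qed simp

end

text \<open>The polynomial \<open>X^(p-1) - 1\<close> has all nonzero residues as simple roots, so
  \<open>x\<close> is a combination of eigenvectors lying in the span of its orbit. They are written
  down explicitly, and one of them is nontrivial because, additively, their sum is
  \<open>(p - 1) x\<close>.\<close>

lemma (in comm_group) eigenvector_exists:
  assumes p: "Factorial_Ring.prime p" and exp_p: "\<And>y. y \<in> carrier G \<Longrightarrow> y [^] p = \<one>"
    and a: "a \<in> hom G G" and x: "x \<in> carrier G" "x \<noteq> \<one>" "(a ^^ (p - 1)) x = x"
  shows "\<exists>v\<in>carrier G. \<exists>c::nat. v \<noteq> \<one> \<and> a v = v [^] c"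
proof -
  have p1: "1 < p" using p prime_gt_1_nat by blast
  define n where "n = p - 2"
  have n: "p - 1 = Suc n" "p = Suc (Suc n)" using p1 by (auto simp: n_def)
  define y where "y i = (a ^^ i) x" for i
  have yc [simp]: "y i \<in> carrier G" for i
    by (induction i) (use a x in \<open>auto simp: y_def hom_def\<close>)
  have pow_cong: "z [^] k = z [^] l" if "z \<in> carrier G" "[k = l] (mod p)" for z and k l :: nat
  proof -
    have red: "z [^] k = z [^] (k mod p)" for k :: nat
    proof -
      have "z [^] k = z [^] (p * (k div p) + k mod p)" by simp
      also have "\<dots> = (z [^] p) [^] (k div p) \<otimes> z [^] (k mod p)"
        using that(1) by (simp only: nat_pow_mult[symmetric] nat_pow_pow nat_pow_closed)
      finally show ?thesis using exp_p that(1) by simp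
    qed
    show ?thesis using red[of k] red[of l] that(2) by (simp add: cong_def)
  qed
  have hom_fin: "a (finprod G f A) = finprod G (\<lambda>i. a (f i)) A"
    if "finite A" "f \<in> A \<rightarrow> carrier G" for f and A :: "nat set"
    using that
  proof (induction A rule: finite_induct)
    case empty
    have "a \<one> = \<one>" using a group_hom.hom_one[of G G a] by (simp add: group_hom_def group_hom_axioms_def)
    then show ?case by simp
  next
    case (insert i A)
    have af: "(\<lambda>i. a (f i)) \<in> A \<rightarrow> carrier G" "a (f i) \<in> carrier G" using insert a by (auto simp: hom_def)
    have "a (f i \<otimes> finprod G f A) = a (f i) \<otimes> a (finprod G f A)"
      using insert a by (auto simp: hom_def)
    then show ?case using insert af by simp
  qed
  have hom_pow: "a (z [^] (k::nat)) = a z [^] k" if "z \<in> carrier G" for z k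
    using a that group_hom.hom_nat_pow[of G G a z k] by (simp add: group_hom_def group_hom_axioms_def)
  \<comment> \<open>up to the factor $p - 1$, the component of \<open>x\<close> in the eigenspace of \<open>a\<close> for the eigenvalue \<open>c\<close>\<close>
  define v where "v c = (\<Otimes>i\<in>{..n}. y i [^] (c ^ (p - 1 - i)))" for c :: nat
  have vc: "v c \<in> carrier G" for c by (auto simp: v_def intro!: finprod_closed)
  have eig: "a (v c) = v c [^] c" for c
  proof -
    \<comment> \<open>\<open>g i\<close> is the c-th power of the i-th factor of \<open>v c\<close>,
      and \<open>g (Suc i)\<close> is the image of that factor under \<open>a\<close>. The two
      products differ only in the end terms \<open>g 0\<close> and \<open>g (p - 1)\<close>, which
      agree since \<open>c^p = c\<close> modulo \<open>p\<close> and \<open>a^(p-1)\<close> fixes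
      \<open>x\<close>.\<close>
    define g where "g i = y i [^] (c ^ (p - i))" for i
    have gc: "g \<in> A \<rightarrow> carrier G" for A by (auto simp: g_def)
    have "a (v c) = (\<Otimes>i\<in>{..n}. a (y i [^] (c ^ (p - 1 - i))))"
      unfolding v_def by (rule hom_fin) auto
    also have "\<dots> = (\<Otimes>i\<in>{..n}. g (Suc i))"
      using gc[of UNIV]
        by (intro finprod_cong' refl) (use hom_pow[OF yc] yc[of "Suc _"] in \<open>auto simp: g_def y_def\<close>)
    finally have 1: "a (v c) = (\<Otimes>i\<in>{..n}. g (Suc i))" .
    have "v c [^] c = (\<Otimes>i\<in>{..n}. (y i [^] (c ^ (p - 1 - i))) [^] c)"
      unfolding v_def by (rule finprod_pow) auto
    also have "\<dots> = (\<Otimes>i\<in>{..n}. g i)"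
    proof (rule finprod_cong')
      fix i assume "i \<in> {..n}"
      then have "p - i = Suc (p - 1 - i)" using n by auto
      then show "(y i [^] (c ^ (p - 1 - i))) [^] c = g i"
        by (simp add: g_def nat_pow_pow mult.commute)
    qed (use gc in auto)
    finally have 2: "v c [^] c = (\<Otimes>i\<in>{..n}. g i)" .
    have "g (Suc n) = x [^] c" using n x(3) by (simp add: g_def y_def)
    moreover have "g 0 = x [^] (c ^ p)" by (simp add: g_def y_def)
    moreover have "[c ^ p = c] (mod p)"
    proof (cases "p dvd c")
      case True
      then have "p dvd c ^ p" using p1 by (intro dvd_trans[OF True dvd_power]) simp
      then show ?thesis using True by (simp add: cong_def dvd_imp_mod_0)
    next
      case False
      then have "[c ^ (p - 1) = 1] (mod p)" using p fermat_theorem by blast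
      then have "[c ^ (p - 1) * c = 1 * c] (mod p)" by (rule cong_mult) simp
      moreover have "c ^ p = c ^ (p - 1) * c" using n by simp
      ultimately show ?thesis by simp
    qed
    ultimately have 3: "g 0 = g (Suc n)" using pow_cong[OF x(1)] by simp
    have "g (Suc n) \<otimes> (\<Otimes>i\<in>{..n}. g i) = (\<Otimes>i\<in>{..n}. g (Suc i)) \<otimes> g 0"
      using finprod_Suc[of g n] finprod_Suc2[of g n] gc by simp
    then have "g 0 \<otimes> (\<Otimes>i\<in>{..n}. g i) = g 0 \<otimes> (\<Otimes>i\<in>{..n}. g (Suc i))"
      using 3 gc[of UNIV] by (simp add: m_comm Pi_def)
    then have "(\<Otimes>i\<in>{..n}. g i) = (\<Otimes>i\<in>{..n}. g (Suc i))"
      using gc[of UNIV] by (simp add: Pi_def)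
    then show ?thesis using 1 2 by simp
  qed
  have "\<exists>c\<in>{1..p - 1}. v c \<noteq> \<one>"
  proof (rule ccontr)
    assume "\<not> ?thesis"
    then have trivial: "(\<Otimes>c\<in>{1..p - 1}. v c) = \<one>" by (intro finprod_one_eqI) auto
    \<comment> \<open>After the exchange of the products, the exponent of \<open>y i\<close> is the
      power sum of the \<open>c^(p-1-i)\<close>. It vanishes modulo \<open>p\<close> except for
      \<open>i = 0\<close>, where it is \<open>p - 1\<close>.\<close>
    have "(\<Otimes>c\<in>{1..p - 1}. v c) = (\<Otimes>i\<in>{..n}. \<Otimes>c\<in>{1..p - 1}. y i [^] (c ^ (p - 1 - i)))"
      unfolding v_def by (rule finprod_swap) auto
    also have "\<dots> = (\<Otimes>i\<in>{..n}. y i [^] (\<Sum>c\<in>{1..p - 1}. c ^ (p - 1 - i)))"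
      by (intro finprod_cong') (auto simp: finprod_pow_sum)
    also have "\<dots> = (\<Otimes>i\<in>{..n}. if 0 = i then x [^] (p - 1) else \<one>)"
    proof (rule finprod_cong')
      fix i assume i: "i \<in> {..n}"
      show "y i [^] (\<Sum>c\<in>{1..p - 1}. c ^ (p - 1 - i)) = (if 0 = i then x [^] (p - 1) else \<one>)"
      proof (cases "i = 0")
        case True
        then show ?thesis using pow_cong[OF x(1) prime_cong_power_sum[OF p]] by (simp add: y_def)
      next
        case False
        then have "p dvd (\<Sum>c\<in>{1..p - 1}. c ^ (p - 1 - i))"
          using prime_dvd_power_sum[OF p, of "p - 1 - i"] i n by auto
        then have "y i [^] (\<Sum>c\<in>{1..p - 1}. c ^ (p - 1 - i)) = y i [^] (0::nat)"
          by (intro pow_cong) (auto simp: cong_0_iff)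
        then show ?thesis using False by simp
      qed
    qed (use x in auto)
    also have "\<dots> = x [^] (p - 1)"
      using finprod_singleton[of 0 "{..n}" "\<lambda>_. x [^] (p - 1)"] x by simp
    finally have "x [^] (p - 1) = \<one>" using trivial by simp
    moreover have "x [^] p = x [^] (p - 1) \<otimes> x" using n by simp
    ultimately show False using exp_p[OF x(1)] x by simp
  qed
  then show ?thesis using eig vc by blast
qed

section \<open>Chief factors of p-power order and coprime action\<close>

definition (in group) centralizes_mod :: "'a \<Rightarrow> 'a set \<Rightarrow> 'a set \<Rightarrow> bool"
  where "centralizes_mod h N K \<longleftrightarrow> (\<forall>x\<in>N. cong_mod K x (conj_by h x))"

context fin_group
begin

lemma chief_inD:
  assumes "chief_in H V U"
  shows "normalized_by H V" "normalized_by H U" "U \<subset> V" "subgroup V G" "subgroup U G"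
    "normalized_by H W \<Longrightarrow> U \<subseteq> W \<Longrightarrow> W \<subseteq> V \<Longrightarrow> W = U \<or> W = V"
  using assms normalized_by_subgroup by (auto simp: chief_in_def)

lemma pgroup_elem_pow:
  assumes T: "subgroup T G" and y: "y \<in> T" shows "y [^] card T = \<one>"
proof -
  interpret T: group "G\<lparr>carrier := T\<rparr>" using T by (rule subgroup_imp_group)
  have "y [^]\<^bsub>G\<lparr>carrier := T\<rparr>\<^esub> order (G\<lparr>carrier := T\<rparr>) = \<one>\<^bsub>G\<lparr>carrier := T\<rparr>\<^esub>"
    using y by (intro T.pow_order_eq_1) simp
  then show ?thesis using nat_pow_consistent[of y _ T] by (simp add: order_def)
qed

text \<open>\<open>V/U\<close> is an image of the p-group \<open>T\<close>, and an irreducible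
  p-group equals its centre and is killed by \<open>p\<close>. \<open>V\<close> itself need not be a
  p-group; this is essential for chief factors of \<open>G\<close>, where only
  \<open>V = U (S \<inter> V)\<close> is known.\<close>

lemma chief_pquotient_elementary:
  assumes H: "subgroup H G" and ch: "chief_in H V U" and VH: "V \<subseteq> H"
    and T: "subgroup T G" "T \<subseteq> V" "card T = p ^ n" and p: "Factorial_Ring.prime p"
    and VT: "V \<subseteq> U <#> T"
  shows "\<And>x y. x \<in> V \<Longrightarrow> y \<in> V \<Longrightarrow> cong_mod U x (conj_by y x)" "\<And>x. x \<in> V \<Longrightarrow> x [^] p \<in> U"
proof -
  note nV = chief_inD(1)[OF ch] and nU = chief_inD(2)[OF ch] and UV = chief_inD(3)[OF ch]
    and sV = chief_inD(4)[OF ch] and sU = chief_inD(5)[OF ch]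
  note Hc = sub_carrier[OF H] and Vc = sub_carrier[OF sV] and Uc = sub_carrier[OF sU]
  have nVU: "normalized_by V U" using normalized_by_mono[OF nU VH] .
  \<comment> \<open>The preimage of the centre of \<open>V/U\<close>. It is larger than
    \<open>U\<close> because \<open>T\<close> fixes a nontrivial coset of
    \<open>T \<inter> U\<close> in \<open>T\<close>, and \<open>U\<close> acts trivially modulo
    \<open>U\<close>.\<close>
  define Z where "Z = {v \<in> V. \<forall>s\<in>V. cong_mod U v (conj_by s v)}"
  have cjV: "conj_by s v \<in> V" if "s \<in> V" "v \<in> V" for s v
    using that normalized_by_conj_by[OF normalized_by_self[OF sV]] by blast
  have sZ: "subgroup Z G"
  proof (rule fin_subgroupI)
    show "Z \<subseteq> carrier G" using Vc by (auto simp: Z_def)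
    show "\<one> \<in> Z" using subgroup.one_closed[OF sV] Vc cong_mod_refl[OF sU] by (simp add: Z_def)
    fix x y assume "x \<in> Z" "y \<in> Z"
    then have xy: "x \<in> V" "y \<in> V" "\<And>s. s \<in> V \<Longrightarrow> cong_mod U x (conj_by s x)"
      "\<And>s. s \<in> V \<Longrightarrow> cong_mod U y (conj_by s y)"
      by (auto simp: Z_def)
    have "cong_mod U (x \<otimes> y) (conj_by s (x \<otimes> y))" if s: "s \<in> V" for s
      using cong_mod_mult[OF nVU sV xy(1) cjV[OF s xy(1)] xy(2) cjV[OF s xy(2)] xy(3)[OF s] xy(4)[OF s]]
        xy(1,2) s Vc by (simp add: conj_by_mult)
    then show "x \<otimes> y \<in> Z" using xy subgroup.m_closed[OF sV] by (simp add: Z_def)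
  qed
  have "normalized_by H Z"
  proof -
    have "conj_by h x \<in> Z" if h: "h \<in> H" "x \<in> Z" for h x
    proof -
      have x: "x \<in> V" "\<And>s. s \<in> V \<Longrightarrow> cong_mod U x (conj_by s x)" using h by (auto simp: Z_def)
      have "cong_mod U (conj_by h x) (conj_by s (conj_by h x))" if s: "s \<in> V" for s
      proof -
        have s': "conj_by (inv h) s \<in> V"
          using normalized_by_conj_by[OF nV _ s] subgroup.m_inv_closed[OF H h(1)] by simp
        have "cong_mod U (conj_by h x) (conj_by h (conj_by (conj_by (inv h) s) x))"
          using cong_mod_conj_by[OF nU h(1) Hc[OF h(1)] _ _ x(2)[OF s']] x s' Vc cjV by simp
        moreover have "conj_by h (conj_by (conj_by (inv h) s) x) = conj_by s (conj_by h x)"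
          using h(1) Hc s x Vc by (simp add: conj_by_def group_word_simps)
        ultimately show ?thesis by simp
      qed
      then show ?thesis using normalized_by_conj_by[OF nV h(1) x(1)] by (simp add: Z_def)
    qed
    then show ?thesis using sZ by (simp add: normalized_by_def)
  qed
  moreover have UZ: "U \<subseteq> Z"
  proof
    fix u assume u: "u \<in> U"
    then have "u \<in> V" using UV by blast
    moreover have "cong_mod U u (conj_by s u)" if "s \<in> V" for s
      using normalized_by_conj_by[OF nVU that u] u subgroup.m_closed[OF sU] subgroup.m_inv_closed[OF sU]
      by (simp add: cong_mod_def)
    ultimately show "u \<in> Z" by (simp add: Z_def)
  qed
  moreover have "Z \<subseteq> V" by (auto simp: Z_def)
  ultimately have ZUV: "Z = U \<or> Z = V" using chief_inD(6)[OF ch] by blast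
  have TU: "T \<inter> U \<subset> T"
  proof -
    have "\<not> T \<subseteq> U"
    proof
      assume "T \<subseteq> U"
      then have "U <#> T \<subseteq> U" by (intro set_mult_in[OF sU]) auto
      then show False using VT UV by blast
    qed
    then show ?thesis by blast
  qed
  have nT: "normalized_by T T" using normalized_by_self[OF T(1)] .
  have nTU: "normalized_by T (T \<inter> U)"
    using normalized_by_Int[OF nT normalized_by_mono[OF nVU T(2)]] .
  obtain y where y: "y \<in> T - (T \<inter> U)" "\<And>g. g \<in> T \<Longrightarrow> cong_mod (T \<inter> U) y (conj_by g y)"
    using pgroup_fixed_in_quotient[OF T(1,3) p nT nTU TU T(3)] by blast
  have yV: "y \<in> V" "y \<notin> U" using y T(2) by auto
  have "y \<in> Z"
  proof -
    have "cong_mod U y (conj_by s y)" if s: "s \<in> V" for s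
    proof -
      from s VT obtain u t where ut: "u \<in> U" "t \<in> T" "s = u \<otimes> t" by (auto simp: set_mult_def)
      have uV: "u \<in> V" "t \<in> V" using ut UV T(2) by auto
      have "conj_by (inv y) (inv u) \<otimes> u \<in> U"
        using normalized_by_conj_by[OF nVU subgroup.m_inv_closed[OF sV yV(1)]] ut(1)
          subgroup.m_closed[OF sU] subgroup.m_inv_closed[OF sU]
        by simp
      have "inv u \<otimes> conj_by y u \<in> U"
        using normalized_by_conj_by[OF nVU yV(1) ut(1)] ut(1) subgroup.m_closed[OF sU]
        subgroup.m_inv_closed[OF sU]
        by simp
      then have "inv (inv u \<otimes> conj_by y u) \<in> U" using subgroup.m_inv_closed[OF sU] by blast
      then have "cong_mod U y (conj_by u y)"
        using normalized_by_conj_by[OF nVU, of y "inv u"] yV uV ut Vc sU subgroup.m_closed[OF sU]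
          subgroup.m_inv_closed[OF sU]
        by (simp add: cong_mod_def conj_by_def group_word_simps)
      then have "cong_mod U (conj_by t y) (conj_by t (conj_by u y))"
        using cong_mod_conj_by[OF nVU uV(2)] Vc uV yV by simp
      moreover have "cong_mod U y (conj_by t y)" using cong_mod_mono[OF y(2)[OF ut(2)]] by blast
      ultimately have "cong_mod U y (conj_by t (conj_by u y))"
        using cong_mod_trans[OF sU] Vc uV yV by (meson conj_by_closed)
      then show ?thesis using ut Vc uV yV by (simp add: conj_by_conj_by)
    qed
    then show ?thesis using yV by (simp add: Z_def)
  qed
  then have ZV: "Z = V" using ZUV yV by blast
  then show comm: "\<And>x y. x \<in> V \<Longrightarrow> y \<in> V \<Longrightarrow> cong_mod U x (conj_by y x)" by (auto simp: Z_def)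
  have comm2: "cong_mod U (x \<otimes> z) (z \<otimes> x)" if "x \<in> V" "z \<in> V" for x z
  proof -
    have "cong_mod U z (conj_by x z)" using comm that by blast
    then have "cong_mod U (x \<otimes> z) (x \<otimes> conj_by x z)" using that Vc
      by (simp add: cong_mod_def group_word_simps)
    moreover have "x \<otimes> conj_by x z = z \<otimes> x" using that Vc by (simp add: conj_by_def group_word_simps)
    ultimately show ?thesis by simp
  qed
  have vp: "v [^] (k::nat) \<in> V" if "v \<in> V" for v k using subgroup_pow_closed[OF sV that] .
  have powm: "cong_mod U ((x \<otimes> z) [^] (k::nat)) (x [^] k \<otimes> z [^] k)" if xz: "x \<in> V" "z \<in> V" for x z k
  proof (induction k)
    case 0 show ?case by (simp add: cong_mod_refl[OF sU])
  next
    case (Suc k)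
    have xzV: "x \<otimes> z \<in> V" using subgroup.m_closed[OF sV] xz by blast
    note cl = vp[OF xz(1)] vp[OF xz(2)] vp[OF xzV] xz xzV subgroup.m_closed[OF sV]
    have 1: "cong_mod U ((x \<otimes> z) [^] k \<otimes> (x \<otimes> z)) ((x [^] k \<otimes> z [^] k) \<otimes> (x \<otimes> z))"
      using cong_mod_mult[OF nVU sV _ _ _ _ Suc cong_mod_refl[OF sU]] cl Vc by simp
    have "cong_mod U (z [^] k \<otimes> x) (x \<otimes> z [^] k)" using comm2 cl by blast
    then have "cong_mod U ((z [^] k \<otimes> x) \<otimes> z) ((x \<otimes> z [^] k) \<otimes> z)"
      using cong_mod_mult[OF nVU sV _ _ _ _ _ cong_mod_refl[OF sU]] cl Vc by simp
    then have "cong_mod U (x [^] k \<otimes> ((z [^] k \<otimes> x) \<otimes> z)) (x [^] k \<otimes> ((x \<otimes> z [^] k) \<otimes> z))"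
      using cong_mod_mult[OF nVU sV _ _ _ _ cong_mod_refl[OF sU]] cl Vc by simp
    then have 2: "cong_mod U ((x [^] k \<otimes> z [^] k) \<otimes> (x \<otimes> z)) (x [^] Suc k \<otimes> z [^] Suc k)"
      using Vc[OF cl(1)] Vc[OF cl(2)] Vc xz by (simp add: m_assoc)
    show ?case using cong_mod_trans[OF sU _ _ _ 1 2] Vc cl by simp
  qed
  \<comment> \<open>The preimage of the elements of order dividing \<open>p\<close>, a subgroup
    because \<open>V/U\<close> is now known to be abelian.\<close>
  define Y where "Y = {v \<in> V. v [^] p \<in> U}"
  have sY: "subgroup Y G"
  proof (rule fin_subgroupI)
    show "Y \<subseteq> carrier G" using Vc by (auto simp: Y_def)
    show "\<one> \<in> Y" using subgroup.one_closed[OF sV] subgroup.one_closed[OF sU] by (simp add: Y_def)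
    fix x z assume "x \<in> Y" "z \<in> Y"
    then have xz: "x \<in> V" "z \<in> V" "x [^] p \<in> U" "z [^] p \<in> U" by (auto simp: Y_def)
    have "x [^] p \<otimes> z [^] p \<in> U" using xz subgroup.m_closed[OF sU] by blast
    then have "(x \<otimes> z) [^] p \<in> U"
      using cong_mod_in[OF sU sU subset_refl _ _ powm[OF xz(1,2), of p]] Vc xz by simp
    then show "x \<otimes> z \<in> Y" using xz subgroup.m_closed[OF sV] by (simp add: Y_def)
  qed
  have "normalized_by H Y"
    using sY normalized_by_conj_by[OF nV] normalized_by_conj_by[OF nU] Hc Vc
    by (auto simp: normalized_by_def Y_def conj_by_pow[symmetric])
  moreover have "U \<subseteq> Y" using UV subgroup_pow_closed[OF sU] by (auto simp: Y_def)
  moreover have "Y \<subseteq> V" by (auto simp: Y_def)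
  ultimately have YUV: "Y = U \<or> Y = V" using chief_inD(6)[OF ch] by blast
  \<comment> \<open>The last iterated p-th power of \<open>y\<close> outside \<open>U\<close> is an
    element of \<open>Y\<close> outside \<open>U\<close>.\<close>
  have "\<exists>j. y [^] (p ^ j) \<notin> U \<and> y [^] (p ^ Suc j) \<in> U"
  proof (rule ccontr)
    assume "\<not> ?thesis"
    then have "y [^] (p ^ j) \<notin> U" for j
      by (induction j) (use yV Vc in auto)
    moreover have "y [^] (p ^ n) = \<one>" using pgroup_elem_pow[OF T(1), of y] T(3) y(1) by simp
    ultimately show False using subgroup.one_closed[OF sU] by metis
  qed
  then obtain j where j: "y [^] (p ^ j) \<notin> U" "y [^] (p ^ Suc j) \<in> U" by blast
  have "y [^] (p ^ j) \<in> Y" using j vp[OF yV(1)] Vc[OF yV(1)]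
    by (simp add: Y_def nat_pow_pow mult.commute)
  then have "Y = V" using YUV j(1) by blast
  then show "\<And>x. x \<in> V \<Longrightarrow> x [^] p \<in> U" by (auto simp: Y_def)
qed

lemma pow_coprime_mem:
  assumes L: "subgroup L G" and k: "k \<in> carrier G" "k [^] (a::nat) \<in> L" "k [^] (b::nat) \<in> L"
    and ab: "coprime a b" "a \<noteq> 0"
  shows "k \<in> L"
proof -
  obtain u v where uv: "a * u = b * v + 1" using bezout_nat[OF ab(2), of b] ab(1) by auto
  have "(k [^] b) [^] v \<otimes> k = (k [^] a) [^] u" using uv k(1) by (simp add: nat_pow_pow)
  then have "(k [^] b) [^] v \<otimes> k \<in> L" using subgroup_pow_closed[OF L k(2)] by simp
  then show ?thesis using sub_mult_left_iff[OF L subgroup_pow_closed[OF L k(3)] k(1)] by blast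
qed

text \<open>If \<open>k = inv x \<otimes> conj_by h x\<close>, then $x^{h^m} \equiv x k^m$ modulo $L$ for all $m$; for $m$ the order
  of \<open>h\<close> this gives $k^m \in L$, and \<open>k\<close> has $p$-power order.\<close>
lemma coprime_stable_chain:
  assumes P: "subgroup K G" "card K = p ^ n" "Factorial_Ring.prime p"
    and h: "h \<in> carrier G" "coprime (ord h) p"
    and N: "N \<subseteq> carrier G" and hK: "\<And>x. x \<in> K \<Longrightarrow> conj_by h x \<in> K" and hL: "normalized_by {h} L"
      and LK: "L \<subseteq> K"
    and c1: "centralizes_mod h N K" and c2: "centralizes_mod h K L"
  shows "centralizes_mod h N L"
  unfolding centralizes_mod_def
proof
  fix x assume x: "x \<in> N"
  note sL = normalized_by_subgroup[OF hL] and Kc = sub_carrier[OF P(1)]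
  have xc: "x \<in> carrier G" using x N by blast
  define k where "k = inv x \<otimes> conj_by h x"
  have k: "k \<in> K" "k \<in> carrier G" using c1 x Kc by (auto simp: centralizes_mod_def cong_mod_def k_def)
  have kp: "k [^] (m::nat) \<in> K" for m using subgroup_pow_closed[OF P(1) k(1)] .
  have "cong_mod L (conj_by (h [^] m) x) (x \<otimes> k [^] m)" for m :: nat
  proof (induction m)
    case 0 show ?case using xc by (simp add: cong_mod_refl[OF sL])
  next
    case (Suc m)
    have "cong_mod L (conj_by h (conj_by (h [^] m) x)) (conj_by h (x \<otimes> k [^] m))"
      using cong_mod_conj_by[OF hL _ h(1) _ _ Suc] h(1) xc k by simp
    moreover have "conj_by h (conj_by (h [^] m) x) = conj_by (h [^] Suc m) x" using h(1) xc
      by (simp add: conj_by_conj_by)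
    moreover have "conj_by h (x \<otimes> k [^] m) = (x \<otimes> k) \<otimes> conj_by h (k [^] m)"
      using h(1) xc k by (simp add: conj_by_mult k_def inv_cancel)
    moreover have "cong_mod L (k [^] m) (conj_by h (k [^] m))" using c2 kp
      by (simp add: centralizes_mod_def)
    then have "cong_mod L (conj_by h (k [^] m)) (k [^] m)" using cong_mod_sym[OF sL] Kc kp h(1) by simp
    then have "cong_mod L ((x \<otimes> k) \<otimes> conj_by h (k [^] m)) ((x \<otimes> k) \<otimes> k [^] m)"
      using xc k h(1) Kc[OF kp] by (simp add: cong_mod_def group_word_simps)
    ultimately have "cong_mod L (conj_by (h [^] Suc m) x) ((x \<otimes> k) \<otimes> k [^] m)"
      using cong_mod_trans[OF sL, of "conj_by (h [^] Suc m) x" "(x \<otimes> k) \<otimes> conj_by h (k [^] m)" "(x \<otimes> k) \<otimes> k [^] m"] xc k h(1) by simp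
    moreover have "(x \<otimes> k) \<otimes> k [^] m = x \<otimes> k [^] Suc m"
      using xc k nat_pow_Suc2[of k m] by (simp add: m_assoc)
    ultimately show ?case by simp
  qed
  from this[of "ord h"] have "cong_mod L x (x \<otimes> k [^] ord h)" using h(1) xc by simp
  then have "k [^] ord h \<in> L" using xc k by (simp add: cong_mod_def group_word_simps)
  moreover have "k [^] (p ^ n) \<in> L"
    using pgroup_elem_pow[OF P(1) k(1)] P(2) subgroup.one_closed[OF sL] by simp
  moreover have "ord h \<noteq> 0" using ord_ge_1[OF fin h(1)] by simp
  ultimately have "k \<in> L" using pow_coprime_mem[OF sL k(2)] h(2) by (simp add: coprime_power_right_iff)
  then show "cong_mod L x (conj_by h x)" by (simp add: cong_mod_def k_def)
qed

lemma centralizes_mod_pow: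
  assumes h: "h \<in> carrier G" and N: "\<And>x. x \<in> N \<Longrightarrow> conj_by h x \<in> N" "N \<subseteq> carrier G"
    and K: "normalized_by {h} K"
    and c: "centralizes_mod h N K"
  shows "centralizes_mod (h [^] (m::nat)) N K"
proof (induction m)
  case 0 show ?case using N normalized_by_subgroup[OF K]
    by (auto simp: centralizes_mod_def cong_mod_refl)
next
  case (Suc m)
  note sK = normalized_by_subgroup[OF K]
  have "cong_mod K x (conj_by (h [^] Suc m) x)" if x: "x \<in> N" for x
  proof -
    have xc: "x \<in> carrier G" using x N by blast
    have "cong_mod K x (conj_by (h [^] m) x)" using Suc x by (simp add: centralizes_mod_def)
    then have "cong_mod K (conj_by h x) (conj_by h (conj_by (h [^] m) x))"
      using cong_mod_conj_by[OF K _ h] h xc by simp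
    moreover have "cong_mod K x (conj_by h x)" using c x by (simp add: centralizes_mod_def)
    moreover have "conj_by h (conj_by (h [^] m) x) = conj_by (h [^] Suc m) x" using h xc
      by (simp add: conj_by_conj_by)
    ultimately show ?thesis
      using cong_mod_trans[OF sK, of x "conj_by h x" "conj_by (h [^] Suc m) x"] h xc by simp
  qed
  then show ?case by (simp add: centralizes_mod_def)
qed

text \<open>A subgroup of a cyclic group is cyclic, so if its p-th powers lie in \<open>L\<close>,
  then the first \<open>p\<close> powers of a generator represent it modulo \<open>L\<close>. It
  serves to refute that a chief factor larger than \<open>p\<close> comes from a cyclic
  group.\<close>

lemma cyclic_elementary_quotient:
  assumes K: "subgroup K G" "K \<subseteq> generate G {x}" and x: "x \<in> carrier G"
    and L: "subgroup L G" and pw: "\<And>y. y \<in> K \<Longrightarrow> y [^] p \<in> L" and p: "0 < p"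
  shows "card K \<le> p * card L"
proof -
  have o: "ord x \<noteq> 0" using ord_ge_1[OF fin x] by simp
  have gen: "generate G {x} = {x [^] k |k. k \<in> (UNIV::nat set)}" using generate_pow_nat[OF x o] .
  \<comment> \<open>The least positive exponent with \<open>x^k\<close> in \<open>K\<close>;
    division with remainder shows that \<open>x^k\<close> generates \<open>K\<close>.\<close>
  define k where "k = (LEAST k::nat. 0 < k \<and> x [^] k \<in> K)"
  have ex: "0 < ord x \<and> x [^] ord x \<in> K" using o x subgroup.one_closed[OF K(1)] by simp
  have k: "0 < k" "x [^] k \<in> K" using LeastI[of "\<lambda>k::nat. 0 < k \<and> x [^] k \<in> K", OF ex]
    by (auto simp: k_def)
  have kmin: "\<not> (0 < j \<and> x [^] j \<in> K)" if "j < k" for j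
    using that not_less_Least[of j "\<lambda>k::nat. 0 < k \<and> x [^] k \<in> K"] by (simp add: k_def)
  define z where "z = x [^] k"
  have z: "z \<in> K" "z \<in> carrier G" using k x by (auto simp: z_def)
  have pw': "\<exists>j::nat. y = z [^] j" if y: "y \<in> K" for y
  proof -
    obtain m where m: "y = x [^] (m::nat)" using y K(2) gen by auto
    have "z [^] (m div k) \<otimes> x [^] (m mod k) = y" using x by (simp add: m z_def nat_pow_pow nat_pow_mult)
    then have "x [^] (m mod k) \<in> K"
      using y sub_mult_left_iff[OF K(1) subgroup_pow_closed[OF K(1) z(1)], of "x [^] (m mod k)" "m div k"] x by auto
    then have "m mod k = 0" using kmin[of "m mod k"] k(1) by auto
    then have "y = z [^] (m div k)" using \<open>z [^] (m div k) \<otimes> x [^] (m mod k) = y\<close> z by simp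
    then show ?thesis by blast
  qed
  have "K \<subseteq> (\<Union>r<p. left_coset (z [^] r) L)"
  proof
    fix y assume "y \<in> K"
    then obtain j where j: "y = z [^] (j::nat)" using pw' by blast
    have "y = z [^] (j mod p) \<otimes> (z [^] p) [^] (j div p)" using z
      by (simp add: j nat_pow_pow nat_pow_mult)
    moreover have "(z [^] p) [^] (j div p) \<in> L" using subgroup_pow_closed[OF L pw[OF z(1)]] .
    ultimately have "y \<in> left_coset (z [^] (j mod p)) L" by (simp add: left_coset_def)
    moreover have "j mod p < p" using p by simp
    ultimately show "y \<in> (\<Union>r<p. left_coset (z [^] r) L)" by blast
  qed
  then have "card K \<le> card (\<Union>r<p. left_coset (z [^] r) L)"
    using L by (intro card_mono finite_UN_I) (auto simp: left_coset_def)
  also have "\<dots> \<le> (\<Sum>r<p. card (left_coset (z [^] r) L))" by (rule card_UN_le) simp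
  also have "\<dots> = p * card L" using card_lcos[OF L] z by simp
  finally show ?thesis .
qed

end

section \<open>The cover-avoidance hypothesis\<close>

text \<open>$VA = UA$ is equivalent to $V \subseteq U(V \cap A)$, by Dedekind's law.\<close>
definition (in group) covers_or_avoids_chief :: "'a set \<Rightarrow> 'a set \<Rightarrow> bool"
  where "covers_or_avoids_chief A H \<longleftrightarrow> (\<forall>V U. chief_in H V U \<longrightarrow> V \<subseteq> H \<longrightarrow> V \<inter> A \<subseteq> U \<or> V \<subseteq> U <#> (V \<inter> A))"

lemma (in fin_group) strong_CAP_imp_covers_or_avoids:
  assumes A: "strong_CAP_subgroup A G" and H: "subgroup H G" and AH: "A \<subseteq> H"
  shows "covers_or_avoids_chief A H"
  unfolding covers_or_avoids_chief_def
proof (intro allI impI)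
  fix V U assume ch: "chief_in H V U" and VH: "V \<subseteq> H"
  note chD = chief_inD[OF ch]
  have sA: "subgroup A G" using A by (simp add: strong_CAP_subgroup_def)
  have "chief_factor (G\<lparr>carrier := H\<rparr>) V U"
    unfolding chief_factor_def
  proof (intro conjI)
    show "V \<lhd> G\<lparr>carrier := H\<rparr>" using normalized_by_imp_normal[OF chD(1) H VH] .
    show "U \<lhd> G\<lparr>carrier := H\<rparr>" using normalized_by_imp_normal[OF chD(2) H] chD(3) VH by blast
    show "U \<subset> V" by (rule chD(3))
    show "\<not> (\<exists>N. N \<lhd> G\<lparr>carrier := H\<rparr> \<and> U \<subset> N \<and> N \<subset> V)"
      using chD(6) normal_imp_normalized_by(1)[OF _ H] by blast
  qed
  then have "covers (G\<lparr>carrier := H\<rparr>) A V U \<or> avoids A V U"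
    using A H AH by (auto simp: strong_CAP_subgroup_def CAP_subgroup_def)
  then show "V \<inter> A \<subseteq> U \<or> V \<subseteq> U <#> (V \<inter> A)"
  proof
    assume "avoids A V U" then show ?thesis by (auto simp: avoids_def)
  next
    assume cov: "covers (G\<lparr>carrier := H\<rparr>) A V U"
    have "V \<subseteq> U <#> (V \<inter> A)"
    proof
      fix v assume v: "v \<in> V"
      have "v \<in> V <#> A" using set_mult_left[OF chD(4) sA] v by blast
      then have "v \<in> U <#> A" using cov by (simp add: covers_def)
      then obtain u a where ua: "u \<in> U" "a \<in> A" "v = u \<otimes> a" by (auto simp: set_mult_def)
      have "u \<in> V" using ua chD(3) by blast
      then have "a \<in> V" using ua v sub_mult_left_iff[OF chD(4), of u a] sub_carrier[OF sA] by auto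
      then show "v \<in> U <#> (V \<inter> A)" using ua by (auto intro: set_mult_memI)
    qed
    then show ?thesis ..
  qed
qed

context fin_group
begin

lemma covers_or_avoids_chiefD: "covers_or_avoids_chief A H \<Longrightarrow> chief_in H V U \<Longrightarrow> V \<subseteq> H \<Longrightarrow> \<not> V \<inter> A \<subseteq> U \<Longrightarrow> V \<subseteq> U <#> (V \<inter> A)"
  by (auto simp: covers_or_avoids_chief_def)

text \<open>\<open>c\<close> is the commutator of \<open>a\<close> and \<open>b\<close>, central in
  the group they generate. The exponent of \<open>c\<close> is the binomial coefficient of
  \<open>m\<close> over 2: for odd \<open>m = p\<close> it is a multiple of \<open>p\<close>, for
  \<open>m = 2\<close> it equals 1, and this difference separates the prime 2.\<close>

lemma class_two_pow:
  assumes c: "a \<in> carrier G" "b \<in> carrier G" "c \<in> carrier G"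
    and ca: "c \<otimes> a = a \<otimes> c" and cb: "c \<otimes> b = b \<otimes> c" and ba: "b \<otimes> a = a \<otimes> b \<otimes> c"
  shows "b [^] (m::nat) \<otimes> a = a \<otimes> b [^] m \<otimes> c [^] m"
    and "(a \<otimes> b) [^] (m::nat) = a [^] m \<otimes> b [^] m \<otimes> c [^] (m * (m - 1) div 2)"
proof -
  have cpow: "c [^] (i::nat) \<otimes> b = b \<otimes> c [^] i" "c [^] i \<otimes> a = a \<otimes> c [^] i" for i
    using group_commutes_pow[OF cb] group_commutes_pow[OF ca] c by auto
  have cbp: "c [^] (i::nat) \<otimes> b [^] (j::nat) = b [^] j \<otimes> c [^] i" for i j
    using group_commutes_pow[of b "c [^] i" j] cpow(1)[of i] c by simp
  have bm: "b [^] (m::nat) \<otimes> a = a \<otimes> b [^] m \<otimes> c [^] m" for m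
  proof (induction m)
    case (Suc m)
    have "b [^] Suc m \<otimes> a = b [^] m \<otimes> (a \<otimes> b \<otimes> c)" using c ba by (simp add: m_assoc)
    also have "\<dots> = (b [^] m \<otimes> a) \<otimes> (b \<otimes> c)" using c by (simp add: m_assoc)
    also have "\<dots> = (a \<otimes> b [^] m) \<otimes> (c [^] m \<otimes> b) \<otimes> c" using c Suc by (simp add: m_assoc)
    also have "\<dots> = a \<otimes> b [^] Suc m \<otimes> c [^] Suc m" unfolding cpow(1) using c by (simp add: m_assoc)
    finally show ?case .
  qed (use c in simp)
  then show "b [^] m \<otimes> a = a \<otimes> b [^] m \<otimes> c [^] m" .
  show "(a \<otimes> b) [^] m = a [^] m \<otimes> b [^] m \<otimes> c [^] (m * (m - 1) div 2)"
  proof (induction m)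
    case (Suc m)
    let ?t = "m * (m - 1) div 2"
    have t: "m + ?t = Suc m * (Suc m - 1) div 2"
      by (cases m) (auto simp: algebra_simps)
    have "(a \<otimes> b) [^] Suc m = (a [^] m \<otimes> b [^] m) \<otimes> (c [^] ?t \<otimes> a) \<otimes> b" using c Suc
      by (simp add: m_assoc)
    also have "\<dots> = a [^] m \<otimes> (b [^] m \<otimes> a) \<otimes> (c [^] ?t \<otimes> b)" unfolding cpow(2) using c
      by (simp add: m_assoc)
    also have "c [^] ?t \<otimes> b = b \<otimes> c [^] ?t" by (rule cpow(1))
    also have "a [^] m \<otimes> (b [^] m \<otimes> a) \<otimes> (b \<otimes> c [^] ?t) = a [^] Suc m \<otimes> b [^] m \<otimes> (c [^] m \<otimes> b) \<otimes> c [^] ?t"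
      unfolding bm using c by (simp add: m_assoc)
    also have "\<dots> = a [^] Suc m \<otimes> b [^] Suc m \<otimes> (c [^] m \<otimes> c [^] ?t)" unfolding cpow(1) using c
      by (simp add: m_assoc)
    also have "c [^] m \<otimes> c [^] ?t = c [^] (Suc m * (Suc m - 1) div 2)" using c t
      by (simp add: nat_pow_mult)
    finally show ?case .
  qed (use c in simp)
qed

lemma mult_eq_self: "x \<in> carrier G \<Longrightarrow> a \<in> carrier G \<Longrightarrow> x \<otimes> a = x \<longleftrightarrow> a = \<one>"
  using l_cancel[of x a \<one>] by simp

lemma prime_power_gap:
  fixes p :: nat
  assumes p: "Factorial_Ring.prime p" and K: "subgroup K G" and N: "subgroup N G" "K \<subset> N"
    "card N = p ^ n"
    and ne: "card N \<noteq> p * card K"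
  shows "p * card K < card N"
proof -
  have p1: "1 < p" using p prime_gt_1_nat by blast
  obtain b where b: "card K = p ^ b" using pgroup_sub[OF K N(1) _ N(3) p] N(2) by blast
  have "card K < card N" using psubset_card_mono[OF fin_sub[OF N(1)] N(2)] .
  then have "b < n" using b N(3) p1 by simp
  moreover have "n \<noteq> Suc b" using ne b N(3) by auto
  ultimately have "Suc b < n" by simp
  then have "p ^ Suc b < p ^ n" using p1 power_strict_increasing by blast
  then show ?thesis using b N(3) by simp
qed

text \<open>The family of \<open>H\<close>-invariant subgroups containing all \<open>[x,h]\<close>
  with \<open>x \<in> P\<close> is closed under intersection, so its minimal member \<open>N\<close>
  is least. It is nontrivial because \<open>h\<close> moves \<open>P\<close>, so there is a maximal
  \<open>H\<close>-invariant \<open>K\<close> below it.\<close>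

lemma minimal_commutator:
  assumes H: "subgroup H G" and P: "normalized_by H P" "card P = p ^ n" "Factorial_Ring.prime p"
    and h: "h \<in> H" "coprime (ord h) p" and nc: "\<not> centralizes_mod h P {\<one>}"
  shows "\<exists>N K. chief_in H N K \<and> N \<subseteq> P \<and> centralizes_mod h P N \<and> \<not> centralizes_mod h N K \<and>
    (\<forall>L. normalized_by H L \<longrightarrow> L \<subseteq> P \<longrightarrow> centralizes_mod h P L \<longrightarrow> N \<subseteq> L)"
proof -
  note sP = normalized_by_subgroup[OF P(1)] and Hc = sub_carrier[OF H]
  define F where "F = {L. normalized_by H L \<and> L \<subseteq> P \<and> centralizes_mod h P L}"
  have "finite F" by (rule finite_subset[of _ "Pow P"]) (use fin_sub[OF sP] in \<open>auto simp: F_def\<close>)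
  moreover have "P \<in> F"
    using P(1) normalized_by_conj_by[OF P(1) h(1)] subgroup.m_closed[OF sP] subgroup.m_inv_closed[OF sP]
    by (simp add: F_def centralizes_mod_def cong_mod_def)
  ultimately obtain N where N: "N \<in> F" "\<And>L. L \<in> F \<Longrightarrow> L \<subseteq> N \<Longrightarrow> L = N"
    using finite_has_minimal[of F] by (metis empty_iff)
  have N': "normalized_by H N" "N \<subseteq> P" "centralizes_mod h P N" using N by (auto simp: F_def)
  have least: "N \<subseteq> L" if "L \<in> F" for L
  proof -
    have "N \<inter> L \<in> F" using that N' normalized_by_Int
      by (auto simp: F_def centralizes_mod_def cong_mod_def)
    then show ?thesis using N(2)[of "N \<inter> L"] by blast
  qed
  have "N \<noteq> {\<one>}" using N' nc by auto
  then have "{\<one>} \<subset> N" using subgroup.one_closed[OF normalized_by_subgroup[OF N'(1)]] by blast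
  then obtain K where K: "chief_in H N K"
    using chief_in_max_exists[OF N'(1) normalized_by_one[OF subgroup.subset[OF H]]] by blast
  note chD = chief_inD[OF K]
  obtain m where m: "card N = p ^ m" using pgroup_sub[OF chD(4) sP N'(2) P(2,3)] by blast
  \<comment> \<open>If \<open>[N,h]\<close> were inside \<open>K\<close>, coprimality would push
    \<open>[P,h]\<close> from \<open>N\<close> down into \<open>K\<close>, against the choice of
    \<open>N\<close>.\<close>
  have "\<not> centralizes_mod h N K"
  proof
    assume c: "centralizes_mod h N K"
    have "centralizes_mod h P K"
      by (rule coprime_stable_chain[OF chD(4) m P(3) Hc[OF h(1)] h(2) subgroup.subset[OF sP] _ _ _ N'(3) c])
        (use chD h normalized_by_conj_by[OF chD(1) h(1)] normalized_by_mono[OF chD(2), of "{h}"] in auto)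
    then have "K \<in> F" using chD N'(2) by (auto simp: F_def)
    then show False using least[of K] chD(3) by blast
  qed
  then show ?thesis using K N' least by (intro exI[of _ N] exI[of _ K]) (auto simp: F_def)
qed

end

text \<open>The hypothesis of the theorem as it is used: for every overgroup \<open>H\<close> of the
  test subgroup, with \<open>p^d\<close> in place of the order of \<open>D\<close>.
  \<open>cap_four\<close> asks for a noncommuting pair and an element of order 4, because the
  argument for \<open>p = 2\<close> produces exactly these.\<close>

locale cap_sylow = fin_group +
  fixes p n d :: nat and S :: "'a set"
  assumes p: "Factorial_Ring.prime p" and sylow_in_S: "sylow_in p (carrier G) S" and cS: "card S = p ^ n"
    and d: "0 < d" "d < n"
    and cap_order: "\<And>A H. subgroup A G \<Longrightarrow> A \<subseteq> S \<Longrightarrow> card A = p ^ d \<Longrightarrow> subgroup H G \<Longrightarrow> A \<subseteq> H \<Longrightarrow> covers_or_avoids_chief A H"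
    and cap_four: "\<And>x y a H. p = 2 \<Longrightarrow> d = 1 \<Longrightarrow> x \<in> S \<Longrightarrow> y \<in> S \<Longrightarrow> x \<otimes> y \<noteq> y \<otimes> x \<Longrightarrow>
      a \<in> S \<Longrightarrow> ord a = 4 \<Longrightarrow> subgroup H G \<Longrightarrow> a \<in> H \<Longrightarrow> covers_or_avoids_chief (generate G {a}) H"
begin

lemma S: "subgroup S G" using sylow_in_S by (simp add: sylow_in_def)

lemma p_gt_1: "1 < p" using p prime_gt_1_nat by blast

text \<open>Induction on \<open>|P|\<close>. If \<open>h\<close> moves \<open>P\<close>, the least
  commutator subgroup \<open>N\<close> has a chief factor \<open>N/K\<close> on which
  \<open>h\<close> acts nontrivially, hence of order larger than \<open>p\<close>; a test subgroup
  meeting \<open>N\<close> strictly between avoiding and covering refutes this. The prime power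
  order of \<open>h\<close> makes the generated group a q-group, as lifting of fixed points
  requires.\<close>

lemma coprime_centralizes_aux:
  assumes H: "subgroup H G" and h: "h \<in> H" "ord h = q ^ k" "Factorial_Ring.prime q" "q \<noteq> p"
  shows "normalized_by H P \<Longrightarrow> P \<subseteq> S \<Longrightarrow> P \<subseteq> H \<Longrightarrow> p ^ d < card P \<Longrightarrow>
    (\<And>N K. normalized_by H N \<Longrightarrow> normalized_by H K \<Longrightarrow> K \<subseteq> N \<Longrightarrow> N \<subseteq> P \<Longrightarrow> card N = p * card K \<Longrightarrow>
      centralizes_mod h N K) \<Longrightarrow> centralizes_mod h P {\<one>}"
proof (induction "card P" arbitrary: P rule: less_induct)
  case less
  note nP = less.prems(1) and PS = less.prems(2) and PH = less.prems(3) and Pd = less.prems(4)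
    and triv = less.prems(5)
  note sP = normalized_by_subgroup[OF nP] and Hc = sub_carrier[OF H]
  have hc: "h \<in> carrier G" using h(1) Hc by blast
  have coph: "coprime (ord h) p"
    using h(2-4) p by (metis coprime_power_left_iff primes_coprime)
  obtain a where a: "card P = p ^ a" using pgroup_sub[OF sP S PS cS p] by blast
  have da: "d < a" using Pd a p_gt_1 by simp
  show ?case
  proof (rule ccontr)
    assume "\<not> centralizes_mod h P {\<one>}"
    then obtain N K where ch: "chief_in H N K" and NP: "N \<subseteq> P" and cPN: "centralizes_mod h P N"
      and ncNK: "\<not> centralizes_mod h N K"
      and least: "\<And>L. normalized_by H L \<Longrightarrow> L \<subseteq> P \<Longrightarrow> centralizes_mod h P L \<Longrightarrow> N \<subseteq> L"
      using minimal_commutator[OF H nP a p h(1) coph] by blast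
    note nN = chief_inD(1)[OF ch] and nK = chief_inD(2)[OF ch] and KN = chief_inD(3)[OF ch]
      and sN = chief_inD(4)[OF ch] and sK = chief_inD(5)[OF ch]
    note Nc = sub_carrier[OF sN] and Kc = sub_carrier[OF sK] and Pc = sub_carrier[OF sP]
    have NH: "N \<subseteq> H" and NS: "N \<subseteq> S" using NP PH PS by auto
    have KP: "K \<subseteq> P" using KN NP by blast
    have nNK: "normalized_by N K" using normalized_by_mono[OF nK NH] .
    have nNh: "normalized_by {h} N" "normalized_by {h} K"
      using normalized_by_mono[OF nN] normalized_by_mono[OF nK] h(1) by auto
    obtain b where b: "card N = p ^ b" using pgroup_sub[OF sN sP NP a p] by blast
    have cNK: "card K < card N" using psubset_card_mono[OF fin_sub[OF sN] KN] .
    \<comment> \<open>By assumption \<open>h\<close> is trivial on factors of order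
      \<open>p\<close>, but it is not trivial on \<open>N/K\<close>.\<close>
    have "card N \<noteq> p * card K" using triv[OF nN nK _ NP] KN ncNK by auto
    then have gap: "p * card K < card N" by (rule prime_power_gap[OF p sK sN KN b])
    have elem: "x [^] p \<in> K" if "x \<in> N" for x
      using chief_pquotient_elementary(2)[OF H ch NH sN subset_refl b p set_mult_right[OF sK sN] that] .
    have comm: "cong_mod K x (conj_by y x)" if "x \<in> N" "y \<in> N" for x y
      using chief_pquotient_elementary(1)[OF H ch NH sN subset_refl b p set_mult_right[OF sK sN] that] .
    show False
    proof (cases "card N \<le> p ^ d")
      case True
      have ncPK: "\<not> centralizes_mod h P K" using ncNK NP by (auto simp: centralizes_mod_def)
      \<comment> \<open>The preimage of the centralizer of \<open>h\<close> in
        \<open>P/K\<close>.\<close>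
      define F where "F = {x \<in> P. cong_mod K x (conj_by h x)}"
      have nPK: "normalized_by P K" using normalized_by_mono[OF nK PH] .
      have hP: "conj_by h x \<in> P" if "x \<in> P" for x using normalized_by_conj_by[OF nP h(1) that] .
      have sF: "subgroup F G"
      proof (rule fin_subgroupI)
        show "F \<subseteq> carrier G" using Pc by (auto simp: F_def)
        show "\<one> \<in> F" using subgroup.one_closed[OF sP] hc by (simp add: F_def cong_mod_refl[OF sK])
        fix x y assume "x \<in> F" "y \<in> F"
        then have xy: "x \<in> P" "y \<in> P" "cong_mod K x (conj_by h x)" "cong_mod K y (conj_by h y)"
          by (auto simp: F_def)
        have "cong_mod K (x \<otimes> y) (conj_by h x \<otimes> conj_by h y)"
          using cong_mod_mult[OF nPK sP xy(1) hP[OF xy(1)] xy(2) hP[OF xy(2)] xy(3,4)] .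
        then show "x \<otimes> y \<in> F" using xy subgroup.m_closed[OF sP] Pc hc by (simp add: F_def conj_by_mult)
      qed
      have FP: "F \<subset> P" using ncPK by (auto simp: F_def centralizes_mod_def)
      have KF: "K \<subseteq> F"
        using KP normalized_by_conj_by[OF nK h(1)] subgroup.m_closed[OF sK] subgroup.m_inv_closed[OF sK]
        by (auto simp: F_def cong_mod_def)
      define Q where "Q = generate G {h}"
      have sQ: "subgroup Q G" unfolding Q_def using hc by (intro generate_is_subgroup) auto
      have cQ: "card Q = q ^ k" using generate_pow_card[OF hc] h(2) by (simp add: Q_def)
      have QH: "Q \<subseteq> H" unfolding Q_def using h(1) H by (intro generate_subgroup_incl) auto
      have hQ: "h \<in> Q" unfolding Q_def by (intro generate.incl) simp
      have Qpow: "\<exists>m::nat. g = h [^] m" if "g \<in> Q" for g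
        using that generate_pow_nat[OF hc] ord_ge_1[OF fin hc] by (auto simp: Q_def)
      \<comment> \<open>\<open>h\<close> centralizes \<open>P/N\<close>, so fixed points lift and
        \<open>F N = P\<close>.\<close>
      have FN: "\<exists>y\<in>F. cong_mod N x y" if x: "x \<in> P" for x
      proof -
        have "cong_mod N x (conj_by g x)" if g: "g \<in> Q" for g
        proof -
          obtain m where m: "g = h [^] (m::nat)" using Qpow[OF g] by blast
          have "centralizes_mod (h [^] m) P N"
            using centralizes_mod_pow[OF hc hP _ nNh(1) cPN] subgroup.subset[OF sP] by blast
          then show ?thesis using x m by (simp add: centralizes_mod_def)
        qed
        then obtain y where y: "y \<in> carrier G" "cong_mod N x y" "\<And>g. g \<in> Q \<Longrightarrow> cong_mod K y (conj_by g y)"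
          using coprime_fixed_in_coset[OF sQ cQ h(3) normalized_by_mono[OF nN QH] normalized_by_mono[OF nK QH] _ Pc[OF x] _ b p] h(4) KN
          by (metis psubset_imp_subset)
        have "y \<in> P" using cong_mod_in[OF sN sP NP Pc[OF x] y(1,2)] x by blast
        then show ?thesis using y hQ by (auto simp: F_def)
      qed
      have "card F < p ^ a" using psubset_card_mono[OF fin_sub[OF sP] FP] a by simp
      moreover obtain f where f: "card F = p ^ f" using pgroup_sub[OF sF sP _ a p] FP by blast
      ultimately have "f \<le> a - 1" using p_gt_1 by simp
      then have "card F \<le> p ^ (a - 1)" using f p_gt_1 by simp
      \<comment> \<open>A maximal subgroup of \<open>P\<close> above \<open>F\<close>. Since
        \<open>F\<close> already supplements \<open>N\<close>, so does \<open>F1\<close>, and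
        \<open>F1 \<inter> N\<close> has index \<open>p\<close> in \<open>N\<close>.\<close>
      then obtain F1 where F1: "subgroup F1 G" "F \<subseteq> F1" "F1 \<subseteq> P" "card F1 = p ^ (a - 1)"
        using pgroup_between[OF sF sP _ a p, of "a - 1"] FP by auto
      have "F1 <#> N = P"
      proof
        show "F1 <#> N \<subseteq> P" using set_mult_in[OF sP F1(3) NP] .
        show "P \<subseteq> F1 <#> N"
        proof
          fix x assume x: "x \<in> P"
          then obtain y where y: "y \<in> F" "cong_mod N x y" using FN by blast
          then have yc: "y \<in> carrier G" using sub_carrier[OF sF] by blast
          have "cong_mod N y x" using cong_mod_sym[OF sN Pc[OF x] yc y(2)] .
          then have "y \<otimes> (inv y \<otimes> x) \<in> F1 <#> N" using y F1
            by (intro set_mult_memI) (auto simp: cong_mod_def)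
          then show "x \<in> F1 <#> N" using yc Pc[OF x] by (simp add: inv_cancel)
        qed
      qed
      then have "card P * card (F1 \<inter> N) = card F1 * card N" using card_set_mult[OF F1(1) sN] by simp
      moreover have "card P = p * card F1" using power_minus_mult[of a p] a F1(4) da
        by (simp add: mult.commute)
      ultimately have cB: "p * card (F1 \<inter> N) = card N"
        using card_pos[OF F1(1)] by (simp add: mult.assoc mult.left_commute[of p])
      define B where "B = F1 \<inter> N"
      have sB: "subgroup B G" unfolding B_def using subgroups_Inter_pair[OF F1(1) sN] .
      have KB: "K \<subseteq> B" using KF F1 KN by (auto simp: B_def)
      have "p * card K < p * card B" using gap cB by (simp add: B_def)
      then have cBN: "card K < card B" by simp
      have "card B \<le> card N" using sN by (intro card_mono) (auto simp: B_def)
      then have "card B \<le> p ^ d" using True by simp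
      moreover have "d \<le> a - 1" using da by linarith
      ultimately obtain A where A: "subgroup A G" "B \<subseteq> A" "A \<subseteq> F1" "card A = p ^ d"
        using pgroup_between[OF sB F1(1) _ F1(4) p, of d] unfolding B_def by blast
      \<comment> \<open>\<open>A\<close> stays inside \<open>F1\<close> and contains
        \<open>B\<close>. As \<open>B\<close> is larger than \<open>K\<close>, \<open>A\<close> does
        not avoid \<open>N/K\<close>; as \<open>K B = B\<close> is a hyperplane of \<open>N\<close>,
        it does not cover.\<close>
      have NA: "N \<inter> A = B" using A by (auto simp: B_def)
      have "covers_or_avoids_chief A H" using cap_order[OF A(1) _ A(4) H] A F1 PS PH by blast
      moreover have "\<not> N \<inter> A \<subseteq> K" using NA cBN card_mono[OF fin_sub[OF sK], of B] by auto
      ultimately have "N \<subseteq> K <#> B" using covers_or_avoids_chiefD[OF _ ch NH] NA by metis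
      also have "\<dots> \<subseteq> B" using set_mult_in[OF sB KB] by blast
      finally have "card N \<le> card B" using card_mono[OF fin_sub[OF sB]] by blast
      moreover have "1 * card B < p * card B" using card_pos[OF sB] p_gt_1
        by (intro mult_strict_right_mono) auto
      ultimately show False using cB by (simp add: B_def)
    next
      case False
      \<comment> \<open>A test subgroup that contains \<open>x\<close> and lies in
        \<open>K <#> generate G {x}\<close> leads to a contradiction: covering would give
        \<open>|N| \<le> p |K|\<close>, because the cyclic group adds at most one factor
        \<open>p\<close> to \<open>K\<close>.\<close>
      have noCap: False
        if x: "x \<in> N" "x \<notin> K" and A: "x \<in> A" "A \<subseteq> K <#> generate G {x}" "covers_or_avoids_chief A H"
        for x A
      proof -
        have xc: "x \<in> carrier G" using x Nc by blast
        define X1 where "X1 = generate G {x}"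
        have sX: "subgroup X1 G" unfolding X1_def using xc by (intro generate_is_subgroup) auto
        have XN: "X1 \<subseteq> N" unfolding X1_def using x sN by (intro generate_subgroup_incl) auto
        have sKX: "subgroup (K \<inter> X1) G" using subgroups_Inter_pair[OF sK sX] .
        have "card X1 \<le> p * card (K \<inter> X1)"
          using cyclic_elementary_quotient[OF sX _ xc sKX] elem XN subgroup_pow_closed[OF sX] p_gt_1
          by (auto simp: X1_def)
        then have "card (K <#> X1) * card (K \<inter> X1) \<le> card K * (p * card (K \<inter> X1))"
          unfolding card_set_mult[OF sK sX] by (rule mult_le_mono2)
        then have cE: "card (K <#> X1) \<le> p * card K" using card_pos[OF sKX]
          by (simp add: mult.commute mult.left_commute)
        have sE: "subgroup (K <#> X1) G" using set_mult_subgroup[OF normalized_by_mono[OF nNK XN] sX] .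
        have NA: "N \<inter> A \<subseteq> K <#> X1" using A(2) unfolding X1_def by blast
        have "N \<subseteq> K <#> (N \<inter> A)" using covers_or_avoids_chiefD[OF A(3) ch NH] x A(1) by blast
        also have "\<dots> \<subseteq> K <#> X1" by (rule set_mult_in[OF sE set_mult_left[OF sK sX] NA])
        finally have "card N \<le> card (K <#> X1)" using card_mono[OF fin_sub[OF sE]] by blast
        then show False using cE gap by simp
      qed
      \<comment> \<open>Otherwise a subgroup of order \<open>p^d\<close> would lie strictly between
        \<open>K\<close> and \<open>N\<close>, neither covering nor avoiding.\<close>
      have Kge: "p ^ d \<le> card K"
      proof (rule ccontr)
        assume "\<not> ?thesis"
        then have "card K \<le> p ^ d" by simp
        moreover have "d \<le> b" using False b p_gt_1 by simp
        ultimately obtain A where A: "subgroup A G" "K \<subseteq> A" "A \<subseteq> N" "card A = p ^ d"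
          using pgroup_between[OF sK sN _ b p, of d] KN by auto
        have NA: "N \<inter> A = A" using A by blast
        have "covers_or_avoids_chief A H" using cap_order[OF A(1) _ A(4) H] A NS NH by blast
        moreover have "\<not> A \<subseteq> K" using A(4) \<open>\<not> p ^ d \<le> card K\<close> card_mono[OF fin_sub[OF sK], of A] by auto
        ultimately have "N \<subseteq> K <#> A" using covers_or_avoids_chiefD[OF _ ch NH] NA by metis
        also have "\<dots> \<subseteq> A" using set_mult_in[OF A(1,2)] by blast
        finally show False using False A(4) card_mono[OF fin_sub[OF A(1)]] by auto
      qed
      \<comment> \<open>otherwise some \<open>A\<close> of order $p^d$ lies between \<open>generate G {x}\<close> and $K\langle x\rangle$, a proper subgroup of \<open>N\<close>\<close>
      have noSmall: "p ^ d < ord x" if x: "x \<in> N" "x \<notin> K" for x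
      proof (rule ccontr)
        assume "\<not> ?thesis"
        then have ox: "ord x \<le> p ^ d" by simp
        have xc: "x \<in> carrier G" using x Nc by blast
        define X1 where "X1 = generate G {x}"
        have sX: "subgroup X1 G" unfolding X1_def using xc by (intro generate_is_subgroup) auto
        have XN: "X1 \<subseteq> N" unfolding X1_def using x sN by (intro generate_subgroup_incl) auto
        have xX: "x \<in> X1" unfolding X1_def by (intro generate.incl) simp
        have sE: "subgroup (K <#> X1) G" using set_mult_subgroup[OF normalized_by_mono[OF nNK XN] sX] .
        have EN: "K <#> X1 \<subseteq> N" using set_mult_in[OF sN _ XN] KN by blast
        obtain e where e: "card (K <#> X1) = p ^ e" using pgroup_sub[OF sE sN EN b p] by blast
        have "card K \<le> card (K <#> X1)" using card_mono[OF fin_sub[OF sE] set_mult_left[OF sK sX]] .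
        then have "d \<le> e" using Kge e p_gt_1 by (metis le_trans power_increasing_iff)
        moreover have "card X1 \<le> p ^ d" using ox generate_pow_card[OF xc] by (simp add: X1_def)
        ultimately obtain A where A: "subgroup A G" "X1 \<subseteq> A" "A \<subseteq> K <#> X1" "card A = p ^ d"
          using pgroup_between[OF sX sE set_mult_right[OF sK sX] e p, of d] by auto
        have "covers_or_avoids_chief A H" using cap_order[OF A(1) _ A(4) H] A EN NS NH by blast
        then show False using noCap[OF x] A xX by (auto simp: X1_def)
      qed
      \<comment> \<open>If \<open>|K| > p^d\<close>, the induction hypothesis applies to
        \<open>K\<close>. In the remaining case \<open>|K| = p^d\<close>, and \<open>K\<close> turns
        out to be cyclic.\<close>
      have centK: "centralizes_mod h K {\<one>}"
      proof (cases "p ^ d < card K")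
        case True
        have "card K < card P" using psubset_card_mono[OF fin_sub[OF sP], of K] KN NP by auto
        then show ?thesis
          using less.hyps[OF _ nK _ _ True] triv KP PS PH by (metis subset_trans)
      next
        case False
        then have cK: "card K = p ^ d" using Kge by simp
        obtain x where x: "x \<in> N" "x \<notin> K" using KN by blast
        have xc: "x \<in> carrier G" using x Nc by blast
        \<comment> \<open>The group generated by \<open>x\<close> has order at least
          \<open>p^(d+1)\<close> and meets \<open>K\<close> in index at most \<open>p\<close>, so
          the intersection has order at least \<open>p^d\<close>, the order of
          \<open>K\<close>.\<close>
        have Kx: "K \<subseteq> generate G {x}"
        proof -
          define X1 where "X1 = generate G {x}"
          have sX: "subgroup X1 G" unfolding X1_def using xc by (intro generate_is_subgroup) auto
          have XN: "X1 \<subseteq> N" unfolding X1_def using x sN by (intro generate_subgroup_incl) auto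
          have sKX: "subgroup (K \<inter> X1) G" using subgroups_Inter_pair[OF sK sX] .
          have le: "card X1 \<le> p * card (K \<inter> X1)"
            using cyclic_elementary_quotient[OF sX _ xc sKX] elem XN subgroup_pow_closed[OF sX] p_gt_1
            by (auto simp: X1_def)
          have "p ^ d < card X1" using noSmall[OF x] generate_pow_card[OF xc] by (simp add: X1_def)
          moreover obtain e where e: "card X1 = p ^ e" using pgroup_sub[OF sX sN XN b p] by blast
          ultimately have "Suc d \<le> e" using p_gt_1 by simp
          then have "p ^ Suc d \<le> card X1" using e p_gt_1 by (metis less_imp_le power_increasing)
          also note le
          finally have "p * p ^ d \<le> p * card (K \<inter> X1)" by simp
          then have "card K \<le> card (K \<inter> X1)" using p_gt_1 cK mult_le_cancel1[of p "p ^ d"] by simp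
          then have "K \<inter> X1 = K" by (intro card_seteq) (use sK in auto)
          then show ?thesis by (auto simp: X1_def)
        qed
        show ?thesis
        proof (rule ccontr)
          assume nc: "\<not> centralizes_mod h K {\<one>}"
          obtain N' K' where N': "chief_in H N' K'" "N' \<subseteq> K" "\<not> centralizes_mod h N' K'"
            using minimal_commutator[OF H nK cK p h(1) coph nc] by blast
          note ch' = chief_inD[OF N'(1)]
          obtain c where c: "card N' = p ^ c" using pgroup_sub[OF ch'(4) sK N'(2) cK p] by blast
          have N'H: "N' \<subseteq> H" using N'(2) KP PH by blast
          have "y [^] p \<in> K'" if "y \<in> N'" for y
            using chief_pquotient_elementary(2)[OF H N'(1) N'H ch'(4) subset_refl c p set_mult_right[OF ch'(5,4)] that] .
          \<comment> \<open>A section of exponent \<open>p\<close> of a cyclic group has order at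
            most \<open>p\<close>; on such a factor \<open>h\<close> is trivial by
            \<open>triv\<close>.\<close>
          then have "card N' \<le> p * card K'"
            using cyclic_elementary_quotient[OF ch'(4) _ xc ch'(5)] N'(2) Kx p_gt_1 by auto
          moreover have "card N' \<noteq> p * card K'"
            using triv[OF ch'(1,2)] N' ch'(3) KP by auto
          then have "p * card K' < card N'" by (rule prime_power_gap[OF p ch'(5,4,3) c])
          ultimately show False by simp
        qed
      qed
      then have hK: "conj_by h z = z" if "z \<in> K" for z
        using that Kc hc by (auto simp: centralizes_mod_def cong_mod_triv)
      \<comment> \<open>The centralizer of \<open>K\<close> in \<open>N\<close>. It will be all of
        \<open>N\<close>, so that \<open>K\<close> is central in \<open>N\<close> and
        \<open>N\<close> has class at most two.\<close>
      define C where "C = {x \<in> N. \<forall>z\<in>K. conj_by x z = z}"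
      have sC: "subgroup C G"
        by (rule fin_subgroupI)
          (use Nc Kc subgroup.one_closed[OF sN] subgroup.m_closed[OF sN] in \<open>auto simp: C_def conj_by_conj_by[symmetric]\<close>)
      have nC: "normalized_by H C"
      proof -
        have "conj_by g x \<in> C" if g: "g \<in> H" "x \<in> C" for g x
        proof -
          have x: "x \<in> N" "\<And>z. z \<in> K \<Longrightarrow> conj_by x z = z" using g by (auto simp: C_def)
          have "conj_by (conj_by g x) z = z" if z: "z \<in> K" for z
          proof -
            have z': "conj_by (inv g) z \<in> K"
              using normalized_by_conj_by[OF nK _ z] subgroup.m_inv_closed[OF H g(1)] by blast
            have "conj_by (conj_by g x) z = conj_by g (conj_by x (conj_by (inv g) z))"
              using g(1) Hc x Nc z Kc by (simp add: conj_by_def group_word_simps)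
            then show ?thesis using x(2)[OF z'] g(1) Hc Kc[OF z] by simp
          qed
          then show ?thesis using normalized_by_conj_by[OF nN g(1) x(1)] by (simp add: C_def)
        qed
        then show ?thesis using sC by (simp add: normalized_by_def)
      qed
      \<comment> \<open>the three subgroups lemma for $[K, h] = 1$ and $[N, K] \le K$\<close>
      have "centralizes_mod h N C"
        unfolding centralizes_mod_def
      proof
        fix x assume x: "x \<in> N"
        have hx: "conj_by h x \<in> N" using normalized_by_conj_by[OF nN h(1) x] .
        have "conj_by (inv x \<otimes> conj_by h x) z = z" if z: "z \<in> K" for z
        proof -
          define z' where "z' = conj_by (inv x) z"
          have z': "z' \<in> K" unfolding z'_def
            using normalized_by_conj_by[OF nNK _ z] subgroup.m_inv_closed[OF sN x] by blast
          have "conj_by (inv x \<otimes> conj_by h x) z = conj_by (conj_by h x) z'" using x hx Nc Kc z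
            by (simp add: z'_def conj_by_conj_by)
          also have "\<dots> = conj_by (conj_by h x) (conj_by h z')" using hK[OF z'] by simp
          also have "\<dots> = conj_by h (conj_by x z')" using x Nc Kc[OF z'] hc
            by (simp add: conj_by_def group_word_simps)
          also have "\<dots> = conj_by h z" using x Nc Kc[OF z] by (simp add: z'_def)
          finally show ?thesis using hK[OF z] by simp
        qed
        then show "cong_mod C x (conj_by h x)"
          using x hx subgroup.m_closed[OF sN] subgroup.m_inv_closed[OF sN]
            by (simp add: cong_mod_def C_def)
      qed
      moreover have "C \<subseteq> N" by (auto simp: C_def)
      ultimately have "centralizes_mod h P C"
        using coprime_stable_chain[OF sN b p hc coph subgroup.subset[OF sP] _ _ _ cPN]
          normalized_by_conj_by[OF nN h(1)] normalized_by_mono[OF nC, of "{h}"] h(1) by blast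
      then have "N \<subseteq> C" using least[OF nC] \<open>C \<subseteq> N\<close> NP by blast
      then have cent: "conj_by x z = z" if "x \<in> N" "z \<in> K" for x z using that by (auto simp: C_def)
      have Kcomm: "z \<otimes> x = x \<otimes> z" if "x \<in> N" "z \<in> K" for x z
      proof -
        have "x \<otimes> conj_by x z = x \<otimes> z" using cent[OF that] by simp
        then show ?thesis using that Nc Kc by (simp add: conj_by_def group_word_simps)
      qed
      obtain x where x: "x \<in> N" "\<not> cong_mod K x (conj_by h x)" using ncNK
        by (auto simp: centralizes_mod_def)
      \<comment> \<open>\<open>y = u v\<close> is the commutator \<open>[x,h]\<close>, an element of
        \<open>N\<close> outside \<open>K\<close>. The element \<open>c\<close> with
        \<open>v u = u v c\<close> lies in \<open>K\<close> because \<open>N/K\<close> is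
        abelian.\<close>
      define u where "u = inv x"
      define v where "v = conj_by h x"
      define y where "y = u \<otimes> v"
      define c where "c = inv (u \<otimes> v) \<otimes> (v \<otimes> u)"
      have uv: "u \<in> N" "v \<in> N"
        using x normalized_by_conj_by[OF nN h(1)] subgroup.m_inv_closed[OF sN]
        by (auto simp: u_def v_def)
      have y: "y \<in> N" "y \<notin> K" using uv x(2) subgroup.m_closed[OF sN]
        by (auto simp: y_def u_def v_def cong_mod_def)
      have cK: "c \<in> K"
        using comm[OF uv(2,1)] uv Nc by (simp add: c_def cong_mod_def conj_by_def group_word_simps)
      have cuv: "u \<in> carrier G" "v \<in> carrier G" "c \<in> carrier G" using uv Nc cK Kc by auto
      have vu: "v \<otimes> u = u \<otimes> v \<otimes> c" using cuv by (simp add: c_def inv_cancel)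
      note c2 = class_two_pow[OF cuv Kcomm[OF uv(1) cK] Kcomm[OF uv(2) cK] vu]
      have xp: "x [^] p \<in> K" using elem x by blast
      \<comment> \<open>The product is \<open>[x^p,h]\<close>, and it is trivial since
        \<open>x^p\<close> lies in \<open>K\<close>, which \<open>h\<close> centralizes.\<close>
      have "u [^] p \<otimes> v [^] p = inv (x [^] p) \<otimes> conj_by h (x [^] p)"
        using x Nc hc by (simp add: u_def v_def conj_by_pow nat_pow_inv)
      then have uvp: "u [^] p \<otimes> v [^] p = \<one>" using hK[OF xp] Kc[OF xp] by simp
      have vp: "v [^] p \<in> K" using elem uv by blast
      \<comment> \<open>\<open>v^p\<close> lies in \<open>K\<close> and therefore commutes with
        \<open>u\<close>, while moving \<open>v^p\<close> past \<open>u\<close> costs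
        \<open>c^p\<close>.\<close>
      have "u \<otimes> v [^] p \<otimes> c [^] p = u \<otimes> v [^] p" using c2(1)[of p] Kcomm[OF uv(1) vp] by simp
      then have cp: "c [^] p = \<one>" using cuv mult_eq_self[of "u \<otimes> v [^] p" "c [^] p"] by simp
      have yp: "y [^] p = c [^] (p * (p - 1) div 2)" using c2(2)[of p] uvp cuv by (simp add: y_def)
      \<comment> \<open>An element of order at most \<open>p\<close> outside \<open>K\<close> is
        excluded by \<open>noSmall\<close>, because \<open>p \<le> p^d\<close>.\<close>
      have small: False if "y [^] p = \<one>"
      proof -
        have "ord y dvd p" using that pow_eq_id y(1) Nc by blast
        then have "ord y \<le> p" using p_gt_1 by (intro dvd_imp_le) auto
        also have "p \<le> p ^ d" using d(1) p_gt_1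
          by (metis One_nat_def Suc_leI less_imp_le power_increasing power_one_right)
        finally show False using noSmall[OF y] by simp
      qed
      show False
      proof (cases "p = 2")
        case False
        then have "odd p" using p by (metis primes_dvd_imp_eq two_is_prime_nat)
        \<comment> \<open>For odd \<open>p\<close> the exponent of \<open>c\<close> is a multiple of
          \<open>p\<close>, so \<open>y^p\<close> is trivial.\<close>
        then have "p * (p - 1) div 2 = p * ((p - 1) div 2)" by (simp add: div_mult_swap)
        then have "y [^] p = (c [^] p) [^] ((p - 1) div 2)" using yp cuv by (simp add: nat_pow_pow)
        then show False using cp small by simp
      next
        case True
        \<comment> \<open>For \<open>p = 2\<close> the exponent is 1 and \<open>y^2 = c\<close>
          survives, so \<open>y\<close> has order 4 and the hypothesis on cyclic subgroups of order
          4 must be invoked.\<close>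
        then have y2: "y [^] (2::nat) = c" using yp cuv by simp
        have "y [^] (2 * 2::nat) = c [^] (2::nat)" using y2 y Nc by (simp only: nat_pow_pow[symmetric])
        then have y4: "y [^] (4::nat) = \<one>" using cp True by simp
        then have o4: "ord y dvd 4" using pow_eq_id y(1) Nc by blast
        have c1: "c \<noteq> \<one>" using small y2 True by auto
        have "\<not> ord y dvd 2" using c1 y2 pow_eq_id y(1) Nc by blast
        then have o: "ord y = 4"
        proof -
          have "ord y \<in> {0..4}" using o4 by (auto dest: dvd_imp_le)
          then have "ord y = 0 \<or> ord y = 1 \<or> ord y = 2 \<or> ord y = 3 \<or> ord y = 4" by auto
          then show ?thesis using o4 \<open>\<not> ord y dvd 2\<close> by auto
        qed
        \<comment> \<open>Elements outside \<open>K\<close> have order above \<open>2^d\<close>, and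
          \<open>y\<close> has order 4.\<close>
        have "d = 1"
        proof (rule ccontr)
          assume "d \<noteq> 1"
          then have "2 \<le> d" using d(1) by simp
          then have "(2::nat) ^ 2 \<le> 2 ^ d" by (intro power_increasing) auto
          then show False using noSmall[OF y] o True by simp
        qed
        moreover have "u \<otimes> v \<noteq> v \<otimes> u" using vu c1 cuv mult_eq_self[of "u \<otimes> v" c] by simp
        ultimately have "covers_or_avoids_chief (generate G {y}) H"
          using cap_four[OF True _ _ _ _ _ o H] uv y NS NH by blast
        moreover have "y \<in> generate G {y}" by (intro generate.incl) simp
        moreover have "generate G {y} \<subseteq> K <#> generate G {y}"
          using set_mult_right[OF sK generate_is_subgroup] y Nc by auto
        ultimately show False using noCap[OF y] by blast
      qed
    qed
  qed
qed

end

section \<open>Abelian action on chief factors\<close>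

context fin_group
begin

lemma rcos_eq_cong_mod:
  assumes K: "normalized_by N K" and N: "subgroup N G" and xy: "x \<in> N" "y \<in> N"
  shows "K #> x = K #> y \<longleftrightarrow> cong_mod K x y"
proof -
  note sK = normalized_by_subgroup[OF K] and Nc = sub_carrier[OF N]
  have c: "x \<in> carrier G" "y \<in> carrier G" using xy Nc by auto
  have e: "y \<otimes> inv x = conj_by (inv x) (inv x \<otimes> y)" "inv x \<otimes> y = conj_by x (y \<otimes> inv x)"
    using c by (simp_all add: conj_by_def group_word_simps)
  have "y \<otimes> inv x \<in> K \<longleftrightarrow> inv x \<otimes> y \<in> K"
    using e normalized_by_conj_by[OF K xy(1)]
      normalized_by_conj_by[OF K subgroup.m_inv_closed[OF N xy(1)]] by metis
  then show ?thesis using rcos_eq_iff[OF sK c] by (simp add: cong_mod_def)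
qed

lemma fixed_mod_subgroup:
  assumes N: "normalized_by Y N" and K: "normalized_by Y K" "normalized_by N K" "K \<subseteq> N"
    and Y: "Y \<subseteq> carrier G"
  shows "subgroup {x \<in> N. \<forall>g\<in>Y. cong_mod K x (conj_by g x)} G"
    "K \<subseteq> {x \<in> N. \<forall>g\<in>Y. cong_mod K x (conj_by g x)}"
proof -
  note sN = normalized_by_subgroup[OF N] and sK = normalized_by_subgroup[OF K(1)]
  note Nc = sub_carrier[OF sN]
  show "subgroup {x \<in> N. \<forall>g\<in>Y. cong_mod K x (conj_by g x)} G"
  proof (rule fin_subgroupI)
    show "{x \<in> N. \<forall>g\<in>Y. cong_mod K x (conj_by g x)} \<subseteq> carrier G" using Nc by auto
    show "\<one> \<in> {x \<in> N. \<forall>g\<in>Y. cong_mod K x (conj_by g x)}"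
      using subgroup.one_closed[OF sN] Y by (auto simp: cong_mod_refl[OF sK] subsetD)
    fix x y assume "x \<in> {x \<in> N. \<forall>g\<in>Y. cong_mod K x (conj_by g x)}"
      "y \<in> {x \<in> N. \<forall>g\<in>Y. cong_mod K x (conj_by g x)}"
    then have xy: "x \<in> N" "y \<in> N" "\<And>g. g \<in> Y \<Longrightarrow> cong_mod K x (conj_by g x)"
      "\<And>g. g \<in> Y \<Longrightarrow> cong_mod K y (conj_by g y)" by auto
    have "cong_mod K (x \<otimes> y) (conj_by g (x \<otimes> y))" if g: "g \<in> Y" for g
      using cong_mod_mult[OF K(2) sN xy(1) normalized_by_conj_by[OF N g xy(1)] xy(2) normalized_by_conj_by[OF N g xy(2)] xy(3)[OF g] xy(4)[OF g]]
        Nc xy(1,2) g Y by (simp add: conj_by_mult subsetD)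
    then show "x \<otimes> y \<in> {x \<in> N. \<forall>g\<in>Y. cong_mod K x (conj_by g x)}" using xy subgroup.m_closed[OF sN]
      by simp
  qed
  show "K \<subseteq> {x \<in> N. \<forall>g\<in>Y. cong_mod K x (conj_by g x)}"
    using K(3) normalized_by_conj_by[OF K(1)] subgroup.m_closed[OF sK] subgroup.m_inv_closed[OF sK]
    by (auto simp: cong_mod_def)
qed

lemma fixed_mod_normalized:
  assumes H: "subgroup H G" and Y: "Y \<subseteq> H" "\<And>h g. h \<in> H \<Longrightarrow> g \<in> Y \<Longrightarrow> conj_by h g \<in> Y"
    and N: "normalized_by H N" and K: "normalized_by H K" "normalized_by N K" "K \<subseteq> N"
  shows "normalized_by H {x \<in> N. \<forall>g\<in>Y. cong_mod K x (conj_by g x)}"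
proof -
  note sN = normalized_by_subgroup[OF N] and Hc = sub_carrier[OF H]
  note Nc = sub_carrier[OF sN]
  have "cong_mod K (conj_by h x) (conj_by g (conj_by h x))"
    if h: "h \<in> H" and x: "x \<in> N" "\<And>g. g \<in> Y \<Longrightarrow> cong_mod K x (conj_by g x)" and g: "g \<in> Y" for h x g
  proof -
    have gH: "g \<in> H" using g Y(1) by blast
    have "conj_by (inv h) g \<in> Y" using Y(2)[OF subgroup.m_inv_closed[OF H h] g] .
    then have "cong_mod K (conj_by h x) (conj_by h (conj_by (conj_by (inv h) g) x))"
      using cong_mod_conj_by[OF K(1) h Hc[OF h] _ _ x(2)] x(1) Nc Hc[OF h] Hc[OF gH] by simp
    moreover have "conj_by h (conj_by (conj_by (inv h) g) x) = conj_by g (conj_by h x)"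
      using Hc[OF h] Hc[OF gH] x Nc by (simp add: conj_by_def group_word_simps)
    ultimately show ?thesis by simp
  qed
  moreover have "Y \<subseteq> carrier G" using Y(1) subgroup.subset[OF H] by blast
  ultimately show ?thesis
    using fixed_mod_subgroup(1)[OF normalized_by_mono[OF N Y(1)] normalized_by_mono[OF K(1) Y(1)] K(2,3)]
      normalized_by_conj_by[OF N] unfolding normalized_by_def by auto
qed

text \<open>Schur's lemma by hand. Since the (p-1)-st power of \<open>h\<close> acts trivially,
  \<open>h\<close> has an eigenvector on \<open>N/K\<close> with eigenvalue in the prime field. The
  eigenspace is \<open>H\<close>-invariant because \<open>H\<close> acts as an abelian group, and by
  irreducibility it is everything.\<close>

lemma chief_eigenvector:
  fixes p :: nat
  assumes H: "subgroup H G" and p: "Factorial_Ring.prime p" and ch: "chief_in H N K" and NH: "N \<subseteq> H"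
    and comm: "\<And>x y. x \<in> N \<Longrightarrow> y \<in> N \<Longrightarrow> cong_mod K x (conj_by y x)" and exp_p: "\<And>x. x \<in> N \<Longrightarrow> x [^] p \<in> K"
    and ab: "\<And>a b x. a \<in> H \<Longrightarrow> b \<in> H \<Longrightarrow> x \<in> N \<Longrightarrow> cong_mod K (conj_by (a \<otimes> b) x) (conj_by (b \<otimes> a) x)"
    and pw: "\<And>h x. h \<in> H \<Longrightarrow> x \<in> N \<Longrightarrow> cong_mod K x (conj_by (h [^] (p - 1)) x)" and h: "h \<in> H"
  shows "\<exists>c::nat. \<forall>x\<in>N. cong_mod K (conj_by h x) (x [^] c)"
proof -
  note nN = chief_inD(1)[OF ch] and nK = chief_inD(2)[OF ch] and KN = chief_inD(3)[OF ch]
    and sN = chief_inD(4)[OF ch] and sK = chief_inD(5)[OF ch]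
  note Nc = sub_carrier[OF sN] and Kc = sub_carrier[OF sK] and Hc = sub_carrier[OF H]
  have nNK: "normalized_by N K" using normalized_by_mono[OF nK NH] .
  have KN': "K \<subseteq> N" using KN by blast
  interpret N: group "G\<lparr>carrier := N\<rparr>" using sN by (rule subgroup_imp_group)
  interpret K: normal K "G\<lparr>carrier := N\<rparr>" using normalized_by_imp_normal[OF nNK sN KN'] .
  let ?V = "G\<lparr>carrier := N\<rparr> Mod K"
  interpret V: group ?V by (rule K.factorgroup_is_group)
  have carV: "carrier ?V = (\<lambda>x. K #> x) ` N" by (simp add: carrier_FactGroup)
  have oneV: "\<one>\<^bsub>?V\<^esub> = K" by simp
  have multV: "(K #> x) \<otimes>\<^bsub>?V\<^esub> (K #> y) = K #> (x \<otimes> y)" if "x \<in> N" "y \<in> N" for x y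
    using K.rcos_sum[of x y] that by simp
  have powV: "(K #> x) [^]\<^bsub>?V\<^esub> (k::nat) = K #> (x [^] k)" if "x \<in> N" for x k
    using K.FactGroup_pow[of x k] that nat_pow_consistent[of x k N] by simp
  note eqV = rcos_eq_cong_mod[OF nNK sN]
  have Npow: "x [^] (k::nat) \<in> N" if "x \<in> N" for x k using subgroup_pow_closed[OF sN that] .
  have Nm: "x \<otimes> y \<in> N" if "x \<in> N" "y \<in> N" for x y using subgroup.m_closed[OF sN that] .
  have Ncj: "conj_by g x \<in> N" if "g \<in> H" "x \<in> N" for g x using normalized_by_conj_by[OF nN that] .
  have oneK: "K #> x = K \<longleftrightarrow> x \<in> K" if "x \<in> N" for x
    using eqV[OF subgroup.one_closed[OF sN] that] subgroup.subset[OF sK] Nc[OF that]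
      by (auto simp: cong_mod_one)
  have comm2: "K #> (x \<otimes> y) = K #> (y \<otimes> x)" if xy: "x \<in> N" "y \<in> N" for x y
  proof -
    have "cong_mod K y (conj_by x y)" using comm xy by blast
    then have "cong_mod K (x \<otimes> y) (y \<otimes> x)" using xy Nc
      by (simp add: cong_mod_def conj_by_def group_word_simps)
    then show ?thesis using eqV xy Nm by blast
  qed
  have "comm_group ?V"
    by (rule V.group_comm_groupI) (auto simp: carV multV comm2 simp del: mult_FactGroup)
  then interpret V: comm_group ?V .
  define al where "al B = conj_by h ` B" for B
  have al: "al (K #> x) = K #> conj_by h x" if "x \<in> N" for x
  proof -
    have "conj_by h ` K = K" using conj_by_image_eq[OF sK Hc[OF h]] normalized_by_conj_by[OF nK h]
      by blast
    moreover have "al (K #> x) = (\<lambda>k. conj_by h k \<otimes> conj_by h x) ` K"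
      unfolding al_def r_coset_def UNION_singleton_eq_range image_image using that Nc Kc Hc[OF h]
      by (intro image_cong refl conj_by_mult) auto
    moreover have "(\<lambda>k. conj_by h k \<otimes> conj_by h x) ` K = (\<lambda>k. k \<otimes> conj_by h x) ` (conj_by h ` K)"
      by (simp only: image_image)
    ultimately show ?thesis by (simp add: r_coset_def UNION_singleton_eq_range)
  qed
  have alhom: "al \<in> hom ?V ?V"
    by (rule homI)
      (use h in \<open>auto simp: carV al multV Nm Ncj Nc Hc conj_by_mult simp del: mult_FactGroup\<close>)
  have alpow: "(al ^^ m) (K #> x) = K #> conj_by (h [^] m) x" if "x \<in> N" for x m
  proof (induction m)
    case 0 show ?case using that Nc by simp
  next
    case (Suc m)
    have "h [^] m \<in> H" using subgroup_pow_closed[OF H h] .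
    then have "(al ^^ Suc m) (K #> x) = K #> conj_by h (conj_by (h [^] m) x)" using Suc al Ncj that
      by simp
    then show ?case using h that Hc Nc by (simp add: conj_by_conj_by)
  qed
  obtain x where x: "x \<in> N" "x \<notin> K" using KN by blast
  have "\<exists>v\<in>carrier ?V. \<exists>c::nat. v \<noteq> \<one>\<^bsub>?V\<^esub> \<and> al v = v [^]\<^bsub>?V\<^esub> c"
  proof (rule V.eigenvector_exists[where p = p and a = al and x = "K #> x"])
    show "Factorial_Ring.prime p" "al \<in> hom ?V ?V" by (fact p, fact alhom)
    show "y [^]\<^bsub>?V\<^esub> p = \<one>\<^bsub>?V\<^esub>" if y: "y \<in> carrier ?V" for y
    proof -
      obtain z where z: "z \<in> N" "y = K #> z" using y by (auto simp: carV)
      then have "K #> (z [^] p) = K" using oneK[OF Npow[OF z(1)]] exp_p[OF z(1)] by blast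
      then show ?thesis unfolding z(2) powV[OF z(1)] oneV .
    qed
    show "K #> x \<in> carrier ?V" using x by (simp add: carV)
    show "K #> x \<noteq> \<one>\<^bsub>?V\<^esub>" unfolding oneV oneK[OF x(1)] by (fact x(2))
    show "(al ^^ (p - 1)) (K #> x) = K #> x"
      unfolding alpow[OF x(1)]
      using pw[OF h x(1)] eqV[OF x(1) Ncj[OF subgroup_pow_closed[OF H h] x(1)], of "p - 1"] by blast
  qed
  then obtain v0 and c :: nat where v0: "v0 \<in> carrier ?V" "v0 \<noteq> K" "al v0 = v0 [^]\<^bsub>?V\<^esub> c"
    unfolding oneV by blast
  then obtain v where v1: "v \<in> N" "v0 = K #> v" by (auto simp: carV)
  then have v: "v \<in> N" "v \<notin> K" "K #> conj_by h v = K #> (v [^] c)"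
    using v0 oneK[OF v1(1)] powV[OF v1(1)] al[OF v1(1)] by simp_all
  define F where "F = {w \<in> N. K #> conj_by h w = K #> (w [^] c)}"
  have powm: "K #> ((x \<otimes> y) [^] (k::nat)) = K #> (x [^] k \<otimes> y [^] k)" if "x \<in> N" "y \<in> N" for x y k
    using V.nat_pow_distrib[of "K #> x" "K #> y" k] that
    by (simp add: carV multV powV Nm Npow del: mult_FactGroup)
  have sF: "subgroup F G"
  proof (rule fin_subgroupI)
    show "F \<subseteq> carrier G" using Nc by (auto simp: F_def)
    show "\<one> \<in> F" using subgroup.one_closed[OF sN] Hc[OF h] by (simp add: F_def)
    fix x y assume "x \<in> F" "y \<in> F"
    then have xy: "x \<in> N" "y \<in> N" "K #> conj_by h x = K #> (x [^] c)"
      "K #> conj_by h y = K #> (y [^] c)" by (auto simp: F_def)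
    have "K #> conj_by h (x \<otimes> y) = (K #> conj_by h x) \<otimes>\<^bsub>?V\<^esub> (K #> conj_by h y)"
      using xy(1,2) h by (simp add: multV Ncj conj_by_mult Nc Hc del: mult_FactGroup)
    also have "\<dots> = K #> (x [^] c \<otimes> y [^] c)" unfolding xy(3,4) using xy(1,2)
      by (simp add: multV Npow del: mult_FactGroup)
    finally show "x \<otimes> y \<in> F" using powm[OF xy(1,2)] xy Nm by (simp add: F_def)
  qed
  have "normalized_by H F"
  proof -
    have "conj_by g w \<in> F" if g: "g \<in> H" and w: "w \<in> F" for g w
    proof -
      have wN: "w \<in> N" and wc: "cong_mod K (conj_by h w) (w [^] c)" using w eqV h Ncj Npow
        by (auto simp: F_def)
      have e: "conj_by h (conj_by g w) = conj_by (g \<otimes> h) w"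
        "conj_by (h \<otimes> g) w = conj_by g (conj_by h w)" using g h wN Hc Nc by (auto simp: conj_by_conj_by)
      have "cong_mod K (conj_by (g \<otimes> h) w) (conj_by (h \<otimes> g) w)" using ab[OF g h wN] .
      moreover have "cong_mod K (conj_by g (conj_by h w)) (conj_by g (w [^] c))"
        using cong_mod_conj_by[OF nK g Hc[OF g] _ _ wc] h wN Hc Nc by simp
      ultimately have "cong_mod K (conj_by h (conj_by g w)) (conj_by g (w [^] c))"
        using e cong_mod_trans[OF sK, of "conj_by h (conj_by g w)" "conj_by g (conj_by h w)" "conj_by g (w [^] c)"] g h wN Hc Nc by simp
      then show ?thesis using g h wN eqV[OF Ncj[OF h Ncj[OF g wN]] Npow[OF Ncj[OF g wN]]] Hc Nc
        by (simp add: F_def Ncj conj_by_pow)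
    qed
    then show ?thesis using sF by (simp add: normalized_by_def)
  qed
  moreover have "K \<subseteq> F"
  proof
    fix k assume k: "k \<in> K"
    then have kN: "k \<in> N" using KN' by blast
    have "K #> conj_by h k = K" "K #> (k [^] c) = K"
      using normalized_by_conj_by[OF nK h k] subgroup_pow_closed[OF sK k] oneK Ncj[OF h kN]
        Npow[OF kN] by auto
    then show "k \<in> F" using kN by (simp add: F_def)
  qed
  moreover have "F \<subseteq> N" by (auto simp: F_def)
  moreover have "v \<in> F" using v by (simp add: F_def)
  ultimately have "F = N" using chief_inD(6)[OF ch] v(2) by blast
  then have "cong_mod K (conj_by h w) (w [^] c)" if "w \<in> N" for w
    using that eqV[OF Ncj[OF h that] Npow[OF that], of c] unfolding F_def by blast
  then show ?thesis by blast
qed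

text \<open>Under scalar action every cyclic subgroup of \<open>N/K\<close> is invariant, so
  irreducibility makes \<open>N/K\<close> itself cyclic of exponent \<open>p\<close>.\<close>

lemma scalar_chief_prime_index:
  assumes H: "subgroup H G" and p: "Factorial_Ring.prime p" and ch: "chief_in H N K" and NH: "N \<subseteq> H"
    and cN: "card N = p ^ a" and exp_p: "\<And>x. x \<in> N \<Longrightarrow> x [^] p \<in> K"
    and scal: "\<And>h. h \<in> H \<Longrightarrow> \<exists>c::nat. \<forall>x\<in>N. cong_mod K (conj_by h x) (x [^] c)"
  shows "card N = p * card K"
proof -
  note nN = chief_inD(1)[OF ch] and nK = chief_inD(2)[OF ch] and KN = chief_inD(3)[OF ch]
    and sN = chief_inD(4)[OF ch] and sK = chief_inD(5)[OF ch]
  note Nc = sub_carrier[OF sN] and Hc = sub_carrier[OF H]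
  have nNK: "normalized_by N K" using normalized_by_mono[OF nK NH] .
  have Ncj: "conj_by g x \<in> N" if "g \<in> H" "x \<in> N" for g x using normalized_by_conj_by[OF nN that] .
  obtain v where v: "v \<in> N" "v \<notin> K" using KN by blast
  have vN: "v [^] (i::nat) \<in> N" for i using subgroup_pow_closed[OF sN v(1)] .
  define J where "J = {x \<in> N. \<exists>i::nat. cong_mod K (v [^] i) x}"
  have sJ: "subgroup J G"
  proof (rule fin_subgroupI)
    show "J \<subseteq> carrier G" using Nc by (auto simp: J_def)
    show "\<one> \<in> J" using subgroup.one_closed[OF sN] cong_mod_refl[OF sK one_closed]
      by (auto simp: J_def intro!: exI[of _ "0::nat"])
    fix x y assume "x \<in> J" "y \<in> J"
    then obtain i j :: nat
      where ij: "x \<in> N" "y \<in> N" "cong_mod K (v [^] i) x" "cong_mod K (v [^] j) y" by (auto simp: J_def)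
    have "cong_mod K (v [^] i \<otimes> v [^] j) (x \<otimes> y)"
      using cong_mod_mult[OF nNK sN _ _ _ _ ij(3,4)] ij vN by simp
    then have "cong_mod K (v [^] (i + j)) (x \<otimes> y)" using Nc[OF v(1)] by (simp add: nat_pow_mult)
    then show "x \<otimes> y \<in> J" using ij subgroup.m_closed[OF sN] by (auto simp: J_def)
  qed
  have "conj_by h x \<in> J" if hx: "h \<in> H" "x \<in> J" for h x
  proof -
    from hx obtain i :: nat where i: "x \<in> N" "cong_mod K (v [^] i) x" by (auto simp: J_def)
    obtain c :: nat where c: "\<And>x. x \<in> N \<Longrightarrow> cong_mod K (conj_by h x) (x [^] c)" using scal[OF hx(1)]
      by blast
    have "cong_mod K (conj_by h x) (x [^] c)" using c i by blast
    then have 1: "cong_mod K (x [^] c) (conj_by h x)" using cong_mod_sym[OF sK] hx(1) i(1) Hc Nc by simp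
    have 2: "cong_mod K ((v [^] i) [^] c) (x [^] c)" using cong_mod_pow[OF nNK sN vN i(1,2)] .
    have "cong_mod K ((v [^] i) [^] c) (conj_by h x)"
      using cong_mod_trans[OF sK _ _ _ 2 1] hx(1) i(1) Hc Nc vN v(1) by simp
    then have "cong_mod K (v [^] (i * c)) (conj_by h x)" using v(1) Nc by (simp add: nat_pow_pow)
    then show ?thesis using Ncj hx(1) i(1) by (auto simp: J_def)
  qed
  then have "normalized_by H J" using sJ by (simp add: normalized_by_def)
  moreover have "K \<subseteq> J"
  proof
    fix k assume "k \<in> K"
    then have "k \<in> N" "cong_mod K (v [^] (0::nat)) k" using KN sub_carrier[OF sK]
      by (auto simp: cong_mod_one)
    then show "k \<in> J" unfolding J_def by blast
  qed
  moreover have "J \<subseteq> N" by (auto simp: J_def)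
  moreover have "v \<in> J"
    using v Nc cong_mod_refl[OF sK, of v] by (auto simp: J_def intro!: exI[of _ "1::nat"])
  ultimately have JN: "J = N" using chief_inD(6)[OF ch] v(2) by blast
  have p0: "0 < p" using p prime_gt_0_nat by blast
  have "N \<subseteq> (\<Union>r<p. left_coset (v [^] r) K)"
  proof
    fix x assume "x \<in> N"
    then obtain i :: nat where i: "cong_mod K (v [^] i) x" using JN by (auto simp: J_def)
    have xc: "x \<in> carrier G" using \<open>x \<in> N\<close> Nc by blast
    have vc: "v \<in> carrier G" using v(1) Nc by blast
    have "v [^] i = v [^] (i mod p) \<otimes> (v [^] p) [^] (i div p)" using vc
      by (simp add: nat_pow_pow nat_pow_mult)
    moreover have "x = v [^] i \<otimes> (inv (v [^] i) \<otimes> x)" using vc xc by (simp add: inv_cancel)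
    ultimately have "x = v [^] (i mod p) \<otimes> ((v [^] p) [^] (i div p) \<otimes> (inv (v [^] i) \<otimes> x))"
      using vc xc by (metis m_assoc m_closed nat_pow_closed inv_closed)
    moreover have "(v [^] p) [^] (i div p) \<otimes> (inv (v [^] i) \<otimes> x) \<in> K"
      using subgroup_pow_closed[OF sK exp_p[OF v(1)]] i subgroup.m_closed[OF sK]
        by (simp add: cong_mod_def)
    ultimately have "x \<in> left_coset (v [^] (i mod p)) K" unfolding left_coset_def by blast
    moreover have "i mod p < p" using p0 by simp
    ultimately show "x \<in> (\<Union>r<p. left_coset (v [^] r) K)" by blast
  qed
  then have "card N \<le> card (\<Union>r<p. left_coset (v [^] r) K)"
    using sK by (intro card_mono finite_UN_I) (auto simp: left_coset_def)
  also have "\<dots> \<le> (\<Sum>r<p. card (left_coset (v [^] r) K))" by (rule card_UN_le) simp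
  also have "\<dots> = p * card K" using card_lcos[OF sK] v Nc by simp
  finally have "\<not> p * card K < card N" by simp
  then show ?thesis using prime_power_gap[OF p sK sN KN cN] by blast
qed

text \<open>An automorphism of a cyclic group is a power map, determined on a generator
  \<open>v\<close>. Its exponent is prime to \<open>p\<close>, since otherwise \<open>h\<close>
  would carry \<open>v\<close> into \<open>K\<close>.\<close>

lemma prime_quotient_power_action:
  assumes H: "subgroup H G" and p: "Factorial_Ring.prime p" and N: "normalized_by H N"
    and K: "normalized_by H K" "K \<subseteq> N"
    and NH: "N \<subseteq> H" and c: "card N = p * card K" and h: "h \<in> H"
  shows "\<exists>i::nat. \<not> p dvd i \<and> (\<forall>x\<in>N. cong_mod K (conj_by h x) (x [^] i))"
proof -
  note sN = normalized_by_subgroup[OF N] and sK = normalized_by_subgroup[OF K(1)]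
  note Nc = sub_carrier[OF sN] and Hc = sub_carrier[OF H]
  have nNK: "normalized_by N K" using normalized_by_mono[OF K(1) NH] .
  have "card K < card N" using c card_pos[OF sK] p prime_gt_1_nat[of p] by simp
  then obtain v where v: "v \<in> N" "v \<notin> K" using card_mono[OF fin_sub[OF sK], of N] by auto
  have hv: "conj_by h v \<in> N" using normalized_by_conj_by[OF N h v(1)] .
  obtain i :: nat where i: "cong_mod K (v [^] i) (conj_by h v)"
    using prime_index_powers[OF nNK sN K(2) c p v hv] by blast
  have act: "cong_mod K (conj_by h x) (x [^] i)" if x: "x \<in> N" for x
  proof -
    obtain j :: nat where j: "cong_mod K (v [^] j) x"
      using prime_index_powers[OF nNK sN K(2) c p v x] by blast
    have vN: "v [^] (j::nat) \<in> N" "v [^] i \<in> N" for j using subgroup_pow_closed[OF sN v(1)] by auto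
    have car: "v \<in> carrier G" "x \<in> carrier G" "h \<in> carrier G" using v x h Nc Hc by auto
    have "cong_mod K (conj_by h (v [^] j)) (conj_by h x)"
      using cong_mod_conj_by[OF K(1) h _ _ _ j] car by simp
    then have 1: "cong_mod K (conj_by h x) (conj_by h v [^] j)" using cong_mod_sym[OF sK] car
      by (simp add: conj_by_pow)
    have "cong_mod K (conj_by h v) (v [^] i)" using cong_mod_sym[OF sK _ _ i] car by simp
    then have 2: "cong_mod K (conj_by h v [^] j) ((v [^] i) [^] j)"
      using cong_mod_pow[OF nNK sN hv vN(2)] by blast
    have 3: "cong_mod K ((v [^] j) [^] i) (x [^] i)" using cong_mod_pow[OF nNK sN vN(1) x j] .
    have "(v [^] i) [^] j = (v [^] j) [^] i" using car by (simp add: nat_pow_pow mult.commute)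
    then have "cong_mod K (conj_by h v [^] j) (x [^] i)"
      using cong_mod_trans[OF sK _ _ _ 2, of "x [^] i"] 3 car by simp
    then show ?thesis using cong_mod_trans[OF sK _ _ _ 1] car by simp
  qed
  moreover have "\<not> p dvd i"
  proof
    assume "p dvd i"
    then obtain k where "i = p * k" by (auto simp: dvd_def)
    then have "v [^] i \<in> K"
      using subgroup_pow_closed[OF sK prime_index_pow[OF nNK sN K(2) c v(1)], of k] v Nc
        by (simp add: nat_pow_pow)
    then have "conj_by h v \<in> K" using cong_mod_in[OF sK sK subset_refl _ _ i] hv v Nc by simp
    then have "conj_by (inv h) (conj_by h v) \<in> K"
      using normalized_by_conj_by[OF K(1)] subgroup.m_inv_closed[OF H h] by blast
    then show False using v h Hc Nc by simp
  qed
  ultimately show ?thesis by blast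
qed

end

section \<open>Inert elements and chief factors of large normal p-subgroups\<close>

text \<open>The inert elements form a normal subgroup of \<open>H\<close> that contains all commutators, all
  $(p-1)$-st powers and all $p$-elements of \<open>H\<close>;
    if $|P| > p^d$, its elements of order prime to $p$ centralize \<open>P\<close>.\<close>
definition (in group) inert :: "nat \<Rightarrow> 'a set \<Rightarrow> 'a set \<Rightarrow> 'a set"
  where "inert p H P = {h \<in> H. \<forall>N K. normalized_by H N \<longrightarrow> normalized_by H K \<longrightarrow> K \<subseteq> N \<longrightarrow> N \<subseteq> P \<longrightarrow>
    card N = p * card K \<longrightarrow> centralizes_mod h N K}"

context fin_group
begin

lemma sylow_in_elem_ord:
  fixes q :: nat
  assumes T: "subgroup T G" "card T = q ^ k" "Factorial_Ring.prime q" and x: "x \<in> T"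
  shows "\<exists>j. ord x = q ^ j"
proof -
  have "ord x dvd q ^ k"
    using pgroup_elem_pow[OF T(1) x] T(2) pow_eq_id[of x "q ^ k"] sub_carrier[OF T(1) x] by simp
  then show ?thesis using T(3) divides_primepow_nat by blast
qed

text \<open>The product of \<open>C\<close> and \<open>T\<close> contains a Sylow subgroup of
  \<open>L\<close> for every prime: \<open>T\<close> for \<open>p\<close> itself, and for any other
  prime a Sylow subgroup lying in \<open>C\<close>. Hence its order is divisible by
  \<open>|L|\<close>.\<close>

lemma normal_syl_decomp:
  assumes L: "subgroup L G" and C: "normalized_by L C" "C \<subseteq> L" and p: "Factorial_Ring.prime p"
    and T: "sylow_in p L T"
    and q: "\<And>q k x. Factorial_Ring.prime q \<Longrightarrow> q \<noteq> p \<Longrightarrow> x \<in> L \<Longrightarrow> ord x = q ^ k \<Longrightarrow> x \<in> C"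
    and l: "l \<in> L"
  shows "\<exists>c\<in>C. \<exists>t\<in>T. l = c \<otimes> t"
proof -
  have T': "subgroup T G" "T \<subseteq> L" "card T = p ^ multiplicity p (card L)" using T
    by (auto simp: sylow_in_def)
  note sC = normalized_by_subgroup[OF C(1)]
  define M where "M = C <#> T"
  have sM: "subgroup M G" unfolding M_def
    using set_mult_subgroup[OF normalized_by_mono[OF C(1) T'(2)] T'(1)] .
  have MsubL: "M \<subseteq> L" unfolding M_def using set_mult_in[OF L C(2) T'(2)] .
  have "card L dvd card M"
  proof (rule multiplicity_le_imp_dvd)
    show "card L \<noteq> 0" using card_pos[OF L] by simp
    fix r :: nat assume r: "Factorial_Ring.prime r"
    have M0: "card M \<noteq> 0" using card_pos[OF sM] by simp
    have "r ^ multiplicity r (card L) dvd card M"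
    proof (cases "r = p")
      case True
      then show ?thesis using card_sub_dvd[OF T'(1) sM] set_mult_right[OF sC T'(1)] T'(3)
        by (simp add: M_def)
    next
      case False
      obtain R where R: "sylow_in r L R" using sylow_in_exists[OF L r] by blast
      then have R': "subgroup R G" "R \<subseteq> L" "card R = r ^ multiplicity r (card L)"
        by (auto simp: sylow_in_def)
      have "R \<subseteq> C"
      proof
        fix x assume x: "x \<in> R"
        obtain j where "ord x = r ^ j" using sylow_in_elem_ord[OF R'(1,3) r x] by blast
        then show "x \<in> C" using q[OF r False] x R'(2) by blast
      qed
      then have "R \<subseteq> M" using set_mult_left[OF sC T'(1)] by (auto simp: M_def)
      then show ?thesis using card_sub_dvd[OF R'(1) sM] R'(3) by simp
    qed
    then show "multiplicity r (card L) \<le> multiplicity r (card M)"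
      using M0 r by (intro multiplicity_geI) auto
  qed
  then have "card L \<le> card M" using card_pos[OF sM] by (rule dvd_imp_le)
  then have "M = L" using MsubL L by (intro card_seteq) auto
  then show ?thesis using l by (auto simp: M_def set_mult_def)
qed

lemma inert_subgroup:
  assumes H: "subgroup H G" and PH: "P \<subseteq> H"
  shows "subgroup (inert p H P) G" "\<And>h g. h \<in> H \<Longrightarrow> g \<in> inert p H P \<Longrightarrow> conj_by h g \<in> inert p H P"
    "inert p H P \<subseteq> H"
proof -
  note Hc = sub_carrier[OF H]
  show sub: "inert p H P \<subseteq> H" by (auto simp: inert_def)
  show "subgroup (inert p H P) G"
  proof (rule fin_subgroupI)
    show "inert p H P \<subseteq> carrier G" using sub subgroup.subset[OF H] by blast
    show "\<one> \<in> inert p H P"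
    proof -
      have "cong_mod K x (conj_by \<one> x)" if "normalized_by H N" "normalized_by H K" "x \<in> N" for N K x
        using that sub_carrier[OF normalized_by_subgroup[OF that(1)] that(3)]
          by (simp add: cong_mod_refl normalized_by_subgroup)
      then show ?thesis using subgroup.one_closed[OF H] by (simp add: inert_def centralizes_mod_def)
    qed
    fix a b assume ab: "a \<in> inert p H P" "b \<in> inert p H P"
    have "centralizes_mod (a \<otimes> b) N K"
      if N: "normalized_by H N" "normalized_by H K" "K \<subseteq> N" "N \<subseteq> P" "card N = p * card K" for N K
    proof -
      note sN = normalized_by_subgroup[OF N(1)] and sK = normalized_by_subgroup[OF N(2)]
      have c: "centralizes_mod a N K" "centralizes_mod b N K" "a \<in> H" "b \<in> H" using ab N
        by (auto simp: inert_def)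
      have "cong_mod K x (conj_by (a \<otimes> b) x)" if x: "x \<in> N" for x
      proof -
        have ca: "a \<in> carrier G" "b \<in> carrier G" "x \<in> carrier G" using c x Hc sub_carrier[OF sN] by auto
        have ax: "conj_by a x \<in> N" using normalized_by_conj_by[OF N(1) c(3) x] .
        have "cong_mod K x (conj_by a x)" "cong_mod K (conj_by a x) (conj_by b (conj_by a x))"
          using c(1,2) x ax by (auto simp: centralizes_mod_def)
        then have "cong_mod K x (conj_by b (conj_by a x))"
          using cong_mod_trans[OF sK, of x "conj_by a x" "conj_by b (conj_by a x)"] ca by simp
        then show ?thesis using ca by (simp add: conj_by_conj_by)
      qed
      then show ?thesis by (simp add: centralizes_mod_def)
    qed
    then show "a \<otimes> b \<in> inert p H P" using ab subgroup.m_closed[OF H] by (auto simp: inert_def)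
  qed
  fix h g assume h: "h \<in> H" and g: "g \<in> inert p H P"
  have gH: "g \<in> H" using g sub by blast
  have "centralizes_mod (conj_by h g) N K"
    if N: "normalized_by H N" "normalized_by H K" "K \<subseteq> N" "N \<subseteq> P" "card N = p * card K" for N K
  proof -
    note sN = normalized_by_subgroup[OF N(1)] and sK = normalized_by_subgroup[OF N(2)]
    have "cong_mod K x (conj_by (conj_by h g) x)" if x: "x \<in> N" for x
    proof -
      have c: "x \<in> carrier G" "g \<in> carrier G" "h \<in> carrier G" using x h gH Hc sub_carrier[OF sN] by auto
      have x': "conj_by (inv h) x \<in> N"
        using normalized_by_conj_by[OF N(1) subgroup.m_inv_closed[OF H h] x] .
      have gx: "cong_mod K (conj_by (inv h) x) (conj_by g (conj_by (inv h) x))" using g N x'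
        by (auto simp: inert_def centralizes_mod_def)
      have "cong_mod K (conj_by h (conj_by (inv h) x)) (conj_by h (conj_by g (conj_by (inv h) x)))"
        by (rule cong_mod_conj_by[OF N(2) h c(3) _ _ gx]) (use c in simp_all)
      moreover have "conj_by h (conj_by g (conj_by (inv h) x)) = conj_by (conj_by h g) x" using c
        by (simp add: conj_by_def group_word_simps)
      ultimately show ?thesis using c by simp
    qed
    then show ?thesis by (simp add: centralizes_mod_def)
  qed
  then show "conj_by h g \<in> inert p H P"
    using normalized_by_conj_by[OF normalized_by_self[OF H] h gH] by (simp add: inert_def)
qed

text \<open>A p-group fixes a nontrivial coset in a factor of order \<open>p\<close>, and its fixed
  points form a subgroup, so they fill the factor.\<close>

lemma psubgroup_inert:
  assumes H: "subgroup H G" and PH: "P \<subseteq> H" and sP: "subgroup P G" "card P = p ^ a"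
    and p: "Factorial_Ring.prime p"
    and T: "subgroup T G" "T \<subseteq> H" "card T = p ^ k"
  shows "T \<subseteq> inert p H P"
proof -
  have "centralizes_mod t N K"
    if N: "normalized_by H N" "normalized_by H K" "K \<subseteq> N" "N \<subseteq> P" "card N = p * card K"
      and t: "t \<in> T" for t N K
  proof -
    note sN = normalized_by_subgroup[OF N(1)] and sK = normalized_by_subgroup[OF N(2)]
    obtain m where m: "card N = p ^ m" using pgroup_sub[OF sN sP(1) N(4) sP(2) p] by blast
    have "K \<noteq> N" using N(5) card_pos[OF sK] p prime_gt_1_nat[of p] by auto
    then have KN: "K \<subset> N" using N(3) by blast
    have nN: "normalized_by T N" "normalized_by T K" "normalized_by N K"
      using normalized_by_mono[OF N(1) T(2)] normalized_by_mono[OF N(2) T(2)]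
        normalized_by_mono[OF N(2)] N(4) PH by auto
    define F where "F = {x \<in> N. \<forall>g\<in>T. cong_mod K x (conj_by g x)}"
    have F: "subgroup F G" "K \<subseteq> F"
      using fixed_mod_subgroup[OF nN N(3) subgroup.subset[OF T(1)]] by (simp_all add: F_def)
    obtain y where "y \<in> N - K" "\<forall>g\<in>T. cong_mod K y (conj_by g y)"
      using pgroup_fixed_in_quotient[OF T(1,3) p nN(1,2) KN m] by blast
    then have "F \<noteq> K" by (auto simp: F_def)
    moreover have "F \<subseteq> N" by (auto simp: F_def)
    ultimately have "F = N" using no_between[OF sK F(1) sN F(2) _ N(5) p] by blast
    then show ?thesis using t by (auto simp: F_def centralizes_mod_def)
  qed
  then show ?thesis using T(2) by (auto simp: inert_def)
qed

text \<open>Power maps commute: \<open>a b\<close> and \<open>b a\<close> both act as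
  \<open>x \<mapsto> x^(i j)\<close>.\<close>

lemma commutator_centralizes_mod:
  assumes H: "subgroup H G" and p: "Factorial_Ring.prime p" and N: "normalized_by H N"
    and K: "normalized_by H K" "K \<subseteq> N"
    and NH: "N \<subseteq> H" and c: "card N = p * card K" and ab: "a \<in> H" "b \<in> H"
  shows "centralizes_mod (a \<otimes> b \<otimes> inv (b \<otimes> a)) N K"
  unfolding centralizes_mod_def
proof
  fix x assume x: "x \<in> N"
  note sN = normalized_by_subgroup[OF N] and sK = normalized_by_subgroup[OF K(1)]
  note Nc = sub_carrier[OF sN] and Hc = sub_carrier[OF H]
  have nNK: "normalized_by N K" using normalized_by_mono[OF K(1) NH] .
  have act: "\<exists>k::nat. cong_mod K (conj_by (a \<otimes> b) x) (x [^] (i * j)) \<and> cong_mod K (conj_by (b \<otimes> a) x) (x [^] (i * j))"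
    if ij: "\<forall>x\<in>N. cong_mod K (conj_by a x) (x [^] (i::nat))"
      "\<forall>x\<in>N. cong_mod K (conj_by b x) (x [^] (j::nat))" for i j
  proof -
    have gen: "cong_mod K (conj_by (g \<otimes> h) x) (x [^] (i * j))"
      if gh: "g \<in> H" "h \<in> H" "\<forall>x\<in>N. cong_mod K (conj_by g x) (x [^] (i::nat))"
        "\<forall>x\<in>N. cong_mod K (conj_by h x) (x [^] (j::nat))" for g h i j
    proof -
      have car: "g \<in> carrier G" "h \<in> carrier G" "x \<in> carrier G" using gh x Hc Nc by auto
      have gx: "conj_by g x \<in> N" using normalized_by_conj_by[OF N gh(1) x] .
      have 1: "cong_mod K (conj_by h (conj_by g x)) (conj_by g x [^] j)" using gh(4) gx by blast
      have 2: "cong_mod K (conj_by g x [^] j) ((x [^] i) [^] j)"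
        using cong_mod_pow[OF nNK sN gx subgroup_pow_closed[OF sN x]] gh(3) x by blast
      show ?thesis using cong_mod_trans[OF sK _ _ _ 1 2] car by (simp add: conj_by_conj_by nat_pow_pow)
    qed
    show ?thesis using gen[OF ab ij] gen[OF ab(2,1) ij(2,1)] by (simp add: mult.commute)
  qed
  obtain i j :: nat
    where "\<forall>x\<in>N. cong_mod K (conj_by a x) (x [^] i)" "\<forall>x\<in>N. cong_mod K (conj_by b x) (x [^] j)"
    using prime_quotient_power_action[OF H p N K NH c] ab by meson
  then have e: "cong_mod K (conj_by (a \<otimes> b) x) (x [^] (i * j))"
    "cong_mod K (conj_by (b \<otimes> a) x) (x [^] (i * j))" using act by auto
  have car: "a \<in> carrier G" "b \<in> carrier G" "x \<in> carrier G" using ab x Hc Nc by auto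
  have ba: "cong_mod K (conj_by (b \<otimes> a) x) (conj_by (a \<otimes> b) x)"
    using cong_mod_trans[OF sK _ _ _ e(2) cong_mod_sym[OF sK _ _ e(1)]] car by simp
  have iH: "inv (b \<otimes> a) \<in> H" using ab subgroup.m_closed[OF H] subgroup.m_inv_closed[OF H] by blast
  have "cong_mod K (conj_by (inv (b \<otimes> a)) (conj_by (b \<otimes> a) x)) (conj_by (inv (b \<otimes> a)) (conj_by (a \<otimes> b) x))"
    by (rule cong_mod_conj_by[OF K(1) iH Hc[OF iH] _ _ ba]) (use car in simp_all)
  then show "cong_mod K x (conj_by (a \<otimes> b \<otimes> inv (b \<otimes> a)) x)"
    using car conj_by_cancel(1)[of "b \<otimes> a" x] conj_by_conj_by[of "a \<otimes> b" "inv (b \<otimes> a)" x] by simp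
qed

text \<open>Fermat: \<open>h\<close> acts as an i-th power map with \<open>i\<close> prime to
  \<open>p\<close>, and \<open>i^(p-1) = 1\<close> modulo \<open>p\<close>.\<close>

lemma power_centralizes_mod:
  assumes H: "subgroup H G" and p: "Factorial_Ring.prime p" and N: "normalized_by H N"
    and K: "normalized_by H K" "K \<subseteq> N"
    and NH: "N \<subseteq> H" and c: "card N = p * card K" and h: "h \<in> H"
  shows "centralizes_mod (h [^] (p - 1)) N K"
  unfolding centralizes_mod_def
proof
  fix x assume x: "x \<in> N"
  note sN = normalized_by_subgroup[OF N] and sK = normalized_by_subgroup[OF K(1)]
  note Nc = sub_carrier[OF sN] and Hc = sub_carrier[OF H]
  have nNK: "normalized_by N K" using normalized_by_mono[OF K(1) NH] .
  have car: "h \<in> carrier G" "x \<in> carrier G" using h x Hc Nc by auto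
  obtain i :: nat where i: "\<not> p dvd i" "\<forall>x\<in>N. cong_mod K (conj_by h x) (x [^] i)"
    using prime_quotient_power_action[OF H p N K NH c h] by blast
  have it: "cong_mod K (conj_by (h [^] m) x) (x [^] (i ^ m))" for m :: nat
  proof (induction m)
    case 0 show ?case using car by (simp add: cong_mod_refl[OF sK])
  next
    case (Suc m)
    have hm: "conj_by (h [^] m) x \<in> N" using normalized_by_conj_by[OF N subgroup_pow_closed[OF H h] x] .
    have 1: "cong_mod K (conj_by h (conj_by (h [^] m) x)) (conj_by (h [^] m) x [^] i)" using i(2) hm
      by blast
    have 2: "cong_mod K (conj_by (h [^] m) x [^] i) ((x [^] (i ^ m)) [^] i)"
      using cong_mod_pow[OF nNK sN hm subgroup_pow_closed[OF sN x] Suc] .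
    show ?case using cong_mod_trans[OF sK _ _ _ 1 2] car
      by (simp add: conj_by_conj_by nat_pow_pow mult.commute)
  qed
  have "[i ^ (p - 1) = 1] (mod p)" using i(1) p fermat_theorem by blast
  then have "p dvd i ^ (p - 1) - 1" by (rule cong_to_1_nat)
  have "0 < i" using i(1) by (cases i) auto
  then have "1 \<le> i ^ (p - 1)" by simp
  from \<open>p dvd i ^ (p - 1) - 1\<close>
  obtain k where "i ^ (p - 1) - 1 = p * k" by (auto simp: dvd_def)
  then have "i ^ (p - 1) = 1 + p * k" using \<open>1 \<le> i ^ (p - 1)\<close> by simp
  then have "x [^] (i ^ (p - 1)) = x [^] (1::nat) \<otimes> x [^] (p * k)" using car by (simp only: nat_pow_mult)
  then have "x [^] (i ^ (p - 1)) = x \<otimes> (x [^] p) [^] k" using car by (simp add: nat_pow_pow)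
  then have "cong_mod K x (x [^] (i ^ (p - 1)))"
    using subgroup_pow_closed[OF sK prime_index_pow[OF nNK sN K(2) c x]] car
      by (simp add: cong_mod_def inv_cancel)
  then show "cong_mod K x (conj_by (h [^] (p - 1)) x)"
    using cong_mod_trans[OF sK _ _ _ _ cong_mod_sym[OF sK _ _ it[of "p - 1"]]] car by simp
qed

lemma normalizer_of_conj_by:
  assumes g: "g \<in> carrier G" and Q: "Q \<subseteq> carrier G"
  shows "normalizer_of (conj_by g ` Q) = conj_by g ` normalizer_of Q"
proof -
  have sub: "conj_by g ` normalizer_of Q \<subseteq> normalizer_of (conj_by g ` Q)"
    if g: "g \<in> carrier G" and Q: "Q \<subseteq> carrier G" for g Q
  proof
    fix y assume "y \<in> conj_by g ` normalizer_of Q"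
    then obtain x where x: "x \<in> carrier G" "\<And>z. z \<in> Q \<Longrightarrow> conj_by x z \<in> Q" "y = conj_by g x"
      by (auto simp: normalizer_of_def)
    have "conj_by y (conj_by g z) \<in> conj_by g ` Q" if z: "z \<in> Q" for z
    proof -
      have "conj_by y (conj_by g z) = conj_by g (conj_by x z)" using x(1,3) g z Q
        by (auto simp: conj_by_def group_word_simps subsetD)
      then show ?thesis using x(2)[OF z] by simp
    qed
    then show "y \<in> normalizer_of (conj_by g ` Q)" using x g by (auto simp: normalizer_of_def)
  qed
  have e: "conj_by (inv g) ` conj_by g ` Q = Q" unfolding image_image using g Q
    by (auto simp: subsetD intro!: image_eqI)
  have gQ: "conj_by g ` Q \<subseteq> carrier G" using g Q by auto
  have "conj_by (inv g) ` normalizer_of (conj_by g ` Q) \<subseteq> normalizer_of Q"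
    using sub[of "inv g" "conj_by g ` Q"] g gQ e by simp
  then have "conj_by g ` conj_by (inv g) ` normalizer_of (conj_by g ` Q) \<subseteq> conj_by g ` normalizer_of Q" by (rule image_mono)
  moreover have "conj_by g ` conj_by (inv g) ` normalizer_of (conj_by g ` Q) = normalizer_of (conj_by g ` Q)"
    unfolding image_image using g normalizer_of_carrier by (auto intro!: image_eqI)
  ultimately show ?thesis using sub[OF g Q] by blast
qed

end

context cap_sylow
begin

text \<open>The inert group modulo the centralizer of \<open>P\<close> in it is a p-group, because
  its elements of prime power order prime to \<open>p\<close> centralize \<open>P\<close>. So up to
  elements invisible on \<open>P\<close> it is a Sylow p-subgroup; both the scalar action and the
  control of fusion rest on this.\<close>

lemma inert_decomp:
  assumes H: "subgroup H G" and P: "normalized_by H P" "P \<subseteq> S" "P \<subseteq> H" "p ^ d < card P"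
    and T: "sylow_in p (inert p H P) T" and h: "h \<in> inert p H P"
  shows "\<exists>c\<in>inert p H P. \<exists>t\<in>T. h = c \<otimes> t \<and> (\<forall>x\<in>P. conj_by c x = x)"
proof -
  note sP = normalized_by_subgroup[OF P(1)]
  note Pc = sub_carrier[OF sP] and Hc = sub_carrier[OF H]
  note I = inert_subgroup[OF H P(3), where p = p]
  define C where "C = {c \<in> inert p H P. \<forall>x\<in>P. conj_by c x = x}"
  have sC: "subgroup C G"
    by (rule fin_subgroupI)
      (use I(1,3) Hc Pc subgroup.one_closed[OF I(1)] subgroup.m_closed[OF I(1)] in \<open>auto simp: C_def conj_by_conj_by[symmetric] subsetD\<close>)
  have nC: "normalized_by (inert p H P) C"
  proof -
    have "conj_by g c \<in> C" if g: "g \<in> inert p H P" "c \<in> C" for g c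
    proof -
      have gH: "g \<in> H" using g(1) I(3) by blast
      have c: "c \<in> inert p H P" "\<And>x. x \<in> P \<Longrightarrow> conj_by c x = x" using g by (auto simp: C_def)
      have cc: "c \<in> carrier G" using c(1) sub_carrier[OF I(1)] by blast
      have "conj_by (conj_by g c) x = x" if x: "x \<in> P" for x
      proof -
        have x': "conj_by (inv g) x \<in> P"
          using normalized_by_conj_by[OF P(1) subgroup.m_inv_closed[OF H gH] x] .
        have "conj_by (conj_by g c) x = conj_by g (conj_by c (conj_by (inv g) x))"
          using Hc[OF gH] cc Pc[OF x] by (simp add: conj_by_def group_word_simps)
        then show ?thesis using c(2)[OF x'] Hc[OF gH] Pc[OF x] by simp
      qed
      then show ?thesis using I(2)[OF gH c(1)] by (simp add: C_def)
    qed
    then show ?thesis using sC by (simp add: normalized_by_def)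
  qed
  have q: "x \<in> C" if x: "Factorial_Ring.prime q" "q \<noteq> p" "x \<in> inert p H P" "ord x = q ^ k" for q k x
  proof -
    have xH: "x \<in> H" using x(3) I(3) by blast
    have "centralizes_mod x P {\<one>}"
      by (rule coprime_centralizes_aux[OF H xH x(4,1,2) P]) (use x(3) in \<open>auto simp: inert_def\<close>)
    then have "conj_by x z = z" if "z \<in> P" for z
      using that Pc Hc[OF xH] by (auto simp: centralizes_mod_def cong_mod_triv)
    then show ?thesis using x(3) by (simp add: C_def)
  qed
  have CI: "C \<subseteq> inert p H P" by (auto simp: C_def)
  have "\<exists>c\<in>C. \<exists>t\<in>T. h = c \<otimes> t"
    by (rule normal_syl_decomp[OF I(1) nC CI p T _ h]) (rule q)
  then show ?thesis by (auto simp: C_def)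
qed

text \<open>The inert group acts trivially on every chief factor below \<open>P\<close>. It contains
  all commutators and (p-1)-st powers, so what is left of the action of \<open>H\<close> is abelian
  of exponent dividing \<open>p - 1\<close>, hence scalar.\<close>

lemma chief_factor_prime:
  assumes H: "subgroup H G" and P: "normalized_by H P" "P \<subseteq> S" "P \<subseteq> H" "p ^ d < card P"
    and ch: "chief_in H N K" and NP: "N \<subseteq> P"
  shows "card N = p * card K"
proof -
  note sP = normalized_by_subgroup[OF P(1)] and Hc = sub_carrier[OF H]
  note nN = chief_inD(1)[OF ch] and nK = chief_inD(2)[OF ch] and KN = chief_inD(3)[OF ch]
    and sN = chief_inD(4)[OF ch] and sK = chief_inD(5)[OF ch]
  note Nc = sub_carrier[OF sN]
  have NH: "N \<subseteq> H" using NP P(3) by blast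
  obtain a where a: "card N = p ^ a" using pgroup_sub[OF sN S _ cS p] NP P(2) by blast
  obtain b where b: "card P = p ^ b" using pgroup_sub[OF sP S P(2) cS p] by blast
  note el = chief_pquotient_elementary[OF H ch NH sN subset_refl a p set_mult_right[OF sK sN]]
  note I = inert_subgroup[OF H P(3), where p = p]
  obtain T where T: "sylow_in p (inert p H P) T" using sylow_in_exists[OF I(1) p] by blast
  then have T': "subgroup T G" "T \<subseteq> inert p H P" "card T = p ^ multiplicity p (card (inert p H P))"
    by (auto simp: sylow_in_def)
  have TH: "T \<subseteq> H" using T'(2) I(3) by blast
  have nNK: "normalized_by N K" using normalized_by_mono[OF nK NH] .
  \<comment> \<open>The p-group \<open>T\<close> has a nontrivial fixed coset. The other part of an
    inert element centralizes \<open>P\<close>, so this coset is fixed by the whole inert group,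
    whose fixed points are \<open>H\<close>-invariant.\<close>
  obtain v where v: "v \<in> N" "v \<notin> K" "\<And>g. g \<in> T \<Longrightarrow> cong_mod K v (conj_by g v)"
    using pgroup_fixed_in_quotient[OF T'(1,3) p normalized_by_mono[OF nN TH] normalized_by_mono[OF nK TH] KN a] by blast
  define F where "F = {x \<in> N. \<forall>g\<in>inert p H P. cong_mod K x (conj_by g x)}"
  have "cong_mod K v (conj_by g v)" if g: "g \<in> inert p H P" for g
  proof -
    obtain c t where ct: "c \<in> inert p H P" "t \<in> T" "g = c \<otimes> t" "\<forall>x\<in>P. conj_by c x = x"
      using inert_decomp[OF H P T g] by blast
    have "conj_by g v = conj_by t (conj_by c v)"
      using ct(1,2,3) Nc[OF v(1)] sub_carrier[OF I(1)] sub_carrier[OF T'(1)]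
      by (simp add: conj_by_conj_by)
    then show ?thesis using ct(2,4) v NP by auto
  qed
  then have "v \<in> F" using v by (simp add: F_def)
  moreover have "normalized_by H F"
    unfolding F_def using fixed_mod_normalized[OF H I(3) I(2) nN nK nNK] KN by blast
  moreover have "K \<subseteq> F"
    unfolding F_def
      using fixed_mod_subgroup(2)[OF normalized_by_mono[OF nN I(3)] normalized_by_mono[OF nK I(3)] nNK _ subgroup.subset[OF I(1)]] KN by blast
  moreover have "F \<subseteq> N" by (auto simp: F_def)
  ultimately have "F = N" using chief_inD(6)[OF ch] v(2) by blast
  then have F: "cong_mod K x (conj_by g x)" if "x \<in> N" "g \<in> inert p H P" for x g using that
    by (auto simp: F_def)
  have ab: "cong_mod K (conj_by (x \<otimes> y) z) (conj_by (y \<otimes> x) z)" if xy: "x \<in> H" "y \<in> H" "z \<in> N" for x y z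
  proof -
    define w where "w = x \<otimes> y \<otimes> inv (y \<otimes> x)"
    have wH: "w \<in> H" unfolding w_def using xy subgroup.m_closed[OF H] subgroup.m_inv_closed[OF H]
      by blast
    have "w \<in> inert p H P"
      using commutator_centralizes_mod[OF H p] xy(1,2) wH P(3) by (fastforce simp: inert_def w_def)
    then have "cong_mod K z (conj_by w z)" using F xy(3) by blast
    then have "cong_mod K (conj_by (y \<otimes> x) z) (conj_by (y \<otimes> x) (conj_by w z))"
      using cong_mod_conj_by[OF nK subgroup.m_closed[OF H xy(2,1)]] xy wH Hc Nc by simp
    moreover have "conj_by (y \<otimes> x) (conj_by w z) = conj_by (x \<otimes> y) z"
      using xy Hc Nc by (simp add: w_def conj_by_conj_by) (simp add: m_assoc)
    ultimately show ?thesis using cong_mod_sym[OF sK] xy Hc Nc by simp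
  qed
  have pw: "cong_mod K z (conj_by (x [^] (p - 1)) z)" if "x \<in> H" "z \<in> N" for x z
  proof -
    have "x [^] (p - 1) \<in> inert p H P"
      using power_centralizes_mod[OF H p] that(1) subgroup_pow_closed[OF H that(1)] P(3)
        by (fastforce simp: inert_def)
    then show ?thesis using F that(2) by blast
  qed
  show ?thesis
    using scalar_chief_prime_index[OF H p ch NH a el(2)] chief_eigenvector[OF H p ch NH el ab pw]
      by blast
qed

end

section \<open>Control of fusion\<close>

context fin_group
begin

lemma pow_in_normal_mult:
  assumes J: "normalized_by E J" and E: "subgroup E G" and b: "b \<in> J <#> E"
  shows "b [^] card E \<in> J"
proof -
  note sJ = normalized_by_subgroup[OF J] and Ec = sub_carrier[OF E]
  note Jc = sub_carrier[OF sJ]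
  from b obtain j e where je: "j \<in> J" "e \<in> E" "b = j \<otimes> e" by (auto simp: set_mult_def)
  have "\<exists>j'\<in>J. b [^] m = j' \<otimes> e [^] m" for m :: nat
  proof (induction m)
    case 0 show ?case using subgroup.one_closed[OF sJ] by (intro bexI[of _ "\<one>"]) auto
  next
    case (Suc m)
    then obtain j' where j': "j' \<in> J" "b [^] m = j' \<otimes> e [^] m" by blast
    have em: "inv (e [^] m) \<in> E" using subgroup_pow_closed[OF E je(2)] subgroup.m_inv_closed[OF E]
      by blast
    have "b [^] Suc m = (j' \<otimes> conj_by (inv (e [^] m)) j) \<otimes> e [^] Suc m"
      using j' je Jc Ec by (simp add: conj_by_def group_word_simps)
    moreover have "j' \<otimes> conj_by (inv (e [^] m)) j \<in> J"
      using j'(1) normalized_by_conj_by[OF J em je(1)] subgroup.m_closed[OF sJ] by blast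
    ultimately show ?case by blast
  qed
  then obtain j' where "j' \<in> J" "b [^] card E = j' \<otimes> e [^] card E" by blast
  then show ?thesis using pgroup_elem_pow[OF E je(2)] Jc by simp
qed

text \<open>The index of \<open>E\<close> in \<open>J <#> E\<close> equals that of
  \<open>J \<inter> E\<close> in \<open>J\<close>, hence is prime to \<open>p\<close>.\<close>

lemma sylow_in_of_product:
  fixes p :: nat
  assumes p: "Factorial_Ring.prime p" and E: "subgroup E G" "card E = p ^ k"
    and J: "normalized_by E J" and sy: "sylow_in p J (J \<inter> E)"
  shows "sylow_in p (J <#> E) E"
proof -
  note sJ = normalized_by_subgroup[OF J]
  have sB: "subgroup (J <#> E) G" using set_mult_subgroup[OF J E(1)] .
  have sJE: "subgroup (J \<inter> E) G" using subgroups_Inter_pair[OF sJ E(1)] .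
  obtain m where m: "card J = m * card (J \<inter> E)" "\<not> p dvd m" using sylow_in_index[OF sJ p sy] by blast
  have "card (J <#> E) * card (J \<inter> E) = m * card (J \<inter> E) * card E"
    using card_set_mult[OF sJ E(1)] m(1) by (simp only:)
  then have "card (J <#> E) * card (J \<inter> E) = m * card E * card (J \<inter> E)" by (simp only: mult_ac)
  then have "card (J <#> E) = m * card E" using card_pos[OF sJE] by simp
  then show ?thesis using sylI[OF sB p E(1) set_mult_right[OF sJ E(1)] E(2) _ m(2)] by blast
qed

text \<open>Inside \<open>J E\<close> the Frattini argument gives a normalizer of a Sylow q-subgroup
  that supplements \<open>J\<close>. Since \<open>J E / J\<close> is a p-group, a Sylow p-subgroup
  of this normalizer already supplements \<open>J\<close>, and it can be conjugated into
  \<open>E\<close>.\<close>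

lemma frattini_complement:
  assumes p: "Factorial_Ring.prime p" and q: "Factorial_Ring.prime q" and E: "subgroup E G"
    "card E = p ^ k"
    and J: "normalized_by E J" and sy: "sylow_in p J (J \<inter> E)"
  shows "\<exists>Q. sylow_in q J Q \<and> (\<forall>e\<in>E. \<exists>j\<in>J \<inter> E. \<exists>f\<in>E \<inter> normalizer_of Q. e = j \<otimes> f)"
proof -
  note sJ = normalized_by_subgroup[OF J] and Ec = sub_carrier[OF E(1)]
  note Jc = sub_carrier[OF sJ]
  define B where "B = J <#> E"
  have sB: "subgroup B G" unfolding B_def using set_mult_subgroup[OF J E(1)] .
  note Bc = sub_carrier[OF sB]
  have JB: "J \<subseteq> B" and EB: "E \<subseteq> B"
    unfolding B_def using set_mult_left[OF sJ E(1)] set_mult_right[OF sJ E(1)] by auto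
  have nJ: "normalized_by B J"
  proof -
    have "conj_by b x \<in> J" if b: "b \<in> B" and x: "x \<in> J" for b x
    proof -
      from b obtain j e where je: "j \<in> J" "e \<in> E" "b = j \<otimes> e" by (auto simp: B_def set_mult_def)
      have "conj_by j x \<in> J" using normalized_by_conj_by[OF normalized_by_self[OF sJ] je(1) x] .
      then have "conj_by e (conj_by j x) \<in> J" using normalized_by_conj_by[OF J je(2)] by blast
      then show ?thesis using je x Jc Ec by (simp add: conj_by_conj_by)
    qed
    then show ?thesis using sJ by (simp add: normalized_by_def)
  qed
  have sylE: "sylow_in p B E" unfolding B_def using sylow_in_of_product[OF p E J sy] .
  obtain Q0 where Q0: "sylow_in q J Q0" using sylow_in_exists[OF sJ q] by blast
  then have Q0': "subgroup Q0 G" "Q0 \<subseteq> J" by (auto simp: sylow_in_def)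
  define R where "R = B \<inter> normalizer_of Q0"
  have sR: "subgroup R G" unfolding R_def
    using subgroups_Inter_pair[OF sB normalizer_of_subgroup[OF Q0'(1)]] .
  have RB: "R \<subseteq> B" by (auto simp: R_def)
  have nJR: "normalized_by R (J \<inter> R)"
    using normalized_by_Int[OF normalized_by_mono[OF nJ RB] normalized_by_self[OF sR]] .
  obtain T where T: "sylow_in p R T" using sylow_in_exists[OF sR p] by blast
  then have T': "subgroup T G" "T \<subseteq> R" "card T = p ^ multiplicity p (card R)"
    by (auto simp: sylow_in_def)
  \<comment> \<open>Elements of \<open>R\<close> of prime power order prime to \<open>p\<close> lie
    in \<open>J\<close>, so \<open>R\<close> is the product of \<open>J \<inter> R\<close> and
    \<open>T\<close>.\<close>
  have dec: "\<exists>j\<in>J. \<exists>t\<in>T. b = j \<otimes> t" if b: "b \<in> B" for b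
  proof -
    obtain j n where jn: "j \<in> J" "n \<in> R" "b = j \<otimes> n"
      using frattini[OF sB q nJ JB Q0 b] by (auto simp: R_def)
    have "\<exists>c\<in>J \<inter> R. \<exists>t\<in>T. n = c \<otimes> t"
    proof (rule normal_syl_decomp[OF sR nJR _ p T _ jn(2)])
      fix r k x assume r: "Factorial_Ring.prime r" "r \<noteq> p" "x \<in> R" "ord x = r ^ k"
      have xc: "x \<in> carrier G" using r(3) sub_carrier[OF sR] by blast
      have "x [^] card E \<in> J" using pow_in_normal_mult[OF J E(1)] r(3) RB by (auto simp: B_def)
      moreover have "x [^] ord x \<in> J" using xc subgroup.one_closed[OF sJ] by simp
      moreover have "coprime (ord x) (card E)"
        using r p E(2) by (simp add: primes_coprime coprime_power_left_iff coprime_power_right_iff)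
      moreover have "ord x \<noteq> 0" using ord_ge_1[OF fin xc] by simp
      ultimately have "x \<in> J" using pow_coprime_mem[OF sJ xc] by blast
      then show "x \<in> J \<inter> R" using r(3) by blast
    qed simp
    then obtain c t where ct: "c \<in> J" "t \<in> T" "n = c \<otimes> t" by blast
    have "b = (j \<otimes> c) \<otimes> t" using jn ct Jc sub_carrier[OF T'(1)] by (simp add: m_assoc)
    then show ?thesis using jn ct subgroup.m_closed[OF sJ] by blast
  qed
  \<comment> \<open>Moving \<open>T\<close> into \<open>E\<close> by \<open>b\<close> moves
    \<open>Q0\<close> to another Sylow q-subgroup of \<open>J\<close>, which is the required
    \<open>Q\<close>.\<close>
  obtain b where b: "b \<in> B" "conj_by b ` T \<subseteq> E"
    using sylow_in_absorbs[OF sB p sylE T'(1) _ T'(3)] T'(2) RB by blast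
  have bc: "b \<in> carrier G" using b(1) Bc by blast
  define Q where "Q = conj_by b ` Q0"
  have sQ: "sylow_in q J Q"
    using Q0 normalized_by_conj_by[OF nJ b(1)] conj_by_image_subgroup[OF bc Q0'(1)]
      card_conj_by_image[OF bc subgroup.subset[OF Q0'(1)]]
    by (auto simp: sylow_in_def Q_def)
  have TQ: "conj_by b ` T \<subseteq> normalizer_of Q"
    unfolding Q_def normalizer_of_conj_by[OF bc subgroup.subset[OF Q0'(1)]] using T'(2)
      by (auto simp: R_def)
  have "\<exists>j\<in>J \<inter> E. \<exists>f\<in>E \<inter> normalizer_of Q. e = j \<otimes> f" if e: "e \<in> E" for e
  proof -
    have ib: "inv b \<in> B" using subgroup.m_inv_closed[OF sB b(1)] .
    have "conj_by (inv b) e \<in> B" using normalized_by_conj_by[OF normalized_by_self[OF sB] ib] e EB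
      by blast
    then obtain j t where jt: "j \<in> J" "t \<in> T" "conj_by (inv b) e = j \<otimes> t" using dec by blast
    have tc: "t \<in> carrier G" using jt(2) sub_carrier[OF T'(1)] by blast
    have "e = conj_by b (conj_by (inv b) e)" using bc Ec[OF e] by simp
    also have "\<dots> = conj_by b j \<otimes> conj_by b t" unfolding jt(3) using bc tc Jc[OF jt(1)]
      by (rule_tac conj_by_mult)
    finally have eq: "e = conj_by b j \<otimes> conj_by b t" .
    have t: "conj_by b t \<in> E" "conj_by b t \<in> normalizer_of Q" using jt(2) b(2) TQ by auto
    have j: "conj_by b j \<in> J" using normalized_by_conj_by[OF nJ b(1) jt(1)] .
    have "conj_by b j \<in> E" using eq e sub_mult_right_iff[OF E(1) t(1), of "conj_by b j"] Jc[OF j] by simp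
    then show ?thesis using eq t j by blast
  qed
  then show ?thesis using sQ by blast
qed

end

context cap_sylow
begin

text \<open>Downward induction on \<open>|Q|\<close>. Any isomorphism onto a fully normalized
  conjugate \<open>Qs\<close> extends to a larger subgroup, up to an element of the normalizer
  \<open>H\<close> of \<open>Qs\<close>. That element must be undone, and
  \<open>inert_decomp\<close> permits this: up to elements centralizing \<open>Qs\<close> it
  normalizes \<open>Ts\<close>, which is again larger than \<open>Qs\<close>.\<close>

lemma fusion_controlled:
  "subgroup Q G \<Longrightarrow> Q \<subseteq> S \<Longrightarrow> p ^ d < card Q \<Longrightarrow> g \<in> carrier G \<Longrightarrow> (\<And>x. x \<in> Q \<Longrightarrow> conj_by g x \<in> S) \<Longrightarrow>
    \<exists>m\<in>normalizer_of S. \<forall>x\<in>Q. conj_by g x = conj_by m x"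
proof (induction "card S - card Q" arbitrary: Q g rule: less_induct)
  case less
  note sQ = less.prems(1) and QS = less.prems(2) and Qd = less.prems(3) and gc = less.prems(4)
    and gQ = less.prems(5)
  have sG: "subgroup (carrier G) G" by (rule subgroup_self)
  show ?case
  proof (cases "Q = S")
    case True
    then show ?thesis using gc gQ by (intro bexI[of _ g]) (auto simp: normalizer_of_def)
  next
    case False
    then have QS': "Q \<subset> S" using QS by blast
    note Sc = sub_carrier[OF S] and Qsub = subgroup.subset[OF sQ]
    have sN: "subgroup (normalizer_of Q) G" using normalizer_of_subgroup[OF sQ] .
    obtain T0 where T0: "sylow_in p (normalizer_of Q) T0" using sylow_in_exists[OF sN p] by blast
    then have T0': "subgroup T0 G" "T0 \<subseteq> normalizer_of Q"
      "card T0 = p ^ multiplicity p (card (normalizer_of Q))"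
      by (auto simp: sylow_in_def)
    obtain u where u: "u \<in> carrier G" "conj_by u ` T0 \<subseteq> S"
      using sylow_in_absorbs[OF sG p sylow_in_S T0'(1) subgroup.subset[OF T0'(1)] T0'(3)] by blast
    define Qs where "Qs = conj_by u ` Q"
    define Ts where "Ts = conj_by u ` T0"
    define H where "H = normalizer_of Qs"
    have Qs: "subgroup Qs G" "card Qs = card Q"
      unfolding Qs_def using conj_by_image_subgroup[OF u(1) sQ] card_conj_by_image[OF u(1) Qsub] by auto
    have sH: "subgroup H G" unfolding H_def using normalizer_of_subgroup[OF Qs(1)] .
    have Heq: "H = conj_by u ` normalizer_of Q" unfolding H_def Qs_def
      using normalizer_of_conj_by[OF u(1) Qsub] .
    have cH: "card H = card (normalizer_of Q)"
      unfolding Heq using card_conj_by_image[OF u(1) subgroup.subset[OF sN]] .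
    have Ts: "sylow_in p H Ts"
      using T0' cH conj_by_image_subgroup[OF u(1) T0'(1)]
        card_conj_by_image[OF u(1) subgroup.subset[OF T0'(1)]]
      unfolding sylow_in_def Ts_def Heq by auto
    then have Ts': "subgroup Ts G" "Ts \<subseteq> H" "card Ts = p ^ multiplicity p (card H)"
      by (auto simp: sylow_in_def)
    have TsS: "Ts \<subseteq> S" using u(2) by (simp add: Ts_def)
    have nQs: "normalized_by H Qs" unfolding H_def using normalized_by_normalizer_of[OF Qs(1)] .
    have QsH: "Qs \<subseteq> H" unfolding H_def
      using sub_normalizer_of[OF subgroup.subset[OF Qs(1)] normalized_by_self[OF Qs(1)]] .
    obtain a where a: "card Qs = p ^ a" using pgroup_sub[OF sQ S QS cS p] Qs(2) by auto
    have QsT: "Qs \<subseteq> Ts"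
    proof -
      obtain h where h: "h \<in> H" "conj_by h ` Qs \<subseteq> Ts" using sylow_in_absorbs[OF sH p Ts Qs(1) QsH a]
        by blast
      have "conj_by h ` Qs = Qs"
        using conj_by_image_eq[OF Qs(1) sub_carrier[OF sH h(1)]] normalized_by_conj_by[OF nQs h(1)]
        by blast
      then show ?thesis using h(2) by simp
    qed
    have QsS: "Qs \<subseteq> S" using QsT TsS by blast
    have Qd': "p ^ d < card Qs" using Qd Qs(2) by simp
    have QsSne: "Qs \<noteq> S" using Qs(2) psubset_card_mono[OF fin_sub[OF S] QS'] by auto
    \<comment> \<open>The normalizer of \<open>Qs\<close> in \<open>S\<close> is larger than
      \<open>Qs\<close>, and the Sylow subgroup \<open>Ts\<close> of \<open>H\<close> is at least as
      large; so the induction hypothesis is available for \<open>Ts\<close>.\<close>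
    have cTs: "card Qs < card Ts"
    proof -
      have sM: "subgroup (H \<inter> S) G" using subgroups_Inter_pair[OF sH S] .
      obtain e where e: "card (H \<inter> S) = p ^ e" using pgroup_sub[OF sM S _ cS p] by blast
      have "Qs \<subset> H \<inter> S" using normalizer_grows[OF Qs(1) S _ cS p] QsS QsSne by (auto simp: H_def)
      then have "card Qs < card (H \<inter> S)" using psubset_card_mono[OF fin_sub[OF sM]] by blast
      also have "\<dots> \<le> card Ts" using sylow_in_card_max[OF sH p Ts sM _ e] by blast
      finally show ?thesis .
    qed
    define I where "I = inert p H Qs"
    note inI = inert_subgroup[OF sH QsH, where p = p, folded I_def]
    have TsI: "Ts \<subseteq> I" unfolding I_def using psubgroup_inert[OF sH QsH Qs(1) a p Ts'] .
    have sylI: "sylow_in p I Ts" using sylow_in_mono[OF sH p Ts inI(1) TsI inI(3)] .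
    \<comment> \<open>It is enough to treat maps onto \<open>Qs\<close>: both \<open>Q\<close> and
      its image under \<open>g\<close> are mapped onto \<open>Qs\<close>, and \<open>g\<close> is
      the quotient of these two maps.\<close>
    have step: "\<exists>m\<in>normalizer_of S. \<forall>x\<in>Q1. conj_by f x = conj_by m x"
      if Q1: "subgroup Q1 G" "Q1 \<subseteq> S" "card Q1 = card Q" and f: "f \<in> carrier G"
        "conj_by f ` Q1 = Qs" for Q1 f
    proof -
      define T1 where "T1 = normalizer_of Q1 \<inter> S"
      have sT1: "subgroup T1 G" unfolding T1_def
        using subgroups_Inter_pair[OF normalizer_of_subgroup[OF Q1(1)] S] .
      have Q1S: "Q1 \<subset> S" using Q1 psubset_card_mono[OF fin_sub[OF S] QS'] by auto
      have Q1T: "Q1 \<subset> T1" unfolding T1_def using normalizer_grows[OF Q1(1) S Q1S cS p] .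
      have cT1: "card Q < card T1" using psubset_card_mono[OF fin_sub[OF sT1] Q1T] Q1(3) by simp
      obtain e where e: "card T1 = p ^ e" using pgroup_sub[OF sT1 S _ cS p] by (auto simp: T1_def)
      have sfT: "subgroup (conj_by f ` T1) G" using conj_by_image_subgroup[OF f(1) sT1] .
      have "conj_by f ` T1 \<subseteq> H"
        unfolding H_def f(2)[symmetric] normalizer_of_conj_by[OF f(1) subgroup.subset[OF Q1(1)]]
          by (auto simp: T1_def)
      moreover have "card (conj_by f ` T1) = p ^ e"
        using card_conj_by_image[OF f(1) subgroup.subset[OF sT1]] e by simp
      ultimately obtain k where k: "k \<in> H" "conj_by k ` conj_by f ` T1 \<subseteq> Ts"
        using sylow_in_absorbs[OF sH p Ts sfT] by blast
      have kc: "k \<in> carrier G" using k(1) sub_carrier[OF sH] by blast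
      have T1c: "x \<in> carrier G" if "x \<in> T1" for x using that sub_carrier[OF sT1] by blast
      have "conj_by (f \<otimes> k) x \<in> S" if "x \<in> T1" for x
        using that k(2) TsS f(1) kc T1c by (auto simp: conj_by_conj_by[symmetric])
      moreover have "card S - card T1 < card S - card Q"
        using cT1 psubset_card_mono[OF fin_sub[OF S] QS'] by simp
      moreover have "T1 \<subseteq> S" by (auto simp: T1_def)
      moreover have "p ^ d < card T1" using Qd cT1 by simp
      ultimately obtain m where m: "m \<in> normalizer_of S" "\<forall>x\<in>T1. conj_by (f \<otimes> k) x = conj_by m x"
        using less.hyps[of T1 "f \<otimes> k"] sT1 f(1) kc by blast
      define k' where "k' = inv k"
      have k': "k' \<in> H" "k' \<in> carrier G" using subgroup.m_inv_closed[OF sH k(1)] kc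
        by (auto simp: k'_def)
      \<comment> \<open>Sylow conjugacy is applied in the inert group \<open>I\<close> instead of
        \<open>H\<close>, because there the conjugating element splits into a part centralizing
        \<open>Qs\<close> and a part in \<open>Ts\<close>.\<close>
      have "sylow_in p I (conj_by k' ` Ts)"
        using inI(2)[OF k'(1)] TsI Ts' conj_by_image_subgroup[OF k'(2) Ts'(1)]
          card_conj_by_image[OF k'(2) subgroup.subset[OF Ts'(1)]] sylI
        by (auto simp: sylow_in_def)
      then obtain l where l: "l \<in> I" "conj_by l ` conj_by k' ` Ts = Ts"
        using sylow_in_conj[OF inI(1) p sylI] by blast
      obtain c t where ct: "c \<in> I" "t \<in> Ts" "l = c \<otimes> t" "\<forall>x\<in>Qs. conj_by c x = x"
        using inert_decomp[OF sH nQs QsS QsH Qd', folded I_def, OF sylI l(1)] by blast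
      have cc: "c \<in> carrier G" "t \<in> carrier G"
        using ct sub_carrier[OF inI(1)] sub_carrier[OF Ts'(1)] by auto
      have Tsc: "x \<in> carrier G" if "x \<in> Ts" for x using that sub_carrier[OF Ts'(1)] by blast
      \<comment> \<open>The factor \<open>t\<close> of \<open>l\<close> normalizes \<open>Ts\<close>
        anyway, so it can be stripped off, leaving \<open>k'\<close> corrected by an element that is
        trivial on \<open>Qs\<close>.\<close>
      have kcT: "conj_by (k' \<otimes> c) x \<in> Ts" if x: "x \<in> Ts" for x
      proof -
        have "conj_by l (conj_by k' x) \<in> Ts" using l(2) x by blast
        then have "conj_by (inv t) (conj_by l (conj_by k' x)) \<in> Ts"
          using normalized_by_conj_by[OF normalized_by_self[OF Ts'(1)] subgroup.m_inv_closed[OF Ts'(1) ct(2)]] by blast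
        moreover have "conj_by (inv t) (conj_by l (conj_by k' x)) = conj_by (k' \<otimes> c) x"
          using cc k' Tsc[OF x] by (simp add: ct(3) conj_by_def group_word_simps)
        ultimately show ?thesis by simp
      qed
      have "card Ts \<le> card S" using TsS by (intro card_mono fin_sub[OF S])
      then have "card S - card Ts < card S - card Q" using cTs Qs(2) by simp
      moreover have "p ^ d < card Ts" using Qd' cTs by simp
      moreover have "conj_by (k' \<otimes> c) x \<in> S" if "x \<in> Ts" for x using kcT[OF that] TsS by blast
      ultimately obtain m' where m': "m' \<in> normalizer_of S" "\<forall>x\<in>Ts. conj_by (k' \<otimes> c) x = conj_by m' x"
        using less.hyps[of Ts "k' \<otimes> c"] Ts'(1) TsS k'(2) cc(1) by blast
      have NSc: "m \<in> carrier G" "m' \<in> carrier G" using m(1) m'(1) normalizer_of_carrier by auto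
      have "conj_by f x = conj_by (m \<otimes> m') x" if x: "x \<in> Q1" for x
      proof -
        have xc: "x \<in> carrier G" using x sub_carrier[OF Q1(1)] by blast
        have fx: "conj_by f x \<in> Qs" using f(2) x by blast
        have y: "conj_by k (conj_by f x) \<in> Qs" using normalized_by_conj_by[OF nQs k(1) fx] .
        have ym: "conj_by k (conj_by f x) = conj_by m x" using m(2) x Q1T f(1) kc xc
          by (auto simp: conj_by_conj_by)
        have "conj_by m' (conj_by m x) = conj_by (k' \<otimes> c) (conj_by k (conj_by f x))"
          using m'(2) y QsT ym by auto
        also have "\<dots> = conj_by c (conj_by k' (conj_by k (conj_by f x)))" using k' cc kc f(1) xc
          by (simp add: conj_by_conj_by m_assoc)
        also have "conj_by k' (conj_by k (conj_by f x)) = conj_by f x" using kc f(1) xc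
          by (simp add: k'_def)
        also have "conj_by c (conj_by f x) = conj_by f x" using ct(4) fx by blast
        finally show ?thesis using NSc xc by (simp add: conj_by_conj_by)
      qed
      moreover have "m \<otimes> m' \<in> normalizer_of S"
        using m(1) m'(1) subgroup.m_closed[OF normalizer_of_subgroup[OF S]] by blast
      ultimately show ?thesis by blast
    qed
    obtain m1 where m1: "m1 \<in> normalizer_of S" "\<forall>x\<in>Q. conj_by u x = conj_by m1 x"
      using step[OF sQ QS refl u(1)] by (auto simp: Qs_def)
    define Q2 where "Q2 = conj_by g ` Q"
    have Q2: "subgroup Q2 G" "Q2 \<subseteq> S" "card Q2 = card Q"
      unfolding Q2_def using conj_by_image_subgroup[OF gc sQ] gQ card_conj_by_image[OF gc Qsub] by auto
    have ret: "conj_by (inv g \<otimes> u) (conj_by g x) = conj_by u x" if "x \<in> Q" for x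
      using that gc u(1) Qsub by (auto simp: conj_by_def group_word_simps subsetD)
    have "conj_by (inv g \<otimes> u) ` Q2 = Qs"
      unfolding Q2_def Qs_def image_image using ret by (intro image_cong) auto
    then obtain m2 where m2: "m2 \<in> normalizer_of S" "\<forall>x\<in>Q2. conj_by (inv g \<otimes> u) x = conj_by m2 x"
      using step[OF Q2, of "inv g \<otimes> u"] gc u(1) by auto
    have mc: "m1 \<in> carrier G" "m2 \<in> carrier G" using m1 m2 normalizer_of_carrier by auto
    have "conj_by g x = conj_by (m1 \<otimes> inv m2) x" if x: "x \<in> Q" for x
    proof -
      have xc: "x \<in> carrier G" using x Qsub by blast
      have "conj_by m2 (conj_by g x) = conj_by m1 x" using m1(2) m2(2) ret[OF x] x by (auto simp: Q2_def)
      then have "conj_by (inv m2) (conj_by m2 (conj_by g x)) = conj_by (inv m2) (conj_by m1 x)" by simp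
      moreover have "conj_by (inv m2) (conj_by m2 (conj_by g x)) = conj_by g x" using mc gc xc by simp
      ultimately show ?thesis using mc xc by (simp add: conj_by_conj_by)
    qed
    moreover have "m1 \<otimes> inv m2 \<in> normalizer_of S"
      using m1(1) m2(1) normalizer_of_subgroup[OF S] by (meson subgroup.m_closed subgroup.m_inv_closed)
    ultimately show ?thesis by blast
  qed
qed

section \<open>Cover-avoidance in \<open>G\<close>, measured on intersections with
  \<open>S\<close>\<close>

lemma sylow_in_normal: "normalized_by (carrier G) W \<Longrightarrow> sylow_in p W (S \<inter> W)"
  using sylow_in_Int[OF subgroup_self p sylow_in_S] subgroup.subset[OF normalized_by_subgroup] by blast

text \<open>The index of \<open>A\<close> in \<open>W <#> A\<close> is that of
  \<open>S \<inter> W\<close> in \<open>W\<close>, prime to \<open>p\<close>, so no p-subgroup of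
  the product is larger than \<open>A\<close>. This turns covering into a bound on orders.\<close>

lemma card_syl_le_of_product:
  assumes W: "normalized_by (carrier G) W" and V: "normalized_by (carrier G) V"
    and A: "subgroup A G" "A \<subseteq> S" "S \<inter> W \<subseteq> A" and VW: "V \<subseteq> W <#> A"
  shows "card (S \<inter> V) \<le> card A"
proof -
  note sW = normalized_by_subgroup[OF W] and sV = normalized_by_subgroup[OF V]
  obtain m where m: "card W = m * card (S \<inter> W)" "\<not> p dvd m"
    using sylow_in_index[OF sW p sylow_in_normal[OF W]] by blast
  have sSW: "subgroup (S \<inter> W) G" and sSV: "subgroup (S \<inter> V) G" using S sW sV
    by (auto intro: subgroups_Inter_pair)
  have WA: "W \<inter> A = S \<inter> W" using A by blast
  have "card (W <#> A) * card (S \<inter> W) = m * card (S \<inter> W) * card A"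
    using card_set_mult[OF sW A(1)] m(1) unfolding WA by (simp only:)
  then have "card (W <#> A) * card (S \<inter> W) = m * card A * card (S \<inter> W)" by (simp only: mult_ac)
  then have c: "card (W <#> A) = m * card A" using card_pos[OF sSW] by simp
  have sWA: "subgroup (W <#> A) G"
    using set_mult_subgroup[OF normalized_by_mono[OF W subgroup.subset[OF A(1)]] A(1)] .
  have "card (S \<inter> V) dvd m * card A" using card_sub_dvd[OF sSV sWA] VW c by auto
  moreover obtain k where "card (S \<inter> V) = p ^ k" using pgroup_sub[OF sSV S _ cS p] by blast
  then have "coprime (card (S \<inter> V)) m" using m(2) p
    by (simp add: prime_imp_coprime coprime_power_left_iff)
  ultimately have "card (S \<inter> V) dvd card A" by (simp add: coprime_dvd_mult_right_iff)
  then show ?thesis using card_pos[OF A(1)] by (rule dvd_imp_le)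
qed

text \<open>A subgroup \<open>A\<close> of order \<open>p^d\<close> between
  \<open>S \<inter> W\<close> and \<open>S \<inter> V\<close> is not contained in \<open>W\<close>;
  so it must cover, and then it is as large as \<open>S \<inter> V\<close>.\<close>

lemma chief_not_straddling:
  assumes ch: "chief_in (carrier G) V W" and c: "card (S \<inter> W) < p ^ d"
  shows "card (S \<inter> V) \<le> p ^ d"
proof (rule ccontr)
  assume lt: "\<not> ?thesis"
  note chD = chief_inD[OF ch]
  have sSW: "subgroup (S \<inter> W) G" and sSV: "subgroup (S \<inter> V) G" using S chD
    by (auto intro: subgroups_Inter_pair)
  obtain k where k: "card (S \<inter> V) = p ^ k" using pgroup_sub[OF sSV S _ cS p] by blast
  have "d \<le> k" using lt k p_gt_1 by simp
  then obtain A where A: "subgroup A G" "S \<inter> W \<subseteq> A" "A \<subseteq> S \<inter> V" "card A = p ^ d"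
    using pgroup_between[OF sSW sSV _ k p, of d] c chD(3) by auto
  have covers_or_avoids_chief: "covers_or_avoids_chief A (carrier G)"
    using cap_order[OF A(1) _ A(4) subgroup_self subgroup.subset[OF A(1)]] A(3) by blast
  have VA: "V \<inter> A = A" using A(3) by blast
  have "\<not> A \<subseteq> W" using A c card_mono[OF fin_sub[OF sSW], of A] by auto
  then have "V \<subseteq> W <#> A"
    using covers_or_avoids_chiefD[OF covers_or_avoids_chief ch subgroup.subset[OF chD(4)]] VA by simp
  then have "card (S \<inter> V) \<le> card A" using card_syl_le_of_product[OF chD(2,1) A(1) _ A(2)] A(3) by blast
  then show False using lt A(4) by simp
qed

text \<open>Enlarge \<open>S \<inter> V\<close> to a subgroup of \<open>S\<close> of order
  \<open>p^d\<close>. It meets \<open>V\<close> in \<open>S \<inter> V\<close>, which is not inside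
  \<open>U\<close>, so it covers \<open>V/U\<close>, and \<open>V/U\<close> is a p-group.\<close>

lemma chief_below_pquotient:
  assumes ch: "chief_in (carrier G) V U" and c: "card (S \<inter> U) < card (S \<inter> V)" "card (S \<inter> V) \<le> p ^ d"
  shows "V \<subseteq> U <#> (S \<inter> V)"
proof -
  note chD = chief_inD[OF ch]
  have sSV: "subgroup (S \<inter> V) G" and sSU: "subgroup (S \<inter> U) G" using S chD
    by (auto intro: subgroups_Inter_pair)
  obtain A where A: "subgroup A G" "S \<inter> V \<subseteq> A" "A \<subseteq> S" "card A = p ^ d"
    using pgroup_between[OF sSV S _ cS p c(2)] d by auto
  have covers_or_avoids_chief: "covers_or_avoids_chief A (carrier G)"
    using cap_order[OF A(1) A(3) A(4) subgroup_self subgroup.subset[OF A(1)]] .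
  have VA: "V \<inter> A = S \<inter> V" using A by blast
  have "\<not> S \<inter> V \<subseteq> U" using c(1) card_mono[OF fin_sub[OF sSU], of "S \<inter> V"] by auto
  then show ?thesis
    using covers_or_avoids_chiefD[OF covers_or_avoids_chief ch subgroup.subset[OF chD(4)]] VA by simp
qed

text \<open>A hyperplane of \<open>S \<inter> V\<close> is too large to lie in \<open>U\<close>,
  because the factor exceeds \<open>p\<close>, and too small to cover \<open>V/U\<close>.\<close>

lemma chief_hyperplane_contradiction:
  assumes ch: "chief_in (carrier G) V U" and gap: "p * card (S \<inter> U) < card (S \<inter> V)"
    and A: "subgroup A G" "A \<subseteq> S" "card A = p ^ d" "S \<inter> U \<subseteq> A"
      and hyp: "p * card (A \<inter> (S \<inter> V)) = card (S \<inter> V)"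
  shows False
proof -
  note chD = chief_inD[OF ch]
  have sSV: "subgroup (S \<inter> V) G" and sSU: "subgroup (S \<inter> U) G" using S chD
    by (auto intro: subgroups_Inter_pair)
  define B where "B = V \<inter> A"
  have Beq: "B = A \<inter> (S \<inter> V)" using A(2) by (auto simp: B_def)
  have sB: "subgroup B G" unfolding B_def using subgroups_Inter_pair[OF chD(4) A(1)] .
  have covers_or_avoids_chief: "covers_or_avoids_chief A (carrier G)"
    using cap_order[OF A(1-3) subgroup_self subgroup.subset[OF A(1)]] .
  have "\<not> B \<subseteq> U"
  proof
    assume "B \<subseteq> U"
    then have "B \<subseteq> S \<inter> U" using A(2) by (auto simp: B_def)
    then have "card B \<le> card (S \<inter> U)" using card_mono[OF fin_sub[OF sSU]] by blast
    then have "p * card B \<le> p * card (S \<inter> U)" by (rule mult_le_mono2)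
    then show False using gap hyp Beq by simp
  qed
  then have "V \<subseteq> U <#> B"
    using covers_or_avoids_chiefD[OF covers_or_avoids_chief ch subgroup.subset[OF chD(4)]]
    by (simp add: B_def)
  moreover have "S \<inter> U \<subseteq> B" using A(4) chD(3) by (auto simp: B_def)
  ultimately have "card (S \<inter> V) \<le> card B"
    using card_syl_le_of_product[OF chD(2,1) sB] A(2) by (auto simp: B_def)
  moreover have "1 * card B < p * card B" using card_pos[OF sB] p_gt_1
    by (intro mult_strict_right_mono) auto
  ultimately show False using hyp Beq by simp
qed

end

section \<open>Chief factors of the whole group\<close>

context cap_sylow
begin

text \<open>\<open>C\<close> stands for the centralizer of \<open>V/U\<close>, and \<open>J\<close>
  for a group whose elements of prime power order prime to \<open>p\<close> are trivial on
  \<open>S \<inter> C\<close> modulo \<open>S \<inter> V\<close> but which is not trivial on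
  \<open>V/U\<close>. The normalizer of a Sylow q-subgroup \<open>Q\<close> of \<open>J\<close>
  separates the two layers, and this produces the hyperplane.\<close>

lemma coprime_action_contradiction:
  assumes ch: "chief_in (carrier G) V U" and gap: "p * card (S \<inter> U) < card (S \<inter> V)"
    and VP: "V \<subseteq> U <#> (S \<inter> V)"
    and C: "normalized_by (carrier G) C" "V \<subseteq> C" and cC: "card (S \<inter> C) \<le> p ^ d"
    and Cmem: "\<And>g. g \<in> carrier G \<Longrightarrow> (\<And>v. v \<in> S \<inter> V \<Longrightarrow> cong_mod U v (conj_by g v)) \<Longrightarrow> g \<in> C"
    and J: "normalized_by (normalizer_of (S \<inter> C)) J" "J \<subseteq> normalizer_of (S \<inter> C)" "S \<inter> J \<subseteq> C" "\<not> J \<subseteq> C"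
    and act: "\<And>h q k. Factorial_Ring.prime q \<Longrightarrow> q \<noteq> p \<Longrightarrow> h \<in> J \<Longrightarrow> ord h = q ^ k \<Longrightarrow>
      centralizes_mod h (S \<inter> C) (S \<inter> V)"
  shows False
proof -
  note chD = chief_inD[OF ch]
  note sC = normalized_by_subgroup[OF C(1)] and sJ = normalized_by_subgroup[OF J(1)]
  define P0 where "P0 = S \<inter> C"
  define P1 where "P1 = S \<inter> V"
  define U0 where "U0 = S \<inter> U"
  define N where "N = normalizer_of P0"
  have sP0: "subgroup P0 G" and sP1: "subgroup P1 G" and sU0: "subgroup U0 G"
    unfolding P0_def P1_def U0_def using S sC chD by (auto intro: subgroups_Inter_pair)
  have UP1: "U0 \<subseteq> P1" and P10: "P1 \<subseteq> P0" using chD(3) C(2) by (auto simp: U0_def P1_def P0_def)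
  have sN: "subgroup N G" unfolding N_def using normalizer_of_subgroup[OF sP0] .
  note Sc = sub_carrier[OF S] and Nc = sub_carrier[OF sN] and Jc = sub_carrier[OF sJ]
  have Ssub: "S \<subseteq> carrier G" using subgroup.subset[OF S] .
  have nS: "normalized_by S W \<Longrightarrow> normalized_by S (S \<inter> W)" for W
    using normalized_by_Int[OF normalized_by_self[OF S]] .
  have nSP0: "normalized_by S P0" unfolding P0_def using nS[OF normalized_by_mono[OF C(1) Ssub]] .
  have nSP1: "normalized_by S P1" unfolding P1_def using nS[OF normalized_by_mono[OF chD(1) Ssub]] .
  have SN: "S \<subseteq> N" unfolding N_def using sub_normalizer_of[OF Ssub nSP0] .
  have nN0: "normalized_by N P0" unfolding N_def using normalized_by_normalizer_of[OF sP0] .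
  have Nsub: "N \<subseteq> carrier G" using subgroup.subset[OF sN] .
  have nN1: "normalized_by N P1"
  proof -
    have "P1 = P0 \<inter> V" using C(2) by (auto simp: P1_def P0_def)
    then show ?thesis using normalized_by_Int[OF nN0 normalized_by_mono[OF chD(1) Nsub]] by simp
  qed
  note J' = J(1,2)[folded P0_def, folded N_def]
  have sylN: "sylow_in p N S" using sylow_in_mono[OF subgroup_self p sylow_in_S sN SN Nsub] .
  have sylJ: "sylow_in p J (S \<inter> J)" using sylow_in_Int[OF sN p sylN J'] .
  have SJ: "S \<inter> J \<subseteq> P0" using J(3) by (auto simp: P0_def)
  define JC where "JC = J \<inter> C"
  have sJC: "subgroup JC G" unfolding JC_def using subgroups_Inter_pair[OF sJ sC] .
  have sSJ: "subgroup (S \<inter> J) G" using subgroups_Inter_pair[OF S sJ] .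
  have SJC: "S \<inter> J \<subseteq> JC" using J(3) by (auto simp: JC_def)
  have JCJ: "JC \<subset> J" using J(4) by (auto simp: JC_def)
  \<comment> \<open>\<open>S \<inter> J\<close> is a Sylow p-subgroup of \<open>J\<close> lying in
    \<open>C\<close>, so the index of \<open>J \<inter> C\<close> in \<open>J\<close> is prime to
    \<open>p\<close>.\<close>
  obtain m' where m': "card J = m' * card (S \<inter> J)" "\<not> p dvd m'" using sylow_in_index[OF sJ p sylJ]
    by blast
  obtain m where m: "card J = m * card JC"
    using card_sub_dvd[OF sJC sJ] JCJ by (auto simp: dvd_def mult.commute)
  obtain e where e: "card JC = e * card (S \<inter> J)"
    using card_sub_dvd[OF sSJ sJC SJC] by (auto simp: dvd_def mult.commute)
  have "m' * card (S \<inter> J) = m * e * card (S \<inter> J)" using m m'(1) e by (metis mult.assoc)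
  then have "m' = m * e" using card_pos[OF sSJ] mult_right_cancel by blast
  then have pm: "\<not> p dvd m" using m'(2) by auto
  have "card JC < card J" using psubset_card_mono[OF fin_sub[OF sJ] JCJ] .
  then have "1 < m" using one_less_factor[OF m[symmetric]] by simp
  \<comment> \<open>A prime divisor of this index, so that no Sylow q-subgroup of \<open>J\<close>
    lies in \<open>C\<close>.\<close>
  then obtain q where q: "Factorial_Ring.prime q" "q dvd m" using prime_factor_nat[of m] by auto
  have qp: "q \<noteq> p" using q pm by auto
  have notC: "\<not> Q \<subseteq> C" if Q: "sylow_in q J Q" for Q
  proof
    assume "Q \<subseteq> C"
    moreover have Q': "subgroup Q G" "Q \<subseteq> J" using Q by (auto simp: sylow_in_def)
    ultimately have "card Q dvd card JC" using card_sub_dvd[OF Q'(1) sJC] by (simp add: JC_def)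
    then have "q * card Q dvd card J" unfolding m using q(2) by (rule_tac mult_dvd_mono)
    moreover obtain l where "card J = l * card Q" "\<not> q dvd l" using sylow_in_index[OF sJ q(1) Q] by blast
    ultimately show False using card_pos[OF Q'(1)] by simp
  qed
  have "p ^ d \<le> p ^ Suc d" using p_gt_1 by (intro power_increasing) auto
  then have "card P0 \<le> p ^ Suc d" using cC le_trans unfolding P0_def by blast
  \<comment> \<open>Order \<open>p^(d+1)\<close>, possible since \<open>d < n\<close>: the maximal
    subgroups of \<open>E\<close> then have the order of the test subgroups.\<close>
  then obtain E where E: "subgroup E G" "P0 \<subseteq> E" "E \<subseteq> S" "card E = p ^ Suc d"
    using pgroup_between[OF sP0 S _ cS p, of "Suc d"] d by (auto simp: P0_def)
  have EN: "E \<subseteq> N" using E(3) SN by blast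
  have JE: "J \<inter> E = S \<inter> J" using E(2,3) SJ by blast
  have sylJE: "sylow_in p J (J \<inter> E)" using sylJ JE by simp
  obtain Q where Q: "sylow_in q J Q" and fr: "\<And>e. e \<in> E \<Longrightarrow> \<exists>j\<in>J \<inter> E. \<exists>f\<in>E \<inter> normalizer_of Q. e = j \<otimes> f"
    using frattini_complement[OF p q(1) E(1,4) normalized_by_mono[OF J'(1) EN] sylJE] by blast
  have sQ: "subgroup Q G" "Q \<subseteq> J" "card Q = q ^ multiplicity q (card J)" using Q
    by (auto simp: sylow_in_def)
  have QN: "Q \<subseteq> N" using sQ(2) J'(2) by blast
  note Qc = sub_carrier[OF sQ(1)] and P0c = sub_carrier[OF sP0] and P1c = sub_carrier[OF sP1]
    and Ec = sub_carrier[OF E(1)]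
  obtain a0 where a0: "card P0 = p ^ a0" using pgroup_sub[OF sP0 S _ cS p] by (auto simp: P0_def)
  obtain a1 where a1: "card P1 = p ^ a1" using pgroup_sub[OF sP1 S _ cS p] by (auto simp: P1_def)
  define E' where "E' = E \<inter> normalizer_of Q"
  have sE': "subgroup E' G" unfolding E'_def
    using subgroups_Inter_pair[OF E(1) normalizer_of_subgroup[OF sQ(1)]] .
  \<comment> \<open>\<open>Q\<close> acts trivially on \<open>P0\<close> modulo \<open>P1\<close>,
    so each coset contains an element centralizing \<open>Q\<close>, and this element normalizes
    \<open>Q\<close>.\<close>
  have fixed_pt: "\<exists>y\<in>P0 \<inter> E'. cong_mod P1 x y" if x: "x \<in> P0" for x
  proof -
    have xx: "cong_mod P1 x (conj_by g x)" if g: "g \<in> Q" for g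
    proof -
      obtain k where "ord g = q ^ k" using sylow_in_elem_ord[OF sQ(1,3) q(1) g] by blast
      then have "centralizes_mod g P0 P1" using act[OF q(1) qp] g sQ(2) by (auto simp: P0_def P1_def)
      then show ?thesis using x by (simp add: centralizes_mod_def)
    qed
    obtain y where y: "y \<in> carrier G" "cong_mod P1 x y" "\<And>g. g \<in> Q \<Longrightarrow> cong_mod {\<one>} y (conj_by g y)"
      using coprime_fixed_in_coset[OF sQ(1,3) q(1) normalized_by_mono[OF nN1 QN] normalized_by_one[OF subgroup.subset[OF sQ(1)]] _ P0c[OF x] xx a1 p]
        qp subgroup.one_closed[OF sP1] by blast
    have yP: "y \<in> P0" using cong_mod_in[OF sP1 sP0 P10 P0c[OF x] y(1,2)] x by blast
    have "conj_by y g = g" if g: "g \<in> Q" for g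
    proof -
      have "conj_by g y = y" using y(3)[OF g] y(1) Qc[OF g] by (simp add: cong_mod_triv)
      then have "g \<otimes> conj_by g y = g \<otimes> y" by simp
      then have "y \<otimes> g = g \<otimes> y" using y(1) Qc[OF g] by (simp add: conj_by_def group_word_simps)
      then have "inv y \<otimes> (g \<otimes> y) = inv y \<otimes> (y \<otimes> g)" by simp
      then show ?thesis using y(1) Qc[OF g] by (simp add: conj_by_def group_word_simps)
    qed
    then have "y \<in> E'" using yP y(1) E(2) by (auto simp: E'_def normalizer_of_def)
    then show ?thesis using y(2) yP by blast
  qed
  have E'S: "E' \<subseteq> S" using E(3) by (auto simp: E'_def)
  have nE'U0: "normalized_by E' U0"
    unfolding U0_def using normalized_by_mono[OF nS[OF normalized_by_mono[OF chD(2) Ssub]] E'S] .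
  \<comment> \<open>a proper subgroup of \<open>E\<close> with \<open>F <#> P1 = E\<close>; a maximal subgroup of \<open>E\<close> above it meets \<open>P1\<close> in a hyperplane\<close>
  define F where "F = U0 <#> E'"
  have sF: "subgroup F G" unfolding F_def using set_mult_subgroup[OF nE'U0 sE'] .
  have U0E: "U0 \<subseteq> E" using UP1 P10 E(2) by blast
  have FE: "F \<subseteq> E" unfolding F_def using set_mult_in[OF E(1) U0E] by (auto simp: E'_def)
  have UF: "U0 \<subseteq> F" and E'F: "E' \<subseteq> F"
    unfolding F_def using set_mult_left[OF sU0 sE'] set_mult_right[OF sU0 sE'] by auto
  \<comment> \<open>An element of \<open>E\<close> is a product from \<open>J \<inter> E\<close> and
    \<open>E'\<close>; the first factor lies in \<open>P0\<close> and is congruent modulo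
    \<open>P1\<close> to an element of \<open>E'\<close>.\<close>
  have EF: "E \<subseteq> F <#> P1"
  proof
    fix x assume x: "x \<in> E"
    obtain j f where jf: "j \<in> J \<inter> E" "f \<in> E'" "x = j \<otimes> f" using fr[OF x] by (auto simp: E'_def)
    have jP: "j \<in> P0" using jf(1) JE SJ by blast
    obtain y where y: "y \<in> P0 \<inter> E'" "cong_mod P1 j y" using fixed_pt[OF jP] by blast
    have car: "j \<in> carrier G" "f \<in> carrier G" "y \<in> carrier G"
      using jP y P0c jf(2) sub_carrier[OF sE'] by auto
    have "cong_mod P1 y j" using cong_mod_sym[OF sP1 car(1,3) y(2)] .
    then have "conj_by f (inv y \<otimes> j) \<in> P1" using normalized_by_conj_by[OF nSP1] jf(2) E'S
      by (auto simp: cong_mod_def)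
    moreover have "x = (y \<otimes> f) \<otimes> conj_by f (inv y \<otimes> j)" using car
      by (simp add: jf(3) conj_by_def group_word_simps)
    moreover have "y \<otimes> f \<in> F" using y jf(2) subgroup.m_closed[OF sE'] E'F by blast
    ultimately show "x \<in> F <#> P1" using set_mult_memI by metis
  qed
  \<comment> \<open>Otherwise \<open>P1\<close> would be represented modulo \<open>U0\<close> by
    elements \<open>f\<close> of \<open>P0\<close> normalizing \<open>Q\<close>. Each commutator of
    such an \<open>f\<close> with \<open>Q\<close> lies in \<open>Q\<close> and in
    \<open>P0\<close>, hence is trivial, so \<open>Q\<close> would centralize \<open>V/U\<close>,
    against the choice of \<open>q\<close>.\<close>
  have notF: "\<not> P1 \<subseteq> F"
  proof
    assume PF: "P1 \<subseteq> F"
    have "g \<in> C" if g: "g \<in> Q" for g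
    proof (rule Cmem[OF Qc[OF g]])
      fix v assume "v \<in> S \<inter> V"
      then have v: "v \<in> P1" by (simp add: P1_def)
      then obtain u f where uf: "u \<in> U0" "f \<in> E'" "v = u \<otimes> f" using PF by (auto simp: F_def set_mult_def)
      have car: "u \<in> carrier G" "f \<in> carrier G" "g \<in> carrier G"
        using uf sub_carrier[OF sU0] sub_carrier[OF sE'] Qc[OF g] by auto
      have fP: "f \<in> P0"
        using v P10 uf(1) UP1 sub_mult_left_iff[OF sP0, of u f] car unfolding uf(3) by blast
      define z where "z = inv g \<otimes> conj_by f g"
      have "conj_by f g \<in> Q" using uf(2) g by (auto simp: E'_def normalizer_of_def)
      then have zQ: "z \<in> Q" unfolding z_def
        using g subgroup.m_closed[OF sQ(1)] subgroup.m_inv_closed[OF sQ(1)] by blast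
      have "conj_by g (inv f) \<in> P0"
        using normalized_by_conj_by[OF nN0, of g "inv f"] g QN fP subgroup.m_inv_closed[OF sP0] by blast
      moreover have "z = conj_by g (inv f) \<otimes> f" using car
        by (simp add: z_def conj_by_def group_word_simps)
      ultimately have zP: "z \<in> P0" using fP subgroup.m_closed[OF sP0] by simp
      have zc: "z \<in> carrier G" using zP P0c by blast
      have "z [^] card Q = \<one>" "z [^] card P0 = \<one>"
        using pgroup_elem_pow[OF sQ(1) zQ] pgroup_elem_pow[OF sP0 zP] .
      moreover have "coprime (card Q) (card P0)"
        using q(1) p qp sQ(3) a0
          by (simp add: primes_coprime coprime_power_left_iff coprime_power_right_iff)
      moreover have "card Q \<noteq> 0" using card_pos[OF sQ(1)] by simp
      ultimately have "z \<in> {\<one>}" using pow_coprime_mem[OF triv_subgroup zc] by simp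
      then have "inv g \<otimes> (inv f \<otimes> (g \<otimes> f)) = \<one>" using car by (simp add: z_def conj_by_def m_assoc)
      moreover have "conj_by g f = f \<otimes> (inv f \<otimes> (inv g \<otimes> (f \<otimes> g)))" using car
        by (simp add: conj_by_def group_word_simps)
      moreover have "inv (inv g \<otimes> (inv f \<otimes> (g \<otimes> f))) = inv f \<otimes> (inv g \<otimes> (f \<otimes> g))" using car
        by (simp add: group_word_simps)
      ultimately have gf: "conj_by g f = f" using car by simp
      have uU: "u \<in> U" using uf(1) by (simp add: U0_def)
      have gu: "conj_by g u \<in> U" using normalized_by_conj_by[OF chD(2) car(3) uU] .
      have "inv u \<otimes> conj_by g u \<in> U"
        using uU gu subgroup.m_closed[OF chD(5)] subgroup.m_inv_closed[OF chD(5)] by blast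
      then have "conj_by f (inv u \<otimes> conj_by g u) \<in> U" using normalized_by_conj_by[OF chD(2) car(2)]
        by blast
      moreover have "inv v \<otimes> conj_by g v = conj_by f (inv u \<otimes> conj_by g u)"
      proof -
        have "conj_by g v = conj_by g u \<otimes> f" using uf(3) car gf by (simp add: conj_by_mult)
        then show ?thesis using uf(3) car by (simp add: conj_by_def[of f] group_word_simps)
      qed
      ultimately show "cong_mod U v (conj_by g v)" by (simp add: cong_mod_def)
    qed
    then show False using notC[OF Q] by blast
  qed
  have P1E: "P1 \<subseteq> E" using P10 E(2) by blast
  then have "F \<noteq> E" using notF by blast
  then have "F \<subset> E" using FE by blast
  then have "card F < p ^ Suc d" using psubset_card_mono[OF fin_sub[OF E(1)]] E(4) by metis
  moreover obtain f where f: "card F = p ^ f" using pgroup_sub[OF sF E(1) FE E(4) p] by blast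
  ultimately have "p ^ f < p ^ Suc d" by simp
  then have "f \<le> d" using p_gt_1 power_less_imp_less_exp less_Suc_eq_le by blast
  then have "card F \<le> p ^ d" using f p_gt_1 by simp
  then obtain A where A: "subgroup A G" "F \<subseteq> A" "A \<subseteq> E" "card A = p ^ d"
    using pgroup_between[OF sF E(1) FE E(4) p, of d] by auto
  have "A <#> P1 = E"
  proof
    show "A <#> P1 \<subseteq> E" using set_mult_in[OF E(1) A(3) P1E] .
    show "E \<subseteq> A <#> P1" using EF mono_set_mult[OF A(2) subset_refl, of G P1] by blast
  qed
  then have "card E * card (A \<inter> P1) = card A * card P1" using card_set_mult[OF A(1) sP1] by simp
  then have "p ^ d * (p * card (A \<inter> P1)) = p ^ d * card P1" using A(4) E(4)
    by (simp only: power_Suc mult_ac)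
  then have "p * card (A \<inter> P1) = card P1" using p_gt_1 by simp
  then show False
    using chief_hyperplane_contradiction[OF ch gap A(1) _ A(4)] A UF E(3) by (auto simp: P1_def U0_def)
qed

text \<open>Induction from the top of \<open>G\<close> downwards, so chief factors above
  \<open>V\<close> may be assumed to contribute at most \<open>p\<close>. With \<open>C\<close> the
  centralizer of \<open>V/U\<close>, the size of \<open>P0 = S \<inter> C\<close> decides: above
  \<open>p^d\<close> the local result for the normalizer of \<open>P0\<close> applies, otherwise a
  coprime action is constructed.\<close>

lemma chief_prime_below:
  "chief_in (carrier G) V U \<Longrightarrow> card (S \<inter> V) \<le> p ^ d \<Longrightarrow> card (S \<inter> U) < card (S \<inter> V) \<Longrightarrow>
    card (S \<inter> V) = p * card (S \<inter> U)"
proof (induction "card (carrier G) - card V" arbitrary: V U rule: less_induct)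
  case less
  note ch = less.prems(1) and Vd = less.prems(2) and UV = less.prems(3)
  note chD = chief_inD[OF ch]
  let ?G = "carrier G"
  have sG: "subgroup ?G G" by (rule subgroup_self)
  have Ssub: "S \<subseteq> ?G" using subgroup.subset[OF S] .
  define P1 where "P1 = S \<inter> V"
  define U0 where "U0 = S \<inter> U"
  have sP1: "subgroup P1 G" and sU0: "subgroup U0 G"
    unfolding P1_def U0_def using S chD by (auto intro: subgroups_Inter_pair)
  have UP: "U0 \<subset> P1" using chD(3) UV by (auto simp: U0_def P1_def)
  have VP: "V \<subseteq> U <#> P1" unfolding P1_def using chief_below_pquotient[OF ch UV Vd] .
  obtain a1 where a1: "card P1 = p ^ a1" using pgroup_sub[OF sP1 S _ cS p] by (auto simp: P1_def)
  have Vsub: "V \<subseteq> ?G" using subgroup.subset[OF chD(4)] .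
  have P1V: "P1 \<subseteq> V" by (auto simp: P1_def)
  note el = chief_pquotient_elementary[OF sG ch Vsub sP1 P1V a1 p VP]
  note Vc = sub_carrier[OF chD(4)] and Uc = sub_carrier[OF chD(5)] and P1c = sub_carrier[OF sP1]
  show ?case
  proof (rule ccontr)
    assume "card (S \<inter> V) \<noteq> p * card (S \<inter> U)"
    then have gap: "p * card U0 < card P1"
      using prime_power_gap[OF p sU0 sP1 UP a1] by (simp add: P1_def U0_def)
    \<comment> \<open>The centralizer of \<open>V/U\<close> in \<open>G\<close>; it contains
      \<open>V\<close> because the factor is abelian.\<close>
    define C where "C = {g \<in> ?G. \<forall>v\<in>V. cong_mod U v (conj_by g v)}"
    have Vcj: "conj_by g v \<in> V" if "g \<in> ?G" "v \<in> V" for g v using normalized_by_conj_by[OF chD(1) that] .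
    have Ctr: "cong_mod U v (conj_by (g \<otimes> h) v)"
      if "g \<in> ?G" "h \<in> ?G" "v \<in> V" "cong_mod U v (conj_by h v)" "cong_mod U v (conj_by g v)" for g h v
    proof -
      have gh: "cong_mod U (conj_by h v) (conj_by h (conj_by g v))"
        using cong_mod_conj_by[OF chD(2) that(2,2) _ _ that(5)] that Vc by simp
      have "cong_mod U v (conj_by h (conj_by g v))"
        using cong_mod_trans[OF chD(5) _ _ _ that(4) gh] that Vc by simp
      then show ?thesis using that Vc by (simp add: conj_by_conj_by)
    qed
    have sC: "subgroup C G"
    proof (rule fin_subgroupI)
      show "C \<subseteq> ?G" by (auto simp: C_def)
      show "\<one> \<in> C" using Vc by (simp add: C_def cong_mod_refl[OF chD(5)])
      fix g h assume "g \<in> C" "h \<in> C"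
      then show "g \<otimes> h \<in> C" using Ctr by (simp add: C_def)
    qed
    have nC: "normalized_by ?G C"
    proof -
      have "conj_by h g \<in> C" if h: "h \<in> ?G" and g: "g \<in> C" for h g
      proof -
        have gc: "g \<in> ?G" "\<And>v. v \<in> V \<Longrightarrow> cong_mod U v (conj_by g v)" using g by (auto simp: C_def)
        have "cong_mod U v (conj_by (conj_by h g) v)" if v: "v \<in> V" for v
        proof -
          have v': "conj_by (inv h) v \<in> V" using Vcj h v by simp
          have "cong_mod U (conj_by h (conj_by (inv h) v)) (conj_by h (conj_by g (conj_by (inv h) v)))"
            by (rule cong_mod_conj_by[OF chD(2) h h _ _ gc(2)[OF v']]) (use h gc(1) v Vc in simp_all)
          moreover have "conj_by h (conj_by g (conj_by (inv h) v)) = conj_by (conj_by h g) v"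
            using h gc(1) Vc[OF v] by (simp add: conj_by_def group_word_simps)
          ultimately show ?thesis using h Vc[OF v] by simp
        qed
        then show ?thesis using h gc(1) by (simp add: C_def)
      qed
      then show ?thesis using sC by (simp add: normalized_by_def)
    qed
    have VC: "V \<subseteq> C" using el(1) Vsub by (auto simp: C_def)
    have Cmem: "g \<in> C" if g: "g \<in> ?G" "\<And>v. v \<in> S \<inter> V \<Longrightarrow> cong_mod U v (conj_by g v)" for g
    proof -
      have "cong_mod U v (conj_by g v)" if v: "v \<in> V" for v
      proof -
        obtain u w where uw: "u \<in> U" "w \<in> P1" "v = u \<otimes> w" using VP v by (auto simp: set_mult_def)
        have car: "u \<in> ?G" "w \<in> ?G" using uw Uc P1c by auto
        have 1: "inv u \<otimes> conj_by g u \<in> U"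
          using uw(1) normalized_by_conj_by[OF chD(2) g(1)] subgroup.m_closed[OF chD(5)]
            subgroup.m_inv_closed[OF chD(5)] by blast
        have 2: "inv w \<otimes> conj_by g w \<in> U" using g(2)[of w] uw(2) by (simp add: P1_def cong_mod_def)
        have "conj_by w (inv u \<otimes> conj_by g u) \<otimes> (inv w \<otimes> conj_by g w) \<in> U"
          using normalized_by_conj_by[OF chD(2) car(2) 1] 2 subgroup.m_closed[OF chD(5)] by blast
        moreover have "inv v \<otimes> conj_by g v = conj_by w (inv u \<otimes> conj_by g u) \<otimes> (inv w \<otimes> conj_by g w)"
          using car g(1) by (simp add: uw(3) conj_by_def group_word_simps)
        ultimately show ?thesis by (simp add: cong_mod_def)
      qed
      then show ?thesis using g(1) by (simp add: C_def)
    qed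
    define P0 where "P0 = S \<inter> C"
    have sP0: "subgroup P0 G" unfolding P0_def using subgroups_Inter_pair[OF S sC] .
    have P10: "P1 \<subseteq> P0" using VC by (auto simp: P0_def P1_def)
    have P0S: "P0 \<subseteq> S" by (auto simp: P0_def)
    obtain a0 where a0: "card P0 = p ^ a0" using pgroup_sub[OF sP0 S P0S cS p] by blast
    have sylC: "sylow_in p C P0" unfolding P0_def using sylow_in_normal[OF nC] .
    define N where "N = normalizer_of P0"
    have sN: "subgroup N G" unfolding N_def using normalizer_of_subgroup[OF sP0] .
    have Nsub: "N \<subseteq> ?G" using subgroup.subset[OF sN] .
    have nN0: "normalized_by N P0" unfolding N_def using normalized_by_normalizer_of[OF sP0] .
    have P0N: "P0 \<subseteq> N" unfolding N_def
      using sub_normalizer_of[OF subgroup.subset[OF sP0] normalized_by_self[OF sP0]] .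
    have Csub: "C \<subseteq> ?G" using subgroup.subset[OF sC] .
    have nNW: "normalized_by N (S \<inter> W)" if "normalized_by ?G W" "W \<subseteq> C" for W
    proof -
      have "S \<inter> W = P0 \<inter> W" using that(2) by (auto simp: P0_def)
      then show ?thesis using normalized_by_Int[OF nN0 normalized_by_mono[OF that(1) Nsub]] by simp
    qed
    have UC: "U \<subseteq> C" using chD(3) VC by blast
    show False
    proof (cases "p ^ d < card P0")
      case True
      \<comment> \<open>\<open>N\<close> acts on \<open>P1/U0\<close> as irreducibly as
        \<open>G\<close> acts on \<open>V/U\<close>; this makes \<open>chief_factor_prime\<close>
        applicable inside the large p-group \<open>P0\<close>.\<close>
      have "chief_in N P1 U0"
        unfolding chief_in_def
      proof (intro conjI allI impI)
        show "normalized_by N P1" unfolding P1_def using nNW[OF chD(1) VC] .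
        show "normalized_by N U0" unfolding U0_def using nNW[OF chD(2) UC] .
        show "U0 \<subset> P1" by (rule UP)
        fix W assume W: "normalized_by N W" "U0 \<subseteq> W" "W \<subseteq> P1"
        note sW = normalized_by_subgroup[OF W(1)]
        have Wsub: "W \<subseteq> ?G" using subgroup.subset[OF sW] .
        define UW where "UW = U <#> W"
        have sUW: "subgroup UW G" unfolding UW_def
          using set_mult_subgroup[OF normalized_by_mono[OF chD(2) Wsub] sW] .
        have UWV: "UW \<subseteq> V" unfolding UW_def using set_mult_in[OF chD(4)] chD(3) W(3) P1V by blast
        have UUW: "U \<subseteq> UW" and WUW: "W \<subseteq> UW" unfolding UW_def
          using set_mult_left[OF chD(5) sW] set_mult_right[OF chD(5) sW] by auto
        \<comment> \<open>By the Frattini argument \<open>G = C N\<close>: \<open>C\<close> acts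
          trivially modulo \<open>U\<close>, and \<open>N\<close> preserves
          \<open>W\<close>.\<close>
        have "normalized_by ?G UW"
        proof -
          have "conj_by g x \<in> UW" if g: "g \<in> ?G" and x: "x \<in> UW" for g x
          proof -
            obtain c n where cn: "c \<in> C" "n \<in> N" "g = c \<otimes> n" using frattini[OF sG p nC Csub sylC g]
              by (auto simp: N_def)
            have xV: "x \<in> V" using x UWV by blast
            have car: "c \<in> ?G" "n \<in> ?G" "x \<in> ?G" using cn Csub Nsub xV Vc by auto
            have "cong_mod U x (conj_by c x)" using cn(1) xV by (simp add: C_def)
            then have "conj_by c x \<in> UW" using cong_mod_in[OF chD(5) sUW UUW car(3) _] car x by blast
            then obtain u w where uw: "u \<in> U" "w \<in> W" "conj_by c x = u \<otimes> w"
              by (auto simp: UW_def set_mult_def)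
            have "conj_by g x = conj_by n (conj_by c x)" using car by (simp add: cn(3) conj_by_conj_by)
            also have "\<dots> = conj_by n u \<otimes> conj_by n w" unfolding uw(3) using car uw Uc Wsub
              by (intro conj_by_mult) auto
            also have "\<dots> \<in> UW" unfolding UW_def
              using normalized_by_conj_by[OF chD(2) car(2) uw(1)]
                normalized_by_conj_by[OF W(1) cn(2) uw(2)] by (rule set_mult_memI)
            finally show ?thesis .
          qed
          then show ?thesis using sUW by (simp add: normalized_by_def)
        qed
        then have "UW = U \<or> UW = V" using chD(6) UUW UWV by blast
        then show "W = U0 \<or> W = P1"
        proof
          assume "UW = U"
          then have "W \<subseteq> U0" using WUW W(3) by (auto simp: U0_def P1_def)
          then show ?thesis using W(2) by blast
        next
          assume "UW = V"
          then have "card P1 \<le> card W"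
            unfolding P1_def using card_syl_le_of_product[OF chD(2,1) sW] W(2,3)
              by (auto simp: UW_def U0_def P1_def)
          then have "W = P1" using W(3) fin_sub[OF sP1] by (intro card_seteq)
          then show ?thesis ..
        qed
      qed
      then have "card P1 = p * card U0"
        using chief_factor_prime[OF sN nN0 P0S P0N True] P10 by blast
      then show False using gap by simp
    next
      case False
      then have cP0: "card P0 \<le> p ^ d" by simp
      \<comment> \<open>A maximal \<open>W\<close> is taken so that the next chief factor
        \<open>M/W\<close> of \<open>G\<close> enlarges the intersection with
        \<open>S\<close>.\<close>
      define Fm where "Fm = {W. normalized_by ?G W \<and> C \<subseteq> W \<and> S \<inter> W = P0}"
      have "finite Fm"
        by (rule finite_subset[of _ "Pow ?G"])
          (use fin in \<open>auto simp: Fm_def dest!: normalized_by_subgroup subgroup.subset\<close>)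
      moreover have "C \<in> Fm" using nC by (simp add: Fm_def P0_def)
      ultimately obtain W where W: "W \<in> Fm" "\<And>W'. W' \<in> Fm \<Longrightarrow> W \<subseteq> W' \<Longrightarrow> W' = W"
        using finite_has_maximal[of Fm] by (metis empty_iff)
      then have nW: "normalized_by ?G W" and CW: "C \<subseteq> W" and SW: "S \<inter> W = P0" by (auto simp: Fm_def)
      note sW = normalized_by_subgroup[OF nW]
      have Wsub: "W \<subseteq> ?G" using subgroup.subset[OF sW] .
      have dn: "p ^ d < card S" using cS d p_gt_1 by simp
      have "W \<noteq> ?G"
      proof
        assume "W = ?G"
        then have "P0 = S" using SW Ssub by blast
        then show False using cP0 dn by simp
      qed
      then have WG: "W \<subset> ?G" using Wsub by blast
      obtain M where M: "chief_in ?G M W"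
        using chief_in_min_exists[OF normalized_by_self[OF sG] nW WG] by blast
      note chM = chief_inD[OF M]
      define T where "T = S \<inter> M"
      have sT: "subgroup T G" unfolding T_def using subgroups_Inter_pair[OF S chM(4)] .
      have TS: "T \<subseteq> S" by (auto simp: T_def)
      have P0T: "P0 \<subset> T"
      proof -
        have "P0 \<subseteq> T" using SW chM(3) by (auto simp: T_def)
        moreover have "T \<noteq> P0"
        proof
          assume "T = P0"
          then have "M \<in> Fm" using chM CW by (auto simp: Fm_def T_def)
          then show False using W(2) chM(3) by blast
        qed
        ultimately show ?thesis by blast
      qed
      have cP0T: "card (S \<inter> W) < card (S \<inter> M)" unfolding SW
        using psubset_card_mono[OF fin_sub[OF sT] P0T] by (simp add: T_def)
      \<comment> \<open>\<open>M/W\<close> is a p-group. If \<open>|T| > p^d\<close>, then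
        \<open>|P0| = p^d\<close>, and any other subgroup of \<open>T\<close> of this order covers
        \<open>M/W\<close>.\<close>
      have MT: "M \<subseteq> W <#> T"
      proof (cases "card T \<le> p ^ d")
        case True
        then show ?thesis unfolding T_def using chief_below_pquotient[OF M cP0T] by blast
      next
        case False
        then have cP0eq: "card P0 = p ^ d" using chief_not_straddling[OF M] cP0 SW
          by (fastforce simp: T_def)
        have good: "M \<subseteq> W <#> T" if A: "subgroup A G" "A \<subseteq> T" "card A = p ^ d" "A \<noteq> P0" for A
        proof -
          have covers_or_avoids_chief: "covers_or_avoids_chief A ?G"
            using cap_order[OF A(1) _ A(3) sG subgroup.subset[OF A(1)]] A(2) TS by blast
          have MA: "M \<inter> A = A" using A(2) by (auto simp: T_def)
          have "\<not> A \<subseteq> W"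
          proof
            assume "A \<subseteq> W"
            then have "A \<subseteq> P0" using A(2) SW by (auto simp: T_def)
            then have "A = P0" using A(3) cP0eq fin_sub[OF sP0] by (intro card_seteq) auto
            then show False using A(4) by simp
          qed
          then have "M \<subseteq> W <#> A"
            using covers_or_avoids_chiefD[OF covers_or_avoids_chief M subgroup.subset[OF chM(4)]] MA
            by simp
          then show ?thesis using mono_set_mult[OF subset_refl A(2), of G W] by blast
        qed
        obtain t where t: "card T = p ^ t" using pgroup_sub[OF sT S TS cS p] by blast
        have "Suc d \<le> t" using False t p_gt_1 by simp
        moreover have "card P0 \<le> p ^ Suc d" using cP0eq p_gt_1 by simp
        ultimately obtain E where E: "subgroup E G" "P0 \<subseteq> E" "E \<subseteq> T" "card E = p ^ Suc d"
          using pgroup_between[OF sP0 sT _ t p, of "Suc d"] P0T by blast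
        have "E \<noteq> P0" using E(4) cP0eq p_gt_1 by auto
        then obtain x where x: "x \<in> E" "x \<notin> P0" using E(2) by blast
        have xc: "x \<in> ?G" using x(1) sub_carrier[OF E(1)] by blast
        define X1 where "X1 = generate G {x}"
        have sX: "subgroup X1 G" unfolding X1_def using xc by (intro generate_is_subgroup) auto
        have XE: "X1 \<subseteq> E" unfolding X1_def using x(1) E(1) by (intro generate_subgroup_incl) auto
        have xX: "x \<in> X1" unfolding X1_def by (intro generate.incl) simp
        show ?thesis
        proof (cases "card X1 \<le> p ^ d")
          case True
          then obtain A where A: "subgroup A G" "X1 \<subseteq> A" "A \<subseteq> E" "card A = p ^ d"
            using pgroup_between[OF sX E(1) XE E(4) p, of d] by auto
          then show ?thesis using good[of A] E(3) x(2) xX by blast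
        next
          case False
          \<comment> \<open>Here \<open>E\<close> is generated by \<open>x\<close>. Then
            \<open>P1\<close> lies in a cyclic group, which forces its elementary abelian factor
            \<open>P1/U0\<close> down to order at most \<open>p\<close>, against
            \<open>gap\<close>.\<close>
          obtain e where e: "card X1 = p ^ e" using pgroup_sub[OF sX E(1) XE E(4) p] by blast
          have "d < e" using False e p_gt_1 by simp
          then have "p ^ Suc d \<le> card X1" using e p_gt_1 by (metis Suc_leI less_imp_le power_increasing)
          then have "X1 = E" using E(1,4) XE by (intro card_seteq) auto
          then have "P1 \<subseteq> generate G {x}" using P10 E(2) by (auto simp: X1_def)
          moreover have "y [^] p \<in> U0" if "y \<in> P1" for y
            using el(2)[of y] that subgroup_pow_closed[OF S, of y p] by (auto simp: P1_def U0_def)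
          ultimately have "card P1 \<le> p * card U0"
            using cyclic_elementary_quotient[OF sP1 _ xc sU0] p_gt_1 by simp
          then show ?thesis using gap by simp
        qed
      qed
      \<comment> \<open>Intersecting with \<open>W\<close> keeps the p-part of \<open>J\<close>
        inside \<open>P0\<close>, and inertness makes \<open>J\<close> trivial on the factors of
        order \<open>p\<close>.\<close>
      define J where "J = W \<inter> inert p N P0"
      note inI = inert_subgroup[OF sN P0N, where p = p]
      have JN: "J \<subseteq> N" using inI(3) by (auto simp: J_def)
      have sJ: "subgroup J G" unfolding J_def using subgroups_Inter_pair[OF sW inI(1)] .
      have nJ: "normalized_by N J"
        using sJ normalized_by_conj_by[OF nW] inI(2) Nsub by (auto simp: normalized_by_def J_def subsetD)
      have SJ: "S \<inter> J \<subseteq> C" using SW by (auto simp: J_def P0_def)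
      have nSP0: "normalized_by S P0"
        unfolding P0_def
          using normalized_by_Int[OF normalized_by_self[OF S] normalized_by_mono[OF nC Ssub]] .
      have SN: "S \<subseteq> N" unfolding N_def using sub_normalizer_of[OF Ssub nSP0] .
      \<comment> \<open>otherwise \<open>C <#> T\<close> is normal in \<open>G\<close> and acts as a $p$-group on $V/U$, so its fixed points fill $V/U$\<close>
      have JC: "\<not> J \<subseteq> C"
      proof
        assume JC: "J \<subseteq> C"
        define Y where "Y = C <#> T"
        note Tc = sub_carrier[OF sT] and Cc = sub_carrier[OF sC] and Nc = sub_carrier[OF sN]
        have Tsub: "T \<subseteq> ?G" using subgroup.subset[OF sT] .
        have sY: "subgroup Y G" unfolding Y_def
          using set_mult_subgroup[OF normalized_by_mono[OF nC Tsub] sT] .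
        have CY: "C \<subseteq> Y" and TY: "T \<subseteq> Y" unfolding Y_def
          using set_mult_left[OF sC sT] set_mult_right[OF sC sT] by auto
        have sNY: "subgroup (normalizer_of Y) G" using normalizer_of_subgroup[OF sY] .
        have YNY: "Y \<subseteq> normalizer_of Y"
          using sub_normalizer_of[OF subgroup.subset[OF sY] normalized_by_self[OF sY]] .
        have memNY: "n \<in> normalizer_of Y" if n: "n \<in> ?G" "\<And>s. s \<in> T \<Longrightarrow> conj_by n s \<in> Y" for n
        proof -
          have "conj_by n y \<in> Y" if y: "y \<in> Y" for y
          proof -
            obtain c s where cs: "c \<in> C" "s \<in> T" "y = c \<otimes> s" using y by (auto simp: Y_def set_mult_def)
            have "conj_by n y = conj_by n c \<otimes> conj_by n s" using cs n(1) Cc Tc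
              by (simp add: conj_by_mult)
            moreover have "conj_by n c \<in> Y" using normalized_by_conj_by[OF nC n(1) cs(1)] CY by blast
            ultimately show ?thesis using n(2)[OF cs(2)] subgroup.m_closed[OF sY] by simp
          qed
          then show ?thesis using n(1) by (simp add: normalizer_of_def)
        qed
        \<comment> \<open>A commutator of \<open>n\<close> with an element of \<open>T\<close> is
          inert and lies in \<open>W\<close>, hence in \<open>J\<close>, which is assumed to be
          inside \<open>C\<close>.\<close>
        have NW: "n \<in> normalizer_of Y" if n: "n \<in> N" "n \<in> W" for n
        proof (rule memNY[OF Nc[OF n(1)]])
          fix s assume s: "s \<in> T"
          have sN': "s \<in> N" using s TS SN by blast
          define r where "r = inv n"
          have r: "r \<in> N" "r \<in> W" unfolding r_def
            using n subgroup.m_inv_closed[OF sN] subgroup.m_inv_closed[OF sW] by auto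
          have car: "r \<in> ?G" "s \<in> ?G" "n \<in> ?G" using r(1) s n(1) Nc Tc by auto
          define w where "w = r \<otimes> s \<otimes> inv (s \<otimes> r)"
          have wN: "w \<in> N" unfolding w_def
            using r(1) sN' subgroup.m_closed[OF sN] subgroup.m_inv_closed[OF sN] by blast
          have "w \<in> inert p N P0"
            using commutator_centralizes_mod[OF sN p _ _ _ _ _ r(1) sN'] wN P0N
              by (fastforce simp: inert_def w_def)
          moreover have "w \<in> W"
          proof -
            have "conj_by (inv s) (inv r) \<in> W"
              using normalized_by_conj_by[OF nW, of "inv s" "inv r"] car r(2)
              subgroup.m_inv_closed[OF sW] by simp
            then have "r \<otimes> conj_by (inv s) (inv r) \<in> W" using r(2) subgroup.m_closed[OF sW] by blast
            moreover have "w = r \<otimes> conj_by (inv s) (inv r)" using car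
              by (simp add: w_def conj_by_def group_word_simps)
            ultimately show ?thesis by simp
          qed
          ultimately have "w \<in> C" using JC by (auto simp: J_def)
          moreover have "conj_by n s = w \<otimes> s" using car
            by (simp add: w_def r_def conj_by_def group_word_simps)
          ultimately show "conj_by n s \<in> Y" using s unfolding Y_def by (auto intro: set_mult_memI)
        qed
        have CW': "normalized_by W C" using normalized_by_mono[OF nC Wsub] .
        \<comment> \<open>Frattini for the Sylow subgroup \<open>P0\<close> of \<open>C\<close>:
          \<open>W\<close> is the product of \<open>C\<close> and
          \<open>W \<inter> N\<close>.\<close>
        have WNY: "W \<subseteq> normalizer_of Y"
        proof
          fix w assume w: "w \<in> W"
          obtain c n where cn: "c \<in> C" "n \<in> W \<inter> N" "w = c \<otimes> n"
            using frattini[OF sW p CW' CW sylC w] by (auto simp: N_def)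
          then show "w \<in> normalizer_of Y" using NW CY YNY subgroup.m_closed[OF sNY] by blast
        qed
        have nGM: "normalized_by ?G M" "M \<subseteq> ?G" using chM(1) subgroup.subset[OF chM(4)] by auto
        have sylM: "sylow_in p M T" unfolding T_def using sylow_in_normal[OF chM(1)] .
        \<comment> \<open>Frattini for the Sylow subgroup \<open>T\<close> of \<open>M\<close>:
          every element of \<open>G\<close> is a product from \<open>W\<close>, \<open>T\<close> and
          the normalizer of \<open>T\<close>.\<close>
        have GNY: "g \<in> normalizer_of Y" if g: "g \<in> ?G" for g
        proof -
          obtain x n where xn: "x \<in> M" "n \<in> normalizer_of T" "g = x \<otimes> n"
            using frattini[OF sG p nGM sylM g] by auto
          obtain w s where ws: "w \<in> W" "s \<in> T" "x = w \<otimes> s" using xn(1) MT by (auto simp: set_mult_def)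
          have "n \<in> normalizer_of Y"
            by (rule memNY) (use xn(2) TY in \<open>auto simp: normalizer_of_def\<close>)
          moreover have "x \<in> normalizer_of Y" unfolding ws(3)
            using ws WNY TY YNY subgroup.m_closed[OF sNY] by blast
          ultimately show ?thesis unfolding xn(3) using subgroup.m_closed[OF sNY] by blast
        qed
        define Fx where "Fx = {v \<in> V. \<forall>g\<in>Y. cong_mod U v (conj_by g v)}"
        have nVU: "normalized_by V U" using normalized_by_mono[OF chD(2) Vsub] .
        have UV': "U \<subseteq> V" using chD(3) by blast
        have Ysub: "Y \<subseteq> ?G" using subgroup.subset[OF sY] .
        have Ycj: "conj_by h g \<in> Y" if "h \<in> ?G" "g \<in> Y" for h g using GNY[OF that(1)] that(2)
          by (simp add: normalizer_of_def)
        have "normalized_by ?G Fx" unfolding Fx_def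
          using fixed_mod_normalized[OF sG Ysub Ycj chD(1,2) nVU UV'] .
        moreover have "U \<subseteq> Fx" unfolding Fx_def
          using fixed_mod_subgroup(2)[OF normalized_by_mono[OF chD(1) Ysub] normalized_by_mono[OF chD(2) Ysub] nVU UV' Ysub] .
        moreover have "Fx \<subseteq> V" by (auto simp: Fx_def)
        ultimately have FxUV: "Fx = U \<or> Fx = V" using chD(6) by blast
        obtain tt where tt: "card T = p ^ tt" using pgroup_sub[OF sT S TS cS p] by blast
        have nT: "normalized_by T P1" "normalized_by T U0"
          unfolding P1_def U0_def
          using normalized_by_mono[OF normalized_by_Int[OF normalized_by_self[OF S] normalized_by_mono[OF chD(1) Ssub]] TS]
            normalized_by_mono[OF normalized_by_Int[OF normalized_by_self[OF S] normalized_by_mono[OF chD(2) Ssub]] TS] .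
        obtain v where v: "v \<in> P1 - U0" "\<And>g. g \<in> T \<Longrightarrow> cong_mod U0 v (conj_by g v)"
          using pgroup_fixed_in_quotient[OF sT tt p nT UP a1] by blast
        have vV: "v \<in> V" "v \<notin> U" using v(1) by (auto simp: P1_def U0_def)
        have "v \<in> Fx"
        proof -
          have "cong_mod U v (conj_by g v)" if g: "g \<in> Y" for g
          proof -
            obtain c s where cs: "c \<in> C" "s \<in> T" "g = c \<otimes> s" using g by (auto simp: Y_def set_mult_def)
            have "cong_mod U v (conj_by s v)" using cong_mod_mono[OF v(2)[OF cs(2)]]
              by (auto simp: U0_def)
            moreover have "cong_mod U v (conj_by c v)" using cs(1) vV(1) by (simp add: C_def)
            ultimately show ?thesis unfolding cs(3) using Ctr cs Cc Tc vV(1) by blast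
          qed
          then show ?thesis using vV(1) by (simp add: Fx_def)
        qed
        then have "Fx = V" using FxUV vV(2) by blast
        then have "T \<subseteq> C" using TY Tsub by (auto simp: C_def Fx_def)
        then have "T \<subseteq> P0" using TS by (auto simp: P0_def)
        then show False using P0T by blast
      qed
      have act: "centralizes_mod h P0 P1"
        if h: "Factorial_Ring.prime q" "q \<noteq> p" "h \<in> J" "ord h = q ^ k" for h q k
      proof -
        have hN: "h \<in> N" using h(3) JN by blast
        have hc: "h \<in> ?G" using hN Nsub by blast
        have coph: "coprime (ord h) p" using h(1,2,4) p
          by (simp add: primes_coprime coprime_power_left_iff)
        \<comment> \<open>Descent from \<open>C\<close> to \<open>V\<close> along chief factors of
          \<open>G\<close>: the least \<open>W'\<close> reached is \<open>V\<close>, since coprime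
          action pushes \<open>[P0,h]\<close> through each factor on which \<open>h\<close> is
          trivial.\<close>
        define Fw where "Fw = {W. normalized_by ?G W \<and> V \<subseteq> W \<and> W \<subseteq> C \<and> centralizes_mod h P0 (S \<inter> W)}"
        have "finite Fw"
          by (rule finite_subset[of _ "Pow C"]) (use fin_sub[OF sC] in \<open>auto simp: Fw_def\<close>)
        moreover have "centralizes_mod h P0 (S \<inter> C)"
          unfolding P0_def[symmetric] centralizes_mod_def cong_mod_def
          using normalized_by_conj_by[OF nN0 hN] subgroup.m_closed[OF sP0]
            subgroup.m_inv_closed[OF sP0] by blast
        then have "C \<in> Fw" using nC VC by (simp add: Fw_def)
        ultimately obtain W' where W': "W' \<in> Fw" "\<And>L. L \<in> Fw \<Longrightarrow> L \<subseteq> W' \<Longrightarrow> L = W'"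
          using finite_has_minimal[of Fw] by (metis empty_iff)
        then have nW': "normalized_by ?G W'" "V \<subseteq> W'" "W' \<subseteq> C" "centralizes_mod h P0 (S \<inter> W')"
          by (auto simp: Fw_def)
        have "W' = V"
        proof (rule ccontr)
          assume "W' \<noteq> V"
          then have "V \<subset> W'" using nW'(2) by blast
          then obtain K where K: "chief_in ?G W' K" "V \<subseteq> K"
            using chief_in_max_exists[OF nW'(1) chD(1)] by blast
          note chK = chief_inD[OF K(1)]
          have KC: "K \<subseteq> C" using chK(3) nW'(3) by blast
          have sSK: "subgroup (S \<inter> K) G" "subgroup (S \<inter> W') G" using S chK
            by (auto intro: subgroups_Inter_pair)
          have SKW: "S \<inter> K \<subseteq> S \<inter> W'" using chK(3) by blast
          have "S \<inter> W' \<subseteq> P0" using nW'(3) by (auto simp: P0_def)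
          then have cW': "card (S \<inter> W') \<le> p ^ d" using cP0 card_mono[OF fin_sub[OF sP0]] le_trans
            by blast
          have "centralizes_mod h P0 (S \<inter> K)"
          proof (cases "S \<inter> K = S \<inter> W'")
            case True then show ?thesis using nW'(4) by simp
          next
            case False
            then have lt: "card (S \<inter> K) < card (S \<inter> W')" using SKW fin_sub[OF sSK(2)]
              by (intro psubset_card_mono) auto
            \<comment> \<open>The factor \<open>W'/K\<close> is higher than \<open>V/U\<close>, so
              the induction hypothesis bounds its p-part by \<open>p\<close>, and there inertness of
              \<open>h\<close> takes effect.\<close>
            have "card V < card W'" using \<open>V \<subset> W'\<close> fin_sub[OF chK(4)] by (intro psubset_card_mono)
            moreover have "card W' \<le> card ?G" using subgroup.subset[OF chK(4)] by (intro card_mono fin)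
            ultimately have "card ?G - card W' < card ?G - card V" by simp
            then have eq: "card (S \<inter> W') = p * card (S \<inter> K)" using less.hyps[OF _ K(1) cW' lt] by blast
            have "centralizes_mod h (S \<inter> W') (S \<inter> K)"
            proof -
              have "h \<in> inert p N P0" using h(3) by (simp add: J_def)
              then show ?thesis
                unfolding inert_def using nNW[OF nW'(1,3)] nNW[OF chK(2) KC] SKW \<open>S \<inter> W' \<subseteq> P0\<close> eq
                  by blast
            qed
            moreover obtain w where "card (S \<inter> W') = p ^ w" using pgroup_sub[OF sSK(2) S _ cS p] by blast
            ultimately show ?thesis
              using coprime_stable_chain[OF sSK(2) _ p hc coph subgroup.subset[OF sP0] _ _ SKW nW'(4)]
                normalized_by_conj_by[OF nNW[OF nW'(1,3)] hN]
                  normalized_by_mono[OF nNW[OF chK(2) KC], of "{h}"] hN by blast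
          qed
          then have "K \<in> Fw" using chK K(2) KC by (simp add: Fw_def)
          then show False using W'(2) chK(3) by blast
        qed
        then show ?thesis using nW'(4) by (simp add: P1_def)
      qed
      show False
        by (rule coprime_action_contradiction[OF ch gap[unfolded U0_def P1_def] VP[unfolded P1_def] nC VC
              cP0[unfolded P0_def] Cmem nJ[unfolded N_def P0_def] JN[unfolded N_def P0_def] SJ JC])
          (use act in \<open>auto simp: P0_def P1_def\<close>)
    qed
  qed
qed

end

section \<open>The strongly closed series\<close>

lemma (in group) cyclic_group_generate:
  assumes a: "a \<in> carrier G"
  shows "cyclic_group (G\<lparr>carrier := generate G {a}\<rparr>)"
proof -
  have sA: "subgroup (generate G {a}) G" using a by (intro generate_is_subgroup) auto
  interpret A: group "G\<lparr>carrier := generate G {a}\<rparr>" using sA by (rule subgroup_imp_group)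
  have aA: "a \<in> generate G {a}" by (intro generate.incl) simp
  have "a [^]\<^bsub>G\<lparr>carrier := generate G {a}\<rparr>\<^esub> (k::int) = a [^] k" for k
    using int_pow_consistent[OF sA aA] by simp
  then show ?thesis unfolding A.cyclic_group using aA generate_pow[OF a] by (intro bexI[of _ a]) auto
qed

context fin_group
begin

lemma prime_quotient_cyclic:
  fixes p :: nat
  assumes p: "Factorial_Ring.prime p" and N: "subgroup N G" and B: "normalized_by N B" "B \<subseteq> N"
    and c: "card N = p * card B"
  shows "cyclic_group (G\<lparr>carrier := N\<rparr> Mod B)"
proof -
  interpret N: group "G\<lparr>carrier := N\<rparr>" using N by (rule subgroup_imp_group)
  interpret B: normal B "G\<lparr>carrier := N\<rparr>" using normalized_by_imp_normal[OF B(1) N B(2)] .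
  let ?V = "G\<lparr>carrier := N\<rparr> Mod B"
  interpret V: group ?V by (rule B.factorgroup_is_group)
  note sB = normalized_by_subgroup[OF B(1)]
  have "card B < card N" using c card_pos[OF sB] prime_gt_1_nat[OF p] by simp
  then obtain v where v: "v \<in> N" "v \<notin> B" using card_mono[OF fin_sub[OF sB], of N] by auto
  have vV: "B #> v \<in> carrier ?V" using v by (auto simp: carrier_FactGroup)
  have "carrier ?V \<subseteq> range (\<lambda>k::int. (B #> v) [^]\<^bsub>?V\<^esub> k)"
  proof
    fix z assume "z \<in> carrier ?V"
    then obtain x where x: "x \<in> N" "z = B #> x" by (auto simp: carrier_FactGroup)
    obtain i :: nat where "cong_mod B (v [^] i) x"
      using prime_index_powers[OF B(1) N B(2) c p v x(1)] by blast
    then have "z = B #> (v [^] i)"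
      using rcos_eq_cong_mod[OF B(1) N subgroup_pow_closed[OF N v(1)] x(1)] x(2) by blast
    also have "\<dots> = (B #> v) [^]\<^bsub>?V\<^esub> i"
      using B.FactGroup_pow[of v i] v(1) nat_pow_consistent[of v i N] by simp
    also have "\<dots> = (B #> v) [^]\<^bsub>?V\<^esub> (int i)" by (simp add: int_pow_int)
    finally show "z \<in> range (\<lambda>k::int. (B #> v) [^]\<^bsub>?V\<^esub> k)" by blast
  qed
  moreover have "range (\<lambda>k::int. (B #> v) [^]\<^bsub>?V\<^esub> k) \<subseteq> carrier ?V" using V.int_pow_closed[OF vV] by blast
  ultimately show ?thesis unfolding V.cyclic_group using vV by (intro bexI[of _ "B #> v"]) auto
qed

end

context cap_sylow
begin

text \<open>Strong closure tested on single elements instead of subgroups and morphisms.\<close>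

definition fusion_closed :: "'a set \<Rightarrow> bool"
  where "fusion_closed T \<longleftrightarrow> subgroup T G \<and> T \<subseteq> S \<and> (\<forall>x\<in>T. \<forall>g\<in>carrier G. conj_by g x \<in> S \<longrightarrow> conj_by g x \<in> T)"

text \<open>Index \<open>p\<close> instead of a cyclic quotient: this is what the chief factor
  results deliver, and it makes extending a chain by one step a matter of orders.\<close>

definition prime_chain :: "'a set \<Rightarrow> bool"
  where "prime_chain T \<longleftrightarrow> (\<exists>(m::nat) f. f 0 = {\<one>} \<and> f m = T \<and> (\<forall>i\<le>m. fusion_closed (f i)) \<and>
    (\<forall>i<m. f i \<subseteq> f (Suc i) \<and> card (f (Suc i)) = p * card (f i)))"

lemma prime_chain_one: "prime_chain {\<one>}"
proof -
  have "fusion_closed {\<one>}" using triv_subgroup subgroup.one_closed[OF S]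
    by (auto simp: fusion_closed_def)
  then show ?thesis unfolding prime_chain_def by (intro exI[of _ 0] exI[of _ "\<lambda>_. {\<one>}"]) simp
qed

lemma prime_chain_extend:
  assumes T: "prime_chain T" and T': "fusion_closed T'" "T \<subseteq> T'" "card T' = p * card T"
  shows "prime_chain T'"
proof -
  obtain m f where f: "f 0 = {\<one>}" "f (m::nat) = T" "\<forall>i\<le>m. fusion_closed (f i)"
    "\<forall>i<m. f i \<subseteq> f (Suc i) \<and> card (f (Suc i)) = p * card (f i)"
    using T unfolding prime_chain_def by blast
  define f' where "f' = f(Suc m := T')"
  have "f' 0 = {\<one>}" "f' (Suc m) = T'" using f(1) by (auto simp: f'_def)
  moreover have "\<forall>i\<le>Suc m. fusion_closed (f' i)" using f(3) T'(1) by (auto simp: f'_def le_Suc_eq)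
  moreover have "\<forall>i<Suc m. f' i \<subseteq> f' (Suc i) \<and> card (f' (Suc i)) = p * card (f' i)"
    using f(2,4) T'(2,3) by (auto simp: f'_def less_Suc_eq)
  ultimately show ?thesis unfolding prime_chain_def by blast
qed

text \<open>Control of fusion needs a subgroup of order above \<open>p^d\<close>, while a single
  element may generate a small one. So \<open>x\<close> is enlarged by \<open>S \<inter> Y\<close>,
  and \<open>g\<close> is corrected by an element of \<open>Y\<close> to fit; this correction
  changes the image of \<open>x\<close> only by an element of \<open>S \<inter> Y\<close>, which
  lies in \<open>T\<close>.\<close>

lemma fusion_closed_above:
  assumes Y: "normalized_by (carrier G) Y" "card (S \<inter> Y) = p ^ d"
    and T: "normalized_by (normalizer_of S) T" "S \<inter> Y \<subseteq> T" "T \<subseteq> S"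
  shows "fusion_closed T"
proof -
  note sY = normalized_by_subgroup[OF Y(1)] and sT = normalized_by_subgroup[OF T(1)]
  define C1 where "C1 = S \<inter> Y"
  have sC1: "subgroup C1 G" unfolding C1_def using subgroups_Inter_pair[OF S sY] .
  have Ssub: "S \<subseteq> carrier G" using subgroup.subset[OF S] .
  note Sc = sub_carrier[OF S] and Yc = sub_carrier[OF sY]
  have nSC1: "normalized_by S C1"
    unfolding C1_def
      using normalized_by_Int[OF normalized_by_self[OF S] normalized_by_mono[OF Y(1) Ssub]] .
  have "conj_by g x \<in> T" if x: "x \<in> T" and g: "g \<in> carrier G" and gx: "conj_by g x \<in> S" for x g
  proof (cases "x \<in> C1")
    case True
    then have "conj_by g x \<in> Y" using normalized_by_conj_by[OF Y(1) g] by (simp add: C1_def)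
    then show ?thesis using gx T(2) by blast
  next
    case False
    have xS: "x \<in> S" using x T(3) by blast
    have xc: "x \<in> carrier G" using xS Sc by blast
    define x' where "x' = conj_by g x"
    have x'c: "x' \<in> carrier G" "x' \<in> S" using gx Sc by (auto simp: x'_def)
    \<comment> \<open>As \<open>x\<close> lies outside \<open>C1\<close>, whose order is
      \<open>p^d\<close>, this group is above the threshold of
      \<open>fusion_controlled\<close>.\<close>
    define Q1 where "Q1 = C1 <#> generate G {x}"
    define Q2 where "Q2 = C1 <#> generate G {x'}"
    have gen: "subgroup (generate G {z}) G" "generate G {z} \<subseteq> S" "z \<in> generate G {z}" if "z \<in> S" for z
      using that Sc S
        by (auto intro!: generate_is_subgroup generate.incl dest: generate_subgroup_incl[THEN subsetD, rotated])
    have Q: "subgroup (C1 <#> generate G {z}) G" "C1 <#> generate G {z} \<subseteq> S"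
      "C1 \<subseteq> C1 <#> generate G {z}" "z \<in> C1 <#> generate G {z}"
      if z: "z \<in> S" for z
    proof -
      show "subgroup (C1 <#> generate G {z}) G"
        using set_mult_subgroup[OF normalized_by_mono[OF nSC1 gen(2)[OF z]] gen(1)[OF z]] .
      show "C1 <#> generate G {z} \<subseteq> S" using set_mult_in[OF S _ gen(2)[OF z]] by (simp add: C1_def)
      show "C1 \<subseteq> C1 <#> generate G {z}" using set_mult_left[OF sC1 gen(1)[OF z]] .
      show "z \<in> C1 <#> generate G {z}" using set_mult_right[OF sC1 gen(1)[OF z]] gen(3)[OF z] by blast
    qed
    note Q1 = Q[OF xS, folded Q1_def] and Q2 = Q[OF x'c(2), folded Q2_def]
    have "C1 \<subset> Q1" using Q1(3,4) False by blast
    then have cQ1: "p ^ d < card Q1" using psubset_card_mono[OF fin_sub[OF Q1(1)]] Y(2) by (metis C1_def)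
    have YQ2: "Y \<inter> Q2 = S \<inter> Y" using Q2(2,3) by (auto simp: C1_def)
    have Q2sub: "Q2 \<subseteq> carrier G" using subgroup.subset[OF Q2(1)] .
    have nY: "normalized_by Q2 Y" using normalized_by_mono[OF Y(1) Q2sub] .
    obtain k1 where k1: "card Q1 = p ^ k1" using pgroup_sub[OF Q1(1) S Q1(2) cS p] by blast
    obtain k2 where k2: "card Q2 = p ^ k2" using pgroup_sub[OF Q2(1) S Q2(2) cS p] by blast
    define B where "B = Y <#> Q2"
    have sB: "subgroup B G" unfolding B_def using set_mult_subgroup[OF nY Q2(1)] .
    \<comment> \<open>\<open>Q2\<close> meets \<open>Y\<close> in the Sylow subgroup
      \<open>S \<inter> Y\<close>, so it is Sylow in \<open>Y Q2\<close>, which also contains the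
      image of \<open>Q1\<close> under \<open>g\<close>.\<close>
    have syB: "sylow_in p B Q2" unfolding B_def
      using sylow_in_of_product[OF p Q2(1) k2 nY] sylow_in_normal[OF Y(1)] YQ2 by simp
    have YB: "Y \<subseteq> B" and QB: "Q2 \<subseteq> B" unfolding B_def
      using set_mult_left[OF sY Q2(1)] set_mult_right[OF sY Q2(1)] by auto
    have genx': "conj_by g z \<in> generate G {x'}" if z: "z \<in> generate G {x}" for z
    proof -
      obtain k :: nat where k: "z = x [^] k" using z generate_pow_nat[OF xc] ord_ge_1[OF fin xc] by auto
      have "conj_by g z = x' [^] k" unfolding k x'_def using conj_by_pow[OF g xc] .
      then show ?thesis using subgroup_pow_closed[OF gen(1,3)[OF x'c(2)]] by simp
    qed
    have gQ1: "conj_by g ` Q1 \<subseteq> B"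
    proof
      fix w assume "w \<in> conj_by g ` Q1"
      then obtain c z where cz: "c \<in> C1" "z \<in> generate G {x}" "w = conj_by g (c \<otimes> z)"
        by (auto simp: Q1_def set_mult_def)
      have "w = conj_by g c \<otimes> conj_by g z"
        unfolding cz(3) using g cz(1) sub_carrier[OF sC1] sub_carrier[OF gen(1)[OF xS] cz(2)]
          by (intro conj_by_mult) auto
      moreover have "conj_by g c \<in> B" using normalized_by_conj_by[OF Y(1) g] cz(1) YB
        by (auto simp: C1_def)
      moreover have "conj_by g z \<in> B"
        using genx'[OF cz(2)] set_mult_right[OF sC1 gen(1)[OF x'c(2)]] QB by (auto simp: Q2_def)
      ultimately show "w \<in> B" using subgroup.m_closed[OF sB] by simp
    qed
    have sgQ1: "subgroup (conj_by g ` Q1) G" using conj_by_image_subgroup[OF g Q1(1)] .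
    have "card (conj_by g ` Q1) = p ^ k1"
      using card_conj_by_image[OF g subgroup.subset[OF Q1(1)]] k1 by simp
    then obtain b where b: "b \<in> B" "conj_by b ` conj_by g ` Q1 \<subseteq> Q2"
      using sylow_in_absorbs[OF sB p syB sgQ1 gQ1] by blast
    obtain y s where ys: "y \<in> Y" "s \<in> Q2" "b = y \<otimes> s" using b(1) by (auto simp: B_def set_mult_def)
    have car: "y \<in> carrier G" "s \<in> carrier G" using ys Yc Q2sub by auto
    \<comment> \<open>The factor \<open>s\<close> of \<open>b\<close> preserves \<open>Q2\<close>,
      so only the factor \<open>y\<close> from \<open>Y\<close> is kept.\<close>
    have into: "conj_by (g \<otimes> y) z \<in> Q2" if z: "z \<in> Q1" for z
    proof -
      have zc: "z \<in> carrier G" using z sub_carrier[OF Q1(1)] by blast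
      have "conj_by b (conj_by g z) \<in> Q2" using b(2) z by blast
      then have "conj_by (inv s) (conj_by b (conj_by g z)) \<in> Q2"
        using normalized_by_conj_by[OF normalized_by_self[OF Q2(1)] subgroup.m_inv_closed[OF Q2(1) ys(2)]] by blast
      moreover have "conj_by (inv s) (conj_by b (conj_by g z)) = conj_by (g \<otimes> y) z"
        unfolding ys(3) using car g zc by (simp add: conj_by_def group_word_simps)
      ultimately show ?thesis by simp
    qed
    obtain m where m: "m \<in> normalizer_of S" "\<forall>z\<in>Q1. conj_by (g \<otimes> y) z = conj_by m z"
      using fusion_controlled[OF Q1(1,2) cQ1, of "g \<otimes> y"] g car(1) into Q2(2) by blast
    define w where "w = conj_by y x'"
    have wm: "w = conj_by m x" using m(2) Q1(4) g car(1) xc by (simp add: w_def x'_def conj_by_conj_by)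
    then have wT: "w \<in> T" using normalized_by_conj_by[OF T(1) m(1) x] by simp
    have wS: "w \<in> S" using wT T(3) by blast
    \<comment> \<open>\<open>x'^-1 w\<close> is the commutator \<open>[x',y]\<close>, so it lies in
      \<open>S \<inter> Y\<close>; as \<open>w\<close> is already in \<open>T\<close>, so is
      \<open>x'\<close>.\<close>
    have "inv x' \<otimes> w \<in> S" using x'c(2) wS subgroup.m_closed[OF S] subgroup.m_inv_closed[OF S] by blast
    moreover have "inv x' \<otimes> w \<in> Y"
    proof -
      have "conj_by x' (inv y) \<otimes> y \<in> Y"
        using normalized_by_conj_by[OF Y(1) x'c(1) subgroup.m_inv_closed[OF sY ys(1)]] ys(1)
          subgroup.m_closed[OF sY] by blast
      moreover have "inv x' \<otimes> w = conj_by x' (inv y) \<otimes> y" using car x'c(1)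
        by (simp add: w_def conj_by_def group_word_simps)
      ultimately show ?thesis by simp
    qed
    ultimately have "inv x' \<otimes> w \<in> T" using T(2) by blast
    then have "inv x' \<in> T" using sub_mult_right_iff[OF sT wT, of "inv x'"] x'c(1) by simp
    then show ?thesis using sub_inv_iff[OF sT x'c(1)] by (simp add: x'_def)
  qed
  then show ?thesis using sT T(3) by (simp add: fusion_closed_def)
qed

lemma prime_chain_S: "prime_chain S"
proof -
  let ?G = "carrier G"
  have sG: "subgroup ?G G" by (rule subgroup_self)
  have n1: "normalized_by ?G {\<one>}" by (rule normalized_by_one) simp
  have fam: "finite {W. normalized_by ?G W \<and> P W}" for P
    by (rule finite_subset[of _ "Pow ?G"]) (auto dest!: normalized_by_subgroup subgroup.subset)
  have S1: "S \<inter> {\<one>} = {\<one>}" using subgroup.one_closed[OF S] by blast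
  obtain Y where Y: "normalized_by ?G Y" "card (S \<inter> Y) \<le> p ^ d"
    "\<And>W. normalized_by ?G W \<Longrightarrow> card (S \<inter> W) \<le> p ^ d \<Longrightarrow> Y \<subseteq> W \<Longrightarrow> W = Y"
  proof -
    have "{\<one>} \<in> {W. normalized_by ?G W \<and> card (S \<inter> W) \<le> p ^ d}" using n1 S1 p_gt_1 by simp
    then obtain Y where "Y \<in> {W. normalized_by ?G W \<and> card (S \<inter> W) \<le> p ^ d}"
      "\<forall>W\<in>{W. normalized_by ?G W \<and> card (S \<inter> W) \<le> p ^ d}. Y \<subseteq> W \<longrightarrow> Y = W"
      using finite_has_maximal[OF fam[of "\<lambda>W. card (S \<inter> W) \<le> p ^ d"]]
        by (metis (no_types, lifting) empty_iff)
    then show thesis by (intro that[of Y]) auto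
  qed
  note sY = normalized_by_subgroup[OF Y(1)]
  \<comment> \<open>If the order were smaller, the next chief factor could not jump over
    \<open>p^d\<close>, against the maximality of \<open>Y\<close>.\<close>
  have Yeq: "card (S \<inter> Y) = p ^ d"
  proof (rule ccontr)
    assume "card (S \<inter> Y) \<noteq> p ^ d"
    then have lt: "card (S \<inter> Y) < p ^ d" using Y(2) by simp
    have "Y \<noteq> ?G"
    proof
      assume "Y = ?G"
      then have "S \<inter> Y = S" using subgroup.subset[OF S] by blast
      then have "p ^ n < p ^ d" using lt cS by simp
      then show False using d p_gt_1 by simp
    qed
    then have "Y \<subset> ?G" using subgroup.subset[OF sY] by blast
    then obtain M where M: "chief_in ?G M Y"
      using chief_in_min_exists[OF normalized_by_self[OF sG] Y(1)] by blast
    have "card (S \<inter> M) \<le> p ^ d" using chief_not_straddling[OF M lt] .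
    then show False using Y(3)[OF chief_inD(1)[OF M]] chief_inD(3)[OF M] by blast
  qed
  have "prime_chain (S \<inter> Y)"
  proof -
    have "{\<one>} \<in> {W. normalized_by ?G W \<and> W \<subseteq> Y \<and> prime_chain (S \<inter> W)}"
      using n1 subgroup.one_closed[OF sY] prime_chain_one S1 by simp
    then obtain W where W: "W \<in> {W. normalized_by ?G W \<and> W \<subseteq> Y \<and> prime_chain (S \<inter> W)}"
      "\<forall>W'\<in>{W. normalized_by ?G W \<and> W \<subseteq> Y \<and> prime_chain (S \<inter> W)}. W \<subseteq> W' \<longrightarrow> W = W'"
      using finite_has_maximal[OF fam[of "\<lambda>W. W \<subseteq> Y \<and> prime_chain (S \<inter> W)"]]
        by (metis (no_types, lifting) empty_iff)
    then have nW: "normalized_by ?G W" "W \<subseteq> Y" "prime_chain (S \<inter> W)" by auto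
    have "W = Y"
    proof (rule ccontr)
      assume "W \<noteq> Y"
      then have "W \<subset> Y" using nW(2) by blast
      then obtain K where K: "chief_in ?G K W" "K \<subseteq> Y" using chief_in_min_exists[OF Y(1) nW(1)] by blast
      note chK = chief_inD[OF K(1)]
      have sSK: "subgroup (S \<inter> K) G" using subgroups_Inter_pair[OF S chK(4)] .
      \<comment> \<open>A chief factor of order prime to \<open>p\<close> leaves the intersection
        with \<open>S\<close> unchanged; any other adds one step.\<close>
      have "prime_chain (S \<inter> K)"
      proof (cases "S \<inter> K = S \<inter> W")
        case True then show ?thesis using nW(3) by simp
      next
        case False
        have sub: "S \<inter> W \<subseteq> S \<inter> K" using chK(3) by blast
        then have lt: "card (S \<inter> W) < card (S \<inter> K)" using False fin_sub[OF sSK]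
          by (intro psubset_card_mono) auto
        have "card (S \<inter> K) \<le> card (S \<inter> Y)" using K(2) S by (intro card_mono) auto
        then have "card (S \<inter> K) = p * card (S \<inter> W)" using chief_prime_below[OF K(1) _ lt] Yeq by simp
        moreover have "fusion_closed (S \<inter> K)"
          using sSK normalized_by_conj_by[OF chK(1)] by (simp add: fusion_closed_def)
        ultimately show ?thesis using prime_chain_extend[OF nW(3) _ sub] by blast
      qed
      then have "W = K" using W(2) chK K(2) by blast
      then show False using chK(3) by blast
    qed
    then show ?thesis using nW(3) by simp
  qed
  define N where "N = normalizer_of S"
  have sN: "subgroup N G" unfolding N_def using normalizer_of_subgroup[OF S] .
  have nNS: "normalized_by N S" unfolding N_def using normalized_by_normalizer_of[OF S] .
  have SN: "S \<subseteq> N" unfolding N_def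
    using sub_normalizer_of[OF subgroup.subset[OF S] normalized_by_self[OF S]] .
  have dS: "p ^ d < card S" using cS d p_gt_1 by simp
  define Fm where "Fm = {T. normalized_by N T \<and> S \<inter> Y \<subseteq> T \<and> T \<subseteq> S \<and> prime_chain T}"
  have "finite Fm" by (rule finite_subset[of _ "Pow S"]) (use S in \<open>auto simp: Fm_def\<close>)
  moreover have "S \<inter> Y \<in> Fm"
    using \<open>prime_chain (S \<inter> Y)\<close>
      normalized_by_Int[OF nNS normalized_by_mono[OF Y(1) subgroup.subset[OF sN]]]
    by (simp add: Fm_def)
  ultimately obtain T where T: "T \<in> Fm" "\<And>T'. T' \<in> Fm \<Longrightarrow> T \<subseteq> T' \<Longrightarrow> T' = T"
    using finite_has_maximal[of Fm] by (metis empty_iff)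
  then have nT: "normalized_by N T" "S \<inter> Y \<subseteq> T" "T \<subseteq> S" "prime_chain T" by (auto simp: Fm_def)
  have "T = S"
  proof (rule ccontr)
    assume "T \<noteq> S"
    then have "T \<subset> S" using nT(3) by blast
    then obtain K where K: "chief_in N K T" "K \<subseteq> S" using chief_in_min_exists[OF nNS nT(1)] by blast
    note chK = chief_inD[OF K(1)]
    \<comment> \<open>The local result with \<open>P = S\<close>, legitimate because
      \<open>|S| > p^d\<close>.\<close>
    have "card K = p * card T" using chief_factor_prime[OF sN nNS subset_refl SN dS K] .
    moreover have SYK: "S \<inter> Y \<subseteq> K" using nT(2) chK(3) by blast
    have "fusion_closed K" using fusion_closed_above[OF Y(1) Yeq chK(1)[unfolded N_def] SYK K(2)] .
    ultimately have "prime_chain K" using prime_chain_extend[OF nT(4)] chK(3) by blast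
    then have "K = T" using T(2)[of K] chK SYK K(2) by (auto simp: Fm_def)
    then show False using chK(3) by blast
  qed
  then show ?thesis using nT(4) by simp
qed

lemma fusion_closed_imp_strongly_closed:
  assumes T: "fusion_closed T"
  shows "strongly_closed (G\<lparr>carrier := S\<rparr>) (group_fusion G S) T"
  unfolding strongly_closed_def
proof (intro conjI allI impI)
  have T': "subgroup T G" "T \<subseteq> S" using T by (auto simp: fusion_closed_def)
  then show "subgroup T (G\<lparr>carrier := S\<rparr>)" using subgroup_incl[OF T'(1) S] by blast
  fix R \<phi>
  assume a: "subgroup R (G\<lparr>carrier := S, carrier := T\<rparr>) \<and> \<phi> \<in> group_fusion G S R (carrier (G\<lparr>carrier := S\<rparr>))"
  then have RT: "R \<subseteq> T" using subgroup.subset[of R "G\<lparr>carrier := S, carrier := T\<rparr>"] by simp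
  from a obtain g where g: "g \<in> carrier G" "\<phi> = (\<lambda>x\<in>R. conj_by g x)" "\<phi> ` R \<subseteq> S"
    by (auto simp: group_fusion_def conj_by_def)
  show "\<phi> ` R \<subseteq> T"
  proof
    fix y assume "y \<in> \<phi> ` R"
    then obtain x where x: "x \<in> R" "y = conj_by g x" "y \<in> S" using g by auto
    then show "y \<in> T" using T g(1) RT by (auto simp: fusion_closed_def)
  qed
qed

lemma supersolvable_fusion_S: "supersolvable_fusion (G\<lparr>carrier := S\<rparr>) (group_fusion G S)"
proof -
  obtain m f where f: "f 0 = {\<one>}" "f (m::nat) = S" "\<And>i. i \<le> m \<Longrightarrow> fusion_closed (f i)"
    "\<And>i. i < m \<Longrightarrow> f i \<subseteq> f (Suc i) \<and> card (f (Suc i)) = p * card (f i)"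
    using prime_chain_S unfolding prime_chain_def by blast
  have "cyclic_group (G\<lparr>carrier := f (Suc i)\<rparr> Mod f i)" if i: "i < m" for i
  proof -
    have fc: "fusion_closed (f i)" "fusion_closed (f (Suc i))" using f(3) i by auto
    then have sub: "subgroup (f i) G" "f i \<subseteq> S" "subgroup (f (Suc i)) G" "f (Suc i) \<subseteq> S"
      by (auto simp: fusion_closed_def)
    \<comment> \<open>Conjugation by elements of \<open>S\<close> is part of the fusion, so closed
      subgroups are normal in \<open>S\<close> and the quotients make sense.\<close>
    have "conj_by h x \<in> f i" if hx: "h \<in> S" "x \<in> f i" for h x
    proof -
      have "conj_by h x \<in> S"
        using normalized_by_conj_by[OF normalized_by_self[OF S] hx(1)] hx(2) sub(2) by blast
      then show ?thesis using fc(1) hx sub_carrier[OF S hx(1)] by (simp add: fusion_closed_def)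
    qed
    then have "normalized_by (f (Suc i)) (f i)" using sub by (auto simp: normalized_by_def)
    then show ?thesis using prime_quotient_cyclic[OF p sub(3)] f(4)[OF i] by blast
  qed
  then show ?thesis
    unfolding supersolvable_fusion_def
    using f fusion_closed_imp_strongly_closed by (intro exI[of _ m] exI[of _ f]) simp
qed

end

theorem theorem1p7:
  fixes G :: "('a, 'b) monoid_scheme" and p :: nat and S D :: "'a set"
  assumes "group G" and "finite (carrier G)"
    and "Factorial_Ring.prime p" and "p dvd order G"
    and "sylow_subgroup p G S"
    and "subgroup D (G\<lparr>carrier := S\<rparr>)" and "1 < card D" and "card D < card S"
    and "\<And>A. subgroup A (G\<lparr>carrier := S\<rparr>) \<Longrightarrow> card A = card D \<Longrightarrow> strong_CAP_subgroup A G"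
    and "\<And>A. \<not> comm_group (G\<lparr>carrier := S\<rparr>) \<Longrightarrow> card D = p \<Longrightarrow> p = 2 \<Longrightarrow>
           subgroup A (G\<lparr>carrier := S\<rparr>) \<Longrightarrow> cyclic_group (G\<lparr>carrier := A\<rparr>) \<Longrightarrow> card A = 4 \<Longrightarrow>
           strong_CAP_subgroup A G"
  shows "supersolvable_fusion (G\<lparr>carrier := S\<rparr>) (group_fusion G S)"
proof -
  interpret fin_group G using assms(1,2) by (simp add: fin_group_def fin_group_axioms_def)
  have S: "subgroup S G" "card S = p ^ multiplicity p (order G)" using assms(5)
    by (auto simp: sylow_subgroup_def)
  have sylow_in: "sylow_in p (carrier G) S" using S subgroup.subset[OF S(1)]
    by (simp add: sylow_in_def order_def)
  have D: "subgroup D G" "D \<subseteq> S" using incl_subgroup[OF S(1) assms(6)] subgroup.subset[OF assms(6)]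
    by auto
  obtain d where d: "card D = p ^ d" using pgroup_sub[OF D(1) S(1) D(2) S(2) assms(3)] by blast
  have p1: "1 < p" using assms(3) prime_gt_1_nat by blast
  have "0 < d" using assms(7) d by (cases d) auto
  moreover have "d < multiplicity p (order G)" using assms(8) d S(2) p1 by simp
  moreover have "covers_or_avoids_chief A H"
    if "subgroup A G" "A \<subseteq> S" "card A = p ^ d" "subgroup H G" "A \<subseteq> H" for A H
    using strong_CAP_imp_covers_or_avoids[OF assms(9)] subgroup_incl[OF that(1) S(1) that(2)] that d
      by simp
  moreover have "covers_or_avoids_chief (generate G {a}) H"
    if p2: "p = 2" and d1: "d = 1" and xy: "x \<in> S" "y \<in> S" "x \<otimes>\<^bsub>G\<^esub> y \<noteq> y \<otimes>\<^bsub>G\<^esub> x"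
      and a: "a \<in> S" "group.ord G a = 4" and H: "subgroup H G" "a \<in> H" for x y a H
  proof -
    have ac: "a \<in> carrier G" using a(1) sub_carrier[OF S(1)] by blast
    have sA: "subgroup (generate G {a}) G" using ac by (intro generate_is_subgroup) auto
    have AS: "generate G {a} \<subseteq> S" using a(1) S(1) by (intro generate_subgroup_incl) auto
    have AH: "generate G {a} \<subseteq> H" using H by (intro generate_subgroup_incl) auto
    have nc: "\<not> comm_group (G\<lparr>carrier := S\<rparr>)"
    proof
      assume "comm_group (G\<lparr>carrier := S\<rparr>)"
      then interpret C: comm_group "G\<lparr>carrier := S\<rparr>" .
      show False using C.m_comm[of x y] xy by simp
    qed
    have "strong_CAP_subgroup (generate G {a}) G"
      using assms(10)[OF nc _ p2 subgroup_incl[OF sA S(1) AS] cyclic_group_generate[OF ac]]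
        d d1 generate_pow_card[OF ac] a(2) by simp
    then show ?thesis using strong_CAP_imp_covers_or_avoids[OF _ H(1) AH] by blast
  qed
  ultimately interpret cap_sylow G p "multiplicity p (order G)" d S
    using sylow_in S assms(3) by unfold_locales auto
  show ?thesis by (rule supersolvable_fusion_S)
qed

end
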